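(* Let $G$ be a connected 4-regular graph. Let $v$ and $w$ be adjacent vertices of $G$ which have no common neighbours. Then \[ c_2^{(2)}(G - v) = c_2^{(2)}(G - w). \]
   Context: For a graph $H$, $H-v$ denotes the graph obtained by deleting the vertex $v$ and all edges incident to it. For a connected graph $H$ with at least $3$ vertices, assign a variable $\alpha_e$ to each edge $e$ and define $\Psi_H=\sum_{T}\prod_{e\notin T}\alpha_e$, the sum over all spanning trees $T$ of $H$. For a prime $p$, let $[\Psi_H]_p$ be the number of zeros of $\Psi_H$ in $\mathbb{F}_p^{|E(H)|}$; it is divisible by $p^2$, and $c_2^{(p)}(H)\equiv [\Psi_H]_p/p^2 \pmod p$. *)

theory Defs
  imports Main "HOL-Library.FuncSet" "HOL-Number_Theory.Cong"
begin

text \<open>Graphs are finite undirected multigraphs: an edge \<open>e\<close> has the set \<open>ends G e\<close> of end vertices,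
  which is a singleton when \<open>e\<close> is a loop.\<close>

record ('v, 'e) graph =
  verts :: "'v set"
  edges :: "'e set"
  ends :: "'e \<Rightarrow> 'v set"

definition wf_graph :: "('v, 'e) graph \<Rightarrow> bool" where
  "wf_graph G \<longleftrightarrow> finite (verts G) \<and> finite (edges G) \<and>
     (\<forall>e\<in>edges G. ends G e \<subseteq> verts G \<and> card (ends G e) \<in> {1, 2})"

definition neighbours :: "('v, 'e) graph \<Rightarrow> 'v \<Rightarrow> 'v set" where
  "neighbours G v = {u. \<exists>e\<in>edges G. ends G e = {v, u}}"

text \<open>Loops contribute twice to the degree.\<close>

definition degree :: "('v, 'e) graph \<Rightarrow> 'v \<Rightarrow> nat" where
  "degree G v = card {e \<in> edges G. v \<in> ends G e} + card {e \<in> edges G. ends G e = {v}}"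

definition regular_graph :: "nat \<Rightarrow> ('v, 'e) graph \<Rightarrow> bool" where
  "regular_graph k G \<longleftrightarrow> (\<forall>v\<in>verts G. degree G v = k)"

definition connected_graph :: "('v, 'e) graph \<Rightarrow> bool" where
  "connected_graph G \<longleftrightarrow> verts G \<noteq> {} \<and>
     (\<forall>u\<in>verts G. \<forall>v\<in>verts G. (\<lambda>x y. y \<in> neighbours G x)\<^sup>*\<^sup>* u v)"

text \<open>The cycle runs through the vertices \<open>vs\<close> along the edges \<open>es\<close>; a loop is a cycle of length 1
  and a pair of parallel edges is a cycle of length 2.\<close>

definition is_cycle :: "('v, 'e) graph \<Rightarrow> 'v list \<Rightarrow> 'e list \<Rightarrow> bool" where
  "is_cycle G vs es \<longleftrightarrow> es \<noteq> [] \<and> length vs = length es \<and> distinct vs \<and> distinct es \<and>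
     set es \<subseteq> edges G \<and>
     (\<forall>i<length es. ends G (es ! i) = {vs ! i, vs ! (Suc i mod length vs)})"

definition is_tree :: "('v, 'e) graph \<Rightarrow> bool" where
  "is_tree G \<longleftrightarrow> connected_graph G \<and> (\<nexists>vs es. is_cycle G vs es)"

definition spanning_trees :: "('v, 'e) graph \<Rightarrow> 'e set set" where
  "spanning_trees G = {T. T \<subseteq> edges G \<and> is_tree (G\<lparr>edges := T\<rparr>)}"

definition delete_vertex :: "('v, 'e) graph \<Rightarrow> 'v \<Rightarrow> ('v, 'e) graph" where
  "delete_vertex G v = G\<lparr>verts := verts G - {v}, edges := {e \<in> edges G. v \<notin> ends G e}\<rparr>"

text \<open>The polynomial \<open>\<Psi>\<close>, evaluated at a point \<open>\<alpha>\<close> of a commutative ring.\<close>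

definition graph_poly :: "('v, 'e) graph \<Rightarrow> ('e \<Rightarrow> 'r::comm_ring_1) \<Rightarrow> 'r" where
  "graph_poly G \<alpha> = (\<Sum>T\<in>spanning_trees G. \<Prod>e\<in>edges G - T. \<alpha> e)"

text \<open>Elements of the field with \<open>p\<close> elements are represented by the residues \<open>0, \<dots>, p - 1\<close>.\<close>

definition zero_count :: "nat \<Rightarrow> ('v, 'e) graph \<Rightarrow> nat" where
  "zero_count p G =
     card {\<alpha> \<in> edges G \<rightarrow>\<^sub>E {0..<int p}. [graph_poly G \<alpha> = 0] (mod int p)}"

text \<open>The value is the representative in \<open>{0..<p}\<close> of the residue class; for \<open>p\<close> prime and \<open>G\<close>
  connected with at least 3 vertices the division by \<open>p\<^sup>2\<close> is exact.\<close>

definition c2 :: "nat \<Rightarrow> ('v, 'e) graph \<Rightarrow> nat" where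
  "c2 p G = (zero_count p G div p\<^sup>2) mod p"

end

theory Submission
  imports Defs "HOL-Library.Z2" "HOL-Library.Function_Algebras"
begin

text \<open>Let \<open>K\<close> be the graph \<open>G\<close> without \<open>v\<close> and \<open>w\<close>, with \<open>m\<close> vertices, and suppose that only one edge
  joins \<open>v\<close> and \<open>w\<close>. Let \<open>P\<close> be the set of the three other neighbours of \<open>w\<close> and \<open>Q\<close> that of \<open>v\<close>.
  Expanding the polynomial of \<open>G - v\<close> at the vertex \<open>w\<close> shows that \<open>c\<^sub>2(G - v)\<close> is the parity of the
  number of edge bipartitions of \<open>K\<close> into a spanning tree and a spanning forest with two components that
  do not have \<open>P\<close> on one side. By the matrix-tree theorem modulo 2, this is the parity of the number of
  subgraphs of \<open>K\<close> whose Laplacian over the field with two elements has a kernel of dimension 3 that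
  restricts isomorphically to \<open>P\<close>.

  Now consider all symmetric matrices \<open>M\<close> over that field whose off-diagonal support lies in the edges of
  \<open>K\<close> and whose diagonal is arbitrary. The number of those whose kernel has dimension 3 and restricts
  isomorphically to both \<open>P\<close> and \<open>Q\<close> is symmetric in \<open>v\<close> and \<open>w\<close>. Modulo 2 it equals the number of pairs
  \<open>(M, u)\<close> where the kernel of \<open>M\<close> has dimension 3 and restricts isomorphically to \<open>P\<close>, and \<open>u\<close> is a kernel
  vector that is 1 on \<open>Q\<close>. For a fixed \<open>u\<close> with a zero \<open>x\<close>, the number of these \<open>M\<close> is even: varying the
  row of \<open>x\<close> (three free entries if \<open>x\<close> lies in \<open>P\<close> and four otherwise, besides the diagonal one)
  only imposes two, respectively at most three, linear conditions. So only the constant vector \<open>u\<close>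
  contributes, and then \<open>M\<close> is a Laplacian.\<close>

section \<open>Sums and subspaces over the field with two elements\<close>

text \<open>Summing a polynomial over all points of F_2^E keeps only the coefficient of the product
  of all variables. This is how bipartitions arise, and |E(K)| = 2m - 3 is just the sum of the sizes
  m - 1 and m - 2 of the tree and the forest. A Laplacian cannot be varied in a single row, since
  its diagonal is tied to its other entries. Freeing the diagonal removes this obstacle, and nothing
  is lost: a matrix that kills the constant vector is again a Laplacian. The numbers three and four
  come from the degrees. A vertex of K keeps four edges unless it is a neighbour of \<open>v\<close>
  or \<open>w\<close>; since these have no common neighbour, a vertex of P only loses its edge to
  \<open>w\<close>. The rows of Q are never varied, because u is 1 there. The vector u can replace
  the condition on Q because an 8-element space has exactly one vector that is 1 on Q if it
  restricts isomorphically to Q, and an even number of them otherwise. If several edges join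
  \<open>v\<close> and \<open>w\<close>, the count reduces to tree counts, which do not depend on
  whether the star of \<open>v\<close> or that of \<open>w\<close> is attached to K. Loops, repeated
  neighbours and very small K are treated separately.\<close>

declare add_bit_eq_xor [simp del] mult_bit_eq_and [simp del]
declare sum_of_bool_eq [simp del] sum_of_bool_mult_eq [simp del] sum_mult_of_bool_eq [simp del]

lemma bit_add_self [simp]: "x + x = (0::bit)"
  by (cases x) auto

lemma bit_add_eq_0_iff: "x + y = 0 \<longleftrightarrow> x = (y::bit)"
  by (cases x; cases y) auto

lemma bit_vec_add_self [simp]: "z + z = (0::'v \<Rightarrow> bit)"
  by (simp add: fun_eq_iff)

lemma bit_vec_add_self_left [simp]: "z + (z + y) = (y::'v \<Rightarrow> bit)"
  by (simp add: fun_eq_iff)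

lemma bit_vec_add_eq_0_iff: "z + y = 0 \<longleftrightarrow> z = (y::'v \<Rightarrow> bit)"
  by (simp add: fun_eq_iff bit_add_eq_0_iff)

lemma of_nat_bit_eq_0_iff: "of_nat n = (0::bit) \<longleftrightarrow> even n"
  by (induction n) (auto simp: bit_add_eq_0_iff)

lemma sum_of_bool_bit:
  "finite X \<Longrightarrow> (\<Sum>x\<in>X. of_bool (P x) :: bit) = of_nat (card {x \<in> X. P x})"
  by (simp add: sum_of_bool_eq Int_def)

lemma of_bool_bit_eq_0 [simp]: "(of_bool P :: bit) = 0 \<longleftrightarrow> \<not> P"
  by (cases P) auto

lemma of_bool_bit_eq_1 [simp]: "(of_bool P :: bit) = 1 \<longleftrightarrow> P"
  by (cases P) auto

lemma bit_eqI: "(x = 1 \<longleftrightarrow> y = 1) \<Longrightarrow> x = (y::bit)"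
  by (cases x; cases y) auto

lemma UNIV_bit: "(UNIV :: bit set) = {0, 1}"
proof (rule set_eqI)
  show "x \<in> UNIV \<longleftrightarrow> x \<in> {0, 1}" for x :: bit by (cases x) auto
qed

text \<open>A fixed-point-free involution that preserves \<open>g\<close> pairs off equal summands,
  and equal bits cancel. Most parity arguments below come down to this pairing.\<close>

lemma sum_involution_eq_0:
  assumes "finite X"
    and "\<And>x. x \<in> X \<Longrightarrow> f x \<in> X \<and> f (f x) = x \<and> f x \<noteq> x \<and> g (f x) = (g x :: bit)"
  shows "sum g X = 0"
  using assms
proof (induction X rule: finite_psubset_induct)
  case (psubset X)
  show ?case
  proof (cases "X = {}")
    case False
    then obtain x where x: "x \<in> X" by blast
    have fx: "f x \<in> X" "f (f x) = x" "f x \<noteq> x" "g (f x) = g x"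
      using psubset.prems[OF x] by auto
    let ?Y = "X - {x, f x}"
    have "sum g ?Y = 0"
    proof (rule psubset.IH)
      show "?Y \<subset> X" using x by blast
      fix y assume y: "y \<in> ?Y"
      then have "f y \<in> X" "f (f y) = y" "f y \<noteq> y" "g (f y) = g y"
        using psubset.prems[of y] by auto
      then show "f y \<in> ?Y \<and> f (f y) = y \<and> f y \<noteq> y \<and> g (f y) = g y"
        using y fx by auto
    qed
    moreover have "sum g X = sum g ?Y + sum g {x, f x}"
      using psubset.hyps x fx by (subst sum.subset_diff[of "{x, f x}" X]) auto
    ultimately show ?thesis using fx by simp
  qed simp
qed

abbreviation sym_difference :: "'a set \<Rightarrow> 'a set \<Rightarrow> 'a set" where
  "sym_difference S T \<equiv> (S - T) \<union> (T - S)"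

lemma sum_sym_difference:
  fixes f :: "'a \<Rightarrow> bit"
  assumes "finite S" "finite T"
  shows "(\<Sum>e\<in>sym_difference S T. f e) = (\<Sum>e\<in>S. f e) + (\<Sum>e\<in>T. f e)"
proof -
  have "(\<Sum>e\<in>S. f e) = (\<Sum>e\<in>S \<inter> T. f e) + (\<Sum>e\<in>S - T. f e)"
    using assms by (intro sum.Int_Diff)
  moreover have "(\<Sum>e\<in>T. f e) = (\<Sum>e\<in>S \<inter> T. f e) + (\<Sum>e\<in>T - S. f e)"
    using assms sum.Int_Diff[of T f S] by (simp add: Int_commute)
  moreover have "(\<Sum>e\<in>sym_difference S T. f e) = (\<Sum>e\<in>S - T. f e) + (\<Sum>e\<in>T - S. f e)"
    using assms by (intro sum.union_disjoint) auto
  ultimately show ?thesis by (simp add: algebra_simps)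
qed

text \<open>Symmetric difference with \<open>S0\<close> is a translation of F_2^E, which has no
  fixed point as \<open>S0\<close> is nonempty.\<close>

lemma sum_Pow_toggle_eq_0:
  assumes "finite E" "S0 \<subseteq> E" "S0 \<noteq> {}"
    and "\<And>S. S \<subseteq> E \<Longrightarrow> g (sym_difference S S0) = (g S :: bit)"
  shows "(\<Sum>S\<in>Pow E. g S) = 0"
proof (rule sum_involution_eq_0[where f = "\<lambda>S. sym_difference S S0"])
  fix S assume "S \<in> Pow E"
  then show "sym_difference S S0 \<in> Pow E \<and>
      sym_difference (sym_difference S S0) S0 = S \<and>
      sym_difference S S0 \<noteq> S \<and> g (sym_difference S S0) = g S"
    using assms by auto
qed (use assms in simp)

text \<open>An element outside \<open>B\<close> can be toggled. In polynomial terms, summing the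
  monomial with variable set \<open>B\<close> over all points of F_2^E gives 0 unless every variable
  occurs.\<close>

lemma sum_Pow_superset:
  assumes "finite E" "B \<subseteq> E"
  shows "(\<Sum>A\<in>Pow E. of_bool (B \<subseteq> A) :: bit) = of_bool (B = E)"
proof (cases "B = E")
  case True
  then have "{A \<in> Pow E. B \<subseteq> A} = {E}" by auto
  moreover have "finite (Pow E)" using assms by simp
  ultimately show ?thesis by (simp only: sum_of_bool_bit True) simp
next
  case False
  then obtain e where "e \<in> E" "e \<notin> B" using assms by blast
  then show ?thesis using assms False
    by (subst sum_Pow_toggle_eq_0[of E "{e}"]) auto
qed

lemma sum_Pow_insert:
  fixes g :: "'a set \<Rightarrow> 'b::comm_monoid_add"
  assumes "finite S" "e \<notin> S"
  shows "(\<Sum>T\<in>Pow (insert e S). g T) = (\<Sum>T\<in>Pow S. g T) + (\<Sum>T\<in>Pow S. g (insert e T))"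
proof -
  have "inj_on (insert e) (Pow S)" using assms by (auto simp: inj_on_def)
  moreover have "Pow S \<inter> insert e ` Pow S = {}" using assms by blast
  ultimately show ?thesis
    using assms by (simp add: Pow_insert sum.union_disjoint sum.reindex)
qed

lemma sum_Pow_union:
  fixes g :: "'a set \<Rightarrow> 'b::comm_monoid_add"
  assumes "finite A" "finite B" "A \<inter> B = {}"
  shows "(\<Sum>T\<in>Pow (A \<union> B). g T) = (\<Sum>F\<in>Pow A. \<Sum>J\<in>Pow B. g (F \<union> J))"
  using assms(2,3,1)
proof (induction B arbitrary: g rule: finite_induct)
  case (insert x B)
  have "(\<Sum>T\<in>Pow (A \<union> insert x B). g T) = (\<Sum>T\<in>Pow (insert x (A \<union> B)). g T)"
    by simp
  also have "\<dots> = (\<Sum>T\<in>Pow (A \<union> B). g T) + (\<Sum>T\<in>Pow (A \<union> B). g (insert x T))"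
    using insert by (intro sum_Pow_insert) auto
  also have "(\<Sum>T\<in>Pow (A \<union> B). g T) = (\<Sum>F\<in>Pow A. \<Sum>J\<in>Pow B. g (F \<union> J))"
    using insert by auto
  also have "(\<Sum>T\<in>Pow (A \<union> B). g (insert x T)) = (\<Sum>F\<in>Pow A. \<Sum>J\<in>Pow B. g (insert x (F \<union> J)))"
    using insert by (auto intro: insert.IH)
  finally show ?case using insert by (simp add: sum_Pow_insert sum.distrib)
qed simp

section \<open>Finite subspaces and duality over the field with two elements\<close>

definition subspace2 :: "('v \<Rightarrow> bit) set \<Rightarrow> bool" where
  "subspace2 U \<longleftrightarrow> finite U \<and> 0 \<in> U \<and> (\<forall>x\<in>U. \<forall>y\<in>U. x + y \<in> U)"

lemma subspace2D:
  assumes "subspace2 U"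
  shows "finite U" "0 \<in> U" "\<And>x y. x \<in> U \<Longrightarrow> y \<in> U \<Longrightarrow> x + y \<in> U"
  using assms by (auto simp: subspace2_def)

lemma subspace2_ker:
  assumes "subspace2 U" "\<And>x y. f (x + y) = f x + (f y :: bit)"
  shows "subspace2 {z \<in> U. f z = 0}"
proof -
  have "f (0 + 0) = f 0 + f 0" by (rule assms)
  then show ?thesis using assms by (auto simp: subspace2_def)
qed

lemma card_ker:
  assumes "subspace2 U" "\<And>x y. f (x + y) = f x + (f y :: bit)" "z \<in> U" "f z = 1"
  shows "card U = 2 * card {z \<in> U. f z = 0}"
proof -
  have "bij_betw (\<lambda>x. x + z) {z \<in> U. f z = 0} {z \<in> U. f z = 1}"
    by (rule bij_betwI[where g = "\<lambda>x. x + z"])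
      (use assms subspace2D in \<open>auto simp: add.assoc\<close>)
  then have "card {z \<in> U. f z = 0} = card {z \<in> U. f z = 1}" by (rule bij_betw_same_card)
  moreover have "U = {z \<in> U. f z = 0} \<union> {z \<in> U. f z = 1}" by auto
  then have "card U = card {z \<in> U. f z = 0} + card {z \<in> U. f z = 1}"
    using card_Un_disjoint[of "{z \<in> U. f z = 0}" "{z \<in> U. f z = 1}"] subspace2D(1)[OF assms(1)]
    by fastforce
  ultimately show ?thesis by simp
qed

text \<open>The nontrivial character of the additive group of the field, with integer values so that
  character sums can count elements.\<close>

definition sign :: "bit \<Rightarrow> int" where
  "sign x = (if x = 0 then 1 else -1)"

text \<open>Orthogonality of characters: translation by a vector \<open>z\<close> of
  \<open>U\<close> with \<open>f z = 1\<close> negates the sum.\<close>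

lemma sum_sign:
  assumes "subspace2 U" "\<And>x y. f (x + y) = f x + (f y :: bit)"
  shows "(\<Sum>z\<in>U. sign (f z)) = (if \<forall>z\<in>U. f z = 0 then int (card U) else 0)"
proof (cases "\<forall>z\<in>U. f z = 0")
  case False
  then obtain z where z: "z \<in> U" "f z = 1" by auto
  have "(\<Sum>x\<in>U. sign (f x)) = (\<Sum>x\<in>U. sign (f (x + z)))"
    by (rule sum.reindex_bij_witness[where i = "\<lambda>x. x + z" and j = "\<lambda>x. x + z"])
      (use assms z subspace2D in \<open>auto simp: add.assoc\<close>)
  also have "\<dots> = - (\<Sum>x\<in>U. sign (f x))"
    unfolding sum_negf[symmetric]
    by (rule sum.cong) (auto simp: assms z sign_def bit_add_eq_0_iff)
  finally show ?thesis using False by auto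
qed (simp add: sign_def)

text \<open>Both sides evaluate the character sum of \<open>sign (q x y)\<close> over \<open>A \<times> B\<close>.\<close>

lemma card_annihilator:
  assumes "subspace2 A" "subspace2 B"
    and "\<And>x x' y. q (x + x') y = q x y + (q x' y :: bit)"
    and "\<And>x y y'. q x (y + y') = q x y + q x y'"
  shows "card {x \<in> A. \<forall>y\<in>B. q x y = 0} * card B = card A * card {y \<in> B. \<forall>x\<in>A. q x y = 0}"
proof -
  have fin: "finite A" "finite B" using assms(1,2) by (auto simp: subspace2_def)
  have "(\<Sum>x\<in>A. \<Sum>y\<in>B. sign (q x y)) = int (card {x \<in> A. \<forall>y\<in>B. q x y = 0} * card B)"
    using assms(4) fin
    by (simp add: sum_sign[OF assms(2)] sum.inter_filter[symmetric])
  moreover have "(\<Sum>y\<in>B. \<Sum>x\<in>A. sign (q x y)) = int (card A * card {y \<in> B. \<forall>x\<in>A. q x y = 0})"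
    using assms(3) fin
    by (simp add: sum_sign[OF assms(1), of "\<lambda>x. q x _"] sum.inter_filter[symmetric])
  moreover have "(\<Sum>x\<in>A. \<Sum>y\<in>B. sign (q x y)) = (\<Sum>y\<in>B. \<Sum>x\<in>A. sign (q x y))"
    by (rule sum.swap)
  ultimately show ?thesis by (simp only: of_nat_eq_iff)
qed

section \<open>Bases of linear forms\<close>

locale bit_forms =
  fixes b :: "'e \<Rightarrow> ('v \<Rightarrow> bit) \<Rightarrow> bit"
  assumes b_add: "b e (x + y) = b e x + b e y"
begin

lemma b_zero [simp]: "b e 0 = 0"
  using b_add[of e 0 0] by simp

abbreviation ker :: "('v \<Rightarrow> bit) set \<Rightarrow> 'e \<Rightarrow> ('v \<Rightarrow> bit) set" where
  "ker U e \<equiv> {z \<in> U. b e z = 0}"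

text \<open>The forms in \<open>T\<close>, restricted to \<open>U\<close>, are a basis of the dual
  space of \<open>U\<close>: the first clause says that they span it, the dual vectors in the second
  that they are independent.\<close>

definition basis :: "('v \<Rightarrow> bit) set \<Rightarrow> 'e set \<Rightarrow> bool" where
  "basis U T \<longleftrightarrow> (\<forall>z\<in>U. (\<forall>e\<in>T. b e z = 0) \<longrightarrow> z = 0) \<and>
     (\<forall>e\<in>T. \<exists>z\<in>U. b e z = 1 \<and> (\<forall>e'\<in>T - {e}. b e' z = 0))"

text \<open>For the coboundary forms of a graph this is the bilinear form of the Laplacian of the
  subgraph with edge set \<open>S\<close>, and \<open>radical\<close> is its kernel.\<close>

definition pairing :: "'e set \<Rightarrow> ('v \<Rightarrow> bit) \<Rightarrow> ('v \<Rightarrow> bit) \<Rightarrow> bit" where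
  "pairing S x y = (\<Sum>e\<in>S. b e x * b e y)"

definition nondegenerate :: "('v \<Rightarrow> bit) set \<Rightarrow> ('v \<Rightarrow> bit) set \<Rightarrow> 'e set \<Rightarrow> bool" where
  "nondegenerate A B S \<longleftrightarrow> (\<forall>x\<in>A. (\<forall>y\<in>B. pairing S x y = 0) \<longrightarrow> x = 0)"

definition radical :: "('v \<Rightarrow> bit) set \<Rightarrow> 'e set \<Rightarrow> ('v \<Rightarrow> bit) set" where
  "radical U S = {z \<in> U. \<forall>y\<in>U. pairing S z y = 0}"

lemma pairing_add:
  "pairing S (x + x') y = pairing S x y + pairing S x' y"
  "pairing S x (y + y') = pairing S x y + pairing S x y'"
  by (simp_all add: pairing_def b_add algebra_simps sum.distrib)

lemma pairing_commute: "pairing S x y = pairing S y x"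
  by (simp add: pairing_def mult.commute)

lemma pairing_insert:
  "finite S \<Longrightarrow> e \<notin> S \<Longrightarrow> pairing (insert e S) x y = b e x * b e y + pairing S x y"
  by (simp add: pairing_def)

lemma pairing_zero [simp]: "pairing S 0 y = 0" "pairing S x 0 = 0"
  by (simp_all add: pairing_def)

lemma subspace2_ker_form: "subspace2 U \<Longrightarrow> subspace2 (ker U e)"
  by (rule subspace2_ker) (auto simp: b_add)

lemma subspace2_radical: "subspace2 U \<Longrightarrow> subspace2 (radical U S)"
  by (auto simp: subspace2_def radical_def pairing_add)

lemma basis_inj: "basis U T \<Longrightarrow> z \<in> U \<Longrightarrow> (\<And>e. e \<in> T \<Longrightarrow> b e z = 0) \<Longrightarrow> z = 0"
  by (simp add: basis_def)

lemma basis_dual: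
  assumes "basis U T" "e \<in> T"
  obtains z where "z \<in> U" "b e z = 1" "\<And>e'. e' \<in> T \<Longrightarrow> e' \<noteq> e \<Longrightarrow> b e' z = 0"
  using assms by (auto simp: basis_def)

lemma basisI:
  assumes "\<And>z. z \<in> U \<Longrightarrow> \<forall>e\<in>T. b e z = 0 \<Longrightarrow> z = 0"
    and "\<And>e. e \<in> T \<Longrightarrow> \<exists>z\<in>U. b e z = 1 \<and> (\<forall>e'\<in>T - {e}. b e' z = 0)"
  shows "basis U T"
  using assms by (simp add: basis_def)

lemma basis_surj:
  assumes U: "subspace2 U" and fin: "finite T" and B: "basis U T"
  obtains y where "y \<in> U" "\<And>e. e \<in> T \<Longrightarrow> b e y = c e"
proof -
  have "\<exists>y\<in>U. \<forall>e\<in>T. b e y = (if e \<in> T0 then c e else 0)" if "finite T0" "T0 \<subseteq> T" for T0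
    using that
  proof (induction T0 rule: finite_induct)
    case empty
    show ?case using subspace2D(2)[OF U] by (metis b_zero empty_iff)
  next
    case (insert t T0)
    then obtain y where y: "y \<in> U" "\<forall>e\<in>T. b e y = (if e \<in> T0 then c e else 0)" by auto
    obtain z where z: "z \<in> U" "b t z = 1" "\<And>e. e \<in> T \<Longrightarrow> e \<noteq> t \<Longrightarrow> b e z = 0"
      using B by (rule basis_dual[of U T t]) (use insert in auto)
    show ?case
    proof (cases "c t = 0")
      case True
      then show ?thesis using y by (intro bexI[of _ y]) auto
    next
      case False
      have "b e (y + z) = (if e \<in> insert t T0 then c e else 0)" if e: "e \<in> T" for e
        using False y z insert e by (cases "e = t") (auto simp: b_add)
      moreover have "y + z \<in> U" using y z U by (simp add: subspace2D)
      ultimately show ?thesis by blast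
    qed
  qed
  from this[OF fin order_refl] show thesis using that by auto
qed

text \<open>This is contraction of \<open>e\<close>. For the converse, a vector with
  \<open>b e z = 1\<close> is corrected by an element of \<open>ker U e\<close>, on which
  \<open>T\<close> takes arbitrary values, so that it vanishes on all of \<open>T\<close>.\<close>

lemma basis_insert:
  assumes U: "subspace2 U" and fin: "finite T" and e: "e \<notin> T"
  shows "basis U (insert e T) \<longleftrightarrow> (\<exists>z\<in>U. b e z = 1) \<and> basis (ker U e) T"
proof
  assume B: "basis U (insert e T)"
  obtain z where "z \<in> U" "b e z = 1" using B by (rule basis_dual[of U "insert e T" e]) auto
  moreover have "basis (ker U e) T"
  proof (rule basisI)
    fix z assume "z \<in> ker U e" "\<forall>e\<in>T. b e z = 0"
    then show "z = 0" using basis_inj[OF B, of z] by auto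
  next
    fix t assume t: "t \<in> T"
    obtain z where "z \<in> U" "b t z = 1" "\<And>e'. e' \<in> insert e T \<Longrightarrow> e' \<noteq> t \<Longrightarrow> b e' z = 0"
      using B by (rule basis_dual[of U "insert e T" t]) (use t in auto)
    then show "\<exists>z\<in>ker U e. b t z = 1 \<and> (\<forall>e'\<in>T - {t}. b e' z = 0)"
      using t e by (intro bexI[of _ z]) auto
  qed
  ultimately show "(\<exists>z\<in>U. b e z = 1) \<and> basis (ker U e) T" by blast
next
  assume R: "(\<exists>z\<in>U. b e z = 1) \<and> basis (ker U e) T"
  then obtain z where z: "z \<in> U" "b e z = 1" by blast
  obtain y where y: "y \<in> ker U e" "\<And>t. t \<in> T \<Longrightarrow> b t y = b t z"
    using basis_surj[OF subspace2_ker_form[OF U] fin, of e "\<lambda>t. b t z"] R by blast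
  show "basis U (insert e T)"
  proof (rule basisI)
    fix z assume "z \<in> U" "\<forall>t\<in>insert e T. b t z = 0"
    then show "z = 0" using basis_inj[of "ker U e" T z] R by auto
  next
    fix t assume t: "t \<in> insert e T"
    show "\<exists>z\<in>U. b t z = 1 \<and> (\<forall>e'\<in>insert e T - {t}. b e' z = 0)"
    proof (cases "t = e")
      case True
      then show ?thesis using y z e U
        by (intro bexI[of _ "y + z"]) (auto simp: b_add subspace2D)
    next
      case False
      obtain x where "x \<in> ker U e" "b t x = 1" "\<And>e'. e' \<in> T \<Longrightarrow> e' \<noteq> t \<Longrightarrow> b e' x = 0"
        using R by (elim conjE basis_dual[of "ker U e" T t]) (use t False in auto)
      then show ?thesis by (intro bexI[of _ x]) auto
    qed
  qed
qed

text \<open>\<open>z\<close> is the vector dual to \<open>e\<close>, so \<open>b e' z\<close> is the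
  coefficient of \<open>e\<close> when the form \<open>e'\<close> is expanded in the basis.\<close>

lemma basis_exchange:
  assumes U: "subspace2 U" and B: "basis U (insert e T)" and e: "e \<notin> T" "e' \<notin> T"
    and z: "z \<in> U" "b e z = 1" "\<And>t. t \<in> T \<Longrightarrow> b t z = 0"
  shows "basis U (insert e' T) \<longleftrightarrow> b e' z = 1"
proof
  assume "basis U (insert e' T)"
  then have "\<not> (\<forall>t\<in>insert e' T. b t z = 0)"
    using basis_inj[of U "insert e' T" z] z b_zero[of e] by force
  then show "b e' z = 1" using z by auto
next
  assume 1: "b e' z = 1"
  show "basis U (insert e' T)"
  proof (rule basisI)
    fix x assume x: "x \<in> U" "\<forall>t\<in>insert e' T. b t x = 0"
    show "x = 0"
    proof (cases "b e x = 0")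
      case True
      then show ?thesis using basis_inj[OF B, of x] x by auto
    next
      case False
      then have "b t (x + z) = 0" if "t \<in> insert e T" for t using x z that by (auto simp: b_add)
      then have "x + z = 0" using basis_inj[OF B, of "x + z"] x z U by (auto simp: subspace2D)
      then show ?thesis using x 1 by (auto simp: bit_vec_add_eq_0_iff)
    qed
  next
    fix t assume t: "t \<in> insert e' T"
    show "\<exists>y\<in>U. b t y = 1 \<and> (\<forall>t'\<in>insert e' T - {t}. b t' y = 0)"
    proof (cases "t = e'")
      case True
      then show ?thesis using z 1 by (intro bexI[of _ z]) auto
    next
      case False
      obtain y where y: "y \<in> U" "b t y = 1" "\<And>t'. t' \<in> insert e T \<Longrightarrow> t' \<noteq> t \<Longrightarrow> b t' y = 0"
        using B by (rule basis_dual[of U "insert e T" t]) (use t False in auto)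
      show ?thesis
      proof (cases "b e' y = 0")
        case True
        then show ?thesis using y False e by (intro bexI[of _ y]) auto
      next
        case F: False
        have "b t' (y + z) = 0" if t': "t' \<in> insert e' T" "t' \<noteq> t" for t'
          using F 1 y(3)[of t'] z(3)[of t'] t' by (auto simp: b_add)
        moreover have "b t (y + z) = 1" using y z False t by (simp add: b_add)
        moreover have "y + z \<in> U" using y z U by (simp add: subspace2D)
        ultimately show ?thesis by blast
      qed
    qed
  qed
qed

lemma card_basis:
  assumes "finite T" "subspace2 U" "basis U T"
  shows "card U = 2 ^ card T"
  using assms
proof (induction T arbitrary: U rule: finite_induct)
  case empty
  then have "U = {0}" by (auto simp: basis_def subspace2D)
  then show ?case by simp
next
  case (insert e T)
  then obtain z where z: "z \<in> U" "b e z = 1" "basis (ker U e) T"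
    by (auto simp: basis_insert)
  then have "card (ker U e) = 2 ^ card T" using insert subspace2_ker_form by blast
  then show ?case using card_ker[of U "b e" z] insert z by (simp add: b_add)
qed

text \<open>\<open>nondegenerate\<close> says that a determinant is 1. Adding the form
  \<open>e\<close> is a rank one perturbation of the matrix, and it changes the determinant by that
  of the restriction to the two kernels.\<close>

lemma nondegenerate_insert:
  assumes A: "subspace2 A" and B: "subspace2 B" and AB: "card A = card B"
    and S: "finite S" "e \<notin> S"
    and a1: "a1 \<in> A" "b e a1 = 1" and b1: "b1 \<in> B" "b e b1 = 1"
  shows "(of_bool (nondegenerate A B (insert e S)) :: bit) =
    of_bool (nondegenerate A B S) + of_bool (nondegenerate (ker A e) (ker B e) S)"
proof -
  note A' = subspace2_ker_form[OF A, of e] and B' = subspace2_ker_form[OF B, of e]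
  have ins: "pairing (insert e S) x y = b e x * b e y + pairing S x y" for x y
    using S by (rule pairing_insert)
  have split: "(\<forall>y\<in>B. pairing X x y = 0) \<longleftrightarrow> pairing X x b1 = 0 \<and> (\<forall>y\<in>ker B e. pairing X x y = 0)"
    for x X
  proof -
    have "pairing X x y = 0" if "pairing X x b1 = 0" "\<forall>y\<in>ker B e. pairing X x y = 0" "y \<in> B" for y
    proof (cases "b e y = 0")
      case False
      then have "y + b1 \<in> ker B e" using that b1 B by (auto simp: b_add subspace2D)
      then have "pairing X x (y + b1) = 0" using that by blast
      then show ?thesis using that by (simp add: pairing_add)
    qed (use that in auto)
    then show ?thesis using b1 by auto
  qed
  show ?thesis
  proof (cases "nondegenerate (ker A e) (ker B e) S")
    case True
    \<comment> \<open>\<open>ker B e\<close> is a hyperplane, so its annihilator \<open>?K\<close>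
      in \<open>A\<close> is nonzero; nondegeneracy on the kernels then makes it a line, spanned by
      a vector \<open>a0\<close> on which \<open>e\<close> is 1.\<close>
    let ?K = "{x \<in> A. \<forall>y\<in>ker B e. pairing S x y = 0}"
    have "card ?K * card (ker B e) = card A * card {y \<in> ker B e. \<forall>x\<in>A. pairing S x y = 0}"
      by (rule card_annihilator[OF A B']) (auto simp: pairing_add)
    moreover have "{y \<in> ker B e. \<forall>x\<in>A. pairing S x y = 0} \<noteq> {}"
      using subspace2D(2)[OF B'] pairing_zero(2) by fastforce
    then have "card {y \<in> ker B e. \<forall>x\<in>A. pairing S x y = 0} \<ge> 1"
      using B by (simp add: Suc_le_eq card_gt_0_iff subspace2D)
    moreover have "card A = 2 * card (ker B e)"
      using card_ker[of B "b e" b1] B b1 AB by (simp add: b_add)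
    moreover have "card (ker B e) > 0" using subspace2D(1,2)[OF B'] card_gt_0_iff by blast
    ultimately have "card ?K \<ge> 2" by (simp add: mult.commute)
    then have "\<not> ?K \<subseteq> {0}" using card_mono[of "{0}" ?K] by auto
    then obtain a0 where a0: "a0 \<in> A" "a0 \<noteq> 0" "\<forall>y\<in>ker B e. pairing S a0 y = 0" by auto
    have ba0: "b e a0 = 1"
      using True a0 unfolding nondegenerate_def by auto
    have K: "x = 0 \<or> x = a0" if x: "x \<in> A" "\<forall>y\<in>ker B e. pairing S x y = 0" for x
    proof (cases "b e x = 0")
      case True': True
      then show ?thesis using True x unfolding nondegenerate_def by auto
    next
      case False
      then have "x + a0 \<in> ker A e" using x a0 ba0 A by (auto simp: b_add subspace2D)
      moreover have "\<forall>y\<in>ker B e. pairing S (x + a0) y = 0" using x a0 by (auto simp: pairing_add)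
      ultimately have "x + a0 = 0" using True unfolding nondegenerate_def by blast
      then show ?thesis by (simp add: bit_vec_add_eq_0_iff)
    qed
    have same: "(\<forall>y\<in>ker B e. pairing (insert e S) x y = 0) \<longleftrightarrow> (\<forall>y\<in>ker B e. pairing S x y = 0)" for x
      by (auto simp: ins)
    \<comment> \<open>The annihilator of \<open>ker B e\<close> is the same line for
      \<open>S\<close> and for \<open>insert e S\<close>, so nondegeneracy is decided by the single
      entry at \<open>a0\<close> and \<open>b1\<close>, which the new form flips.\<close>
    have crit: "nondegenerate A B X \<longleftrightarrow> pairing X a0 b1 = 1"
      if X: "\<And>x. (\<forall>y\<in>ker B e. pairing X x y = 0) \<longleftrightarrow> (\<forall>y\<in>ker B e. pairing S x y = 0)" for X
    proof
      assume "nondegenerate A B X"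
      then have "\<not> (\<forall>y\<in>B. pairing X a0 y = 0)" using a0 unfolding nondegenerate_def by blast
      then have "pairing X a0 b1 \<noteq> 0" using split[of X a0] X[of a0] a0(3) by blast
      then show "pairing X a0 b1 = 1" by simp
    next
      assume 1: "pairing X a0 b1 = 1"
      show "nondegenerate A B X" unfolding nondegenerate_def
      proof (intro ballI impI)
        fix x assume x: "x \<in> A" "\<forall>y\<in>B. pairing X x y = 0"
        then have "\<forall>y\<in>ker B e. pairing S x y = 0" using split[of X x] X[of x] by blast
        then have "x = 0 \<or> x = a0" using K x by blast
        then show "x = 0" using x 1 b1 by auto
      qed
    qed
    note crit[OF refl] moreover note crit[OF same]
    moreover have "pairing (insert e S) a0 b1 = 1 + pairing S a0 b1"
      by (simp add: ins ba0 b1)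
    ultimately show ?thesis using True by (cases "pairing S a0 b1") auto
  next
    case False
    then obtain a where a: "a \<in> A" "b e a = 0" "a \<noteq> 0" "\<forall>y\<in>ker B e. pairing S a y = 0"
      unfolding nondegenerate_def by auto
    have "nondegenerate A B (insert e S) \<longleftrightarrow> nondegenerate A B S"
    proof (cases "pairing S a b1 = 0")
      case True
      then have 1: "\<forall>y\<in>B. pairing S a y = 0" using split a by blast
      then have "\<forall>y\<in>B. pairing (insert e S) a y = 0" using a by (simp add: ins)
      then show ?thesis using 1 a unfolding nondegenerate_def by blast
    next
      case F: False
      have ab: "pairing S a y = b e y" if "y \<in> B" for y
      proof (cases "b e y = 0")
        case True
        then show ?thesis using a that by auto
      next
        case G: False
        then have "y + b1 \<in> ker B e" using that b1 B by (auto simp: b_add subspace2D)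
        then have "pairing S a (y + b1) = 0" using a by blast
        then show ?thesis using F G by (auto simp: pairing_add bit_add_eq_0_iff)
      qed
      \<comment> \<open>A transvection along \<open>a\<close>. Since pairing with \<open>a\<close>
        agrees with the form \<open>e\<close> on \<open>B\<close>, it absorbs the rank one term, and
        both pairings have isomorphic annihilators.\<close>
      define \<theta> where "\<theta> x = (if b e x = 0 then x else x + a)" for x
      have \<theta>: "pairing (insert e S) x y = pairing S (\<theta> x) y" if "y \<in> B" for x y
        using ab[OF that] by (auto simp: ins \<theta>_def pairing_add add.commute)
      have \<theta>2: "\<theta> (\<theta> x) = x" for x using a by (auto simp: \<theta>_def b_add add.assoc)
      have \<theta>A: "\<theta> x \<in> A" if "x \<in> A" for x using a that A by (auto simp: \<theta>_def subspace2D)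
      have \<theta>0: "\<theta> x = 0 \<longleftrightarrow> x = 0" for x using \<theta>2[of x] \<theta>2[of 0] by (auto simp: \<theta>_def)
      show ?thesis
      proof
        assume N: "nondegenerate A B (insert e S)"
        show "nondegenerate A B S" unfolding nondegenerate_def
        proof (intro ballI impI)
          fix x assume x: "x \<in> A" "\<forall>y\<in>B. pairing S x y = 0"
          then have "\<forall>y\<in>B. pairing (insert e S) (\<theta> x) y = 0" by (simp add: \<theta> \<theta>2)
          then have "\<theta> x = 0" using N \<theta>A x unfolding nondegenerate_def by blast
          then show "x = 0" by (simp add: \<theta>0)
        qed
      next
        assume N: "nondegenerate A B S"
        show "nondegenerate A B (insert e S)" unfolding nondegenerate_def
        proof (intro ballI impI)
          fix x assume x: "x \<in> A" "\<forall>y\<in>B. pairing (insert e S) x y = 0"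
          then have "\<forall>y\<in>B. pairing S (\<theta> x) y = 0" by (simp add: \<theta>)
          then have "\<theta> x = 0" using N \<theta>A x unfolding nondegenerate_def by blast
          then show "x = 0" by (simp add: \<theta>0)
        qed
      qed
    qed
    then show ?thesis using False by simp
  qed
qed

text \<open>Both sides obey the same deletion-contraction recursion in the form \<open>e\<close>.\<close>

theorem cauchy_binet:
  assumes "finite S" "subspace2 A" "subspace2 B" "card A = card B"
  shows "(\<Sum>T\<in>Pow S. of_bool (basis A T \<and> basis B T) :: bit) = of_bool (nondegenerate A B S)"
  using assms
proof (induction S arbitrary: A B rule: finite_induct)
  case empty
  have one: "basis X {} \<longleftrightarrow> card X = 1" if "subspace2 X" for X :: "('v \<Rightarrow> bit) set"
  proof
    assume "basis X {}"
    then have "X = {0}" using subspace2D(2)[OF that] by (auto simp: basis_def)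
    then show "card X = 1" by simp
  next
    assume "card X = 1"
    then have "X = {0}" using subspace2D(2)[OF that] by (auto simp: card_1_singleton_iff)
    then show "basis X {}" by (simp add: basis_def)
  qed
  note one[OF empty(1)]
  moreover note one[OF empty(2)]
  moreover have "basis A {} \<longleftrightarrow> nondegenerate A B {}"
    by (auto simp: basis_def nondegenerate_def pairing_def)
  ultimately show ?case using empty by simp
next
  case (insert e S)
  let ?c = "\<lambda>A B. (\<Sum>T\<in>Pow S. of_bool (basis A T \<and> basis B T) :: bit)"
  let ?p = "(\<exists>z\<in>A. b e z = 1) \<and> (\<exists>z\<in>B. b e z = 1)"
  have "(\<Sum>T\<in>Pow (insert e S). of_bool (basis A T \<and> basis B T) :: bit)
      = ?c A B + (\<Sum>T\<in>Pow S. of_bool (basis A (insert e T) \<and> basis B (insert e T)))"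
    using insert by (intro sum_Pow_insert) auto
  also have "(\<Sum>T\<in>Pow S. of_bool (basis A (insert e T) \<and> basis B (insert e T)) :: bit)
      = (\<Sum>T\<in>Pow S. of_bool ?p * of_bool (basis (ker A e) T \<and> basis (ker B e) T))"
  proof (rule sum.cong[OF refl])
    fix T assume "T \<in> Pow S"
    then have "finite T" "e \<notin> T" using insert by (auto intro: finite_subset)
    then show "(of_bool (basis A (insert e T) \<and> basis B (insert e T)) :: bit) =
        of_bool ?p * of_bool (basis (ker A e) T \<and> basis (ker B e) T)"
      using insert.prems by (auto simp: basis_insert)
  qed
  also have "\<dots> = of_bool ?p * ?c (ker A e) (ker B e)"
    by (simp add: sum_distrib_left)
  finally have eq: "(\<Sum>T\<in>Pow (insert e S). of_bool (basis A T \<and> basis B T) :: bit)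
      = ?c A B + of_bool ?p * ?c (ker A e) (ker B e)" .
  show ?case
  proof (cases ?p)
    case True
    then obtain a1 b1 where ab: "a1 \<in> A" "b e a1 = 1" "b1 \<in> B" "b e b1 = 1" by blast
    have "card (ker A e) = card (ker B e)"
      using card_ker[of A "b e" a1] card_ker[of B "b e" b1] ab insert.prems by (simp add: b_add)
    then show ?thesis
      using eq True insert nondegenerate_insert[of A B S e a1 b1] ab
      by (simp add: subspace2_ker_form)
  next
    case False
    have "pairing (insert e S) x y = pairing S x y" if "x \<in> A" "y \<in> B" for x y
      using False that insert by (auto simp: pairing_insert)
    then have "nondegenerate A B (insert e S) = nondegenerate A B S"
      by (simp add: nondegenerate_def)
    then show ?thesis using eq False insert by simp
  qed
qed

end

section \<open>Duality of edge subsets\<close>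

text \<open>For fixed \<open>F\<close> and \<open>F'\<close> the two conditions on \<open>A\<close>
  say that it contains the complement of \<open>F \<inter> F'\<close>; the number of such
  \<open>A\<close> is odd only if the intersection is empty.\<close>

lemma sum_Pow_dual:
  fixes P Q :: "'a set \<Rightarrow> bool"
  assumes E: "finite E"
  shows "(\<Sum>A\<in>Pow E. (\<Sum>F\<in>Pow E. of_bool (E - F \<subseteq> A \<and> P F)) *
            (\<Sum>F\<in>Pow E. of_bool (E - F \<subseteq> A \<and> Q F)) :: bit) =
         (\<Sum>F\<in>Pow E. \<Sum>F'\<in>Pow E. of_bool (P F \<and> Q F' \<and> F \<inter> F' = {}))"
proof -
  have "(\<Sum>A\<in>Pow E. (\<Sum>F\<in>Pow E. of_bool (E - F \<subseteq> A \<and> P F)) *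
          (\<Sum>F\<in>Pow E. of_bool (E - F \<subseteq> A \<and> Q F)) :: bit) =
      (\<Sum>A\<in>Pow E. \<Sum>F\<in>Pow E. \<Sum>F'\<in>Pow E. of_bool (P F \<and> Q F') * of_bool (E - F \<inter> F' \<subseteq> A))"
    unfolding sum_product by (intro sum.cong refl) auto
  also have "\<dots> = (\<Sum>F\<in>Pow E. \<Sum>A\<in>Pow E. \<Sum>F'\<in>Pow E. of_bool (P F \<and> Q F') * of_bool (E - F \<inter> F' \<subseteq> A))"
    by (rule sum.swap)
  also have "\<dots> = (\<Sum>F\<in>Pow E. \<Sum>F'\<in>Pow E. \<Sum>A\<in>Pow E. of_bool (P F \<and> Q F') * of_bool (E - F \<inter> F' \<subseteq> A))"
    by (intro sum.cong refl sum.swap)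
  also have "\<dots> = (\<Sum>F\<in>Pow E. \<Sum>F'\<in>Pow E. of_bool (P F \<and> Q F') * of_bool (E - F \<inter> F' = E))"
    unfolding sum_distrib_left[symmetric] using E by (simp add: sum_Pow_superset)
  also have "\<dots> = (\<Sum>F\<in>Pow E. \<Sum>F'\<in>Pow E. of_bool (P F \<and> Q F' \<and> F \<inter> F' = {}))"
  proof (intro sum.cong refl)
    fix F F' assume "F \<in> Pow E" "F' \<in> Pow E"
    then have "E - F \<inter> F' = E \<longleftrightarrow> F \<inter> F' = {}" by blast
    then show "(of_bool (P F \<and> Q F') * of_bool (E - F \<inter> F' = E) :: bit) =
        of_bool (P F \<and> Q F' \<and> F \<inter> F' = {})" by simp
  qed
  finally show ?thesis .
qed

lemma sum_Pow_subsets: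
  fixes P :: "'a set \<Rightarrow> bool"
  assumes "finite E" "S \<subseteq> E"
  shows "(\<Sum>F\<in>Pow S. of_bool (P F) :: bit) = (\<Sum>F\<in>Pow E. of_bool (F \<subseteq> S \<and> P F))"
  using assms by (intro sum.mono_neutral_cong_left) auto

text \<open>Here \<open>S\<close> has to contain \<open>F \<union> F'\<close>, which an odd number
  of sets do only if the union is \<open>E\<close>.\<close>

lemma sum_Pow_prim:
  fixes P Q :: "'a set \<Rightarrow> bool"
  assumes E: "finite E"
  shows "(\<Sum>S\<in>Pow E. (\<Sum>F\<in>Pow S. of_bool (P F)) * (\<Sum>F\<in>Pow S. of_bool (Q F)) :: bit) =
         (\<Sum>F\<in>Pow E. \<Sum>F'\<in>Pow E. of_bool (P F \<and> Q F' \<and> F \<union> F' = E))"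
proof -
  have "(\<Sum>S\<in>Pow E. (\<Sum>F\<in>Pow S. of_bool (P F)) * (\<Sum>F\<in>Pow S. of_bool (Q F)) :: bit) =
      (\<Sum>A\<in>Pow E. \<Sum>F\<in>Pow E. \<Sum>F'\<in>Pow E. of_bool (P F \<and> Q F') * of_bool (F \<union> F' \<subseteq> A))"
  proof (intro sum.cong refl)
    fix S assume "S \<in> Pow E"
    then have SE: "S \<subseteq> E" by simp
    have "(\<Sum>F\<in>Pow S. of_bool (P F)) * (\<Sum>F\<in>Pow S. of_bool (Q F)) =
       (\<Sum>F\<in>Pow E. of_bool (F \<subseteq> S \<and> P F)) * (\<Sum>F\<in>Pow E. of_bool (F \<subseteq> S \<and> Q F) :: bit)"
      by (simp only: sum_Pow_subsets[OF E SE])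
    also have "\<dots> = (\<Sum>F\<in>Pow E. \<Sum>F'\<in>Pow E. of_bool (P F \<and> Q F') * of_bool (F \<union> F' \<subseteq> S))"
      unfolding sum_product by (intro sum.cong refl) auto
    finally show "(\<Sum>F\<in>Pow S. of_bool (P F)) * (\<Sum>F\<in>Pow S. of_bool (Q F) :: bit) = \<dots>" .
  qed
  also have "\<dots> = (\<Sum>F\<in>Pow E. \<Sum>A\<in>Pow E. \<Sum>F'\<in>Pow E. of_bool (P F \<and> Q F') * of_bool (F \<union> F' \<subseteq> A))"
    by (rule sum.swap)
  also have "\<dots> = (\<Sum>F\<in>Pow E. \<Sum>F'\<in>Pow E. \<Sum>A\<in>Pow E. of_bool (P F \<and> Q F') * of_bool (F \<union> F' \<subseteq> A))"
    by (intro sum.cong refl sum.swap)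
  also have "\<dots> = (\<Sum>F\<in>Pow E. \<Sum>F'\<in>Pow E. of_bool (P F \<and> Q F' \<and> F \<union> F' = E))"
  proof (intro sum.cong refl)
    fix F F' assume "F \<in> Pow E" "F' \<in> Pow E"
    then have "F \<union> F' \<subseteq> E" by blast
    from sum_Pow_superset[OF E this]
    show "(\<Sum>A\<in>Pow E. of_bool (P F \<and> Q F') * of_bool (F \<union> F' \<subseteq> A) :: bit) =
        of_bool (P F \<and> Q F' \<and> F \<union> F' = E)"
      unfolding sum_distrib_left[symmetric] by simp
  qed
  finally show ?thesis .
qed

lemma sum_Pow_dual_single:
  assumes "finite E" "\<And>F. F \<subseteq> E \<Longrightarrow> P F \<Longrightarrow> F \<noteq> {}"
  shows "(\<Sum>A\<in>Pow E. \<Sum>F\<in>Pow E. of_bool (E - F \<subseteq> A \<and> P F) :: bit) = 0"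
proof -
  have "(\<Sum>A\<in>Pow E. \<Sum>F\<in>Pow E. of_bool (E - F \<subseteq> A \<and> P F) :: bit) =
      (\<Sum>F\<in>Pow E. of_bool (P F) * (\<Sum>A\<in>Pow E. of_bool (E - F \<subseteq> A)))"
    by (subst sum.swap) (simp add: sum_distrib_left of_bool_conj mult.commute)
  also have "\<dots> = (\<Sum>F\<in>Pow E. of_bool (P F) * of_bool (E - F = E))"
    using assms by (simp add: sum_Pow_superset)
  also have "\<dots> = 0"
  proof (intro sum.neutral ballI)
    fix F assume "F \<in> Pow E"
    then have "\<not> (P F \<and> E - F = E)" using assms(2)[of F] by blast
    then show "(of_bool (P F) * of_bool (E - F = E) :: bit) = 0" by auto
  qed
  finally show ?thesis .
qed

lemma sum_Pow_prim_single:
  assumes E: "finite E" and P: "\<not> P E"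
  shows "(\<Sum>S\<in>Pow E. \<Sum>F\<in>Pow S. of_bool (P F) :: bit) = 0"
proof -
  have "(\<Sum>S\<in>Pow E. \<Sum>F\<in>Pow S. of_bool (P F) :: bit) =
      (\<Sum>S\<in>Pow E. \<Sum>F\<in>Pow E. of_bool (F \<subseteq> S \<and> P F))"
    using E by (intro sum.cong refl sum_Pow_subsets) auto
  also have "\<dots> = (\<Sum>F\<in>Pow E. of_bool (P F) * (\<Sum>S\<in>Pow E. of_bool (F \<subseteq> S)))"
    by (subst sum.swap) (simp add: sum_distrib_left of_bool_conj mult.commute)
  also have "\<dots> = (\<Sum>F\<in>Pow E. of_bool (P F) * of_bool (F = E))"
    using E by (simp add: sum_Pow_superset)
  also have "\<dots> = 0" using P by (intro sum.neutral) auto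
  finally show ?thesis .
qed

text \<open>The monomials of a product of complementary degrees that use every edge exactly once are the
  same whether a set of edges is encoded by the variables it contains or by those it omits.\<close>

lemma sum_Pow_dual_eq_prim:
  fixes P Q :: "'a set \<Rightarrow> bool"
  assumes E: "finite E" and pq: "p + q = card E" "p > 0" "q > 0"
    and P: "\<And>F. F \<subseteq> E \<Longrightarrow> P F \<Longrightarrow> card F = p" and Q: "\<And>F. F \<subseteq> E \<Longrightarrow> Q F \<Longrightarrow> card F = q"
  shows "(\<Sum>A\<in>Pow E. (1 + (\<Sum>F\<in>Pow E. of_bool (E - F \<subseteq> A \<and> P F))) *
            (1 + (\<Sum>F\<in>Pow E. of_bool (E - F \<subseteq> A \<and> Q F))) :: bit) =
         (\<Sum>S\<in>Pow E. (1 + (\<Sum>F\<in>Pow S. of_bool (P F))) * (1 + (\<Sum>F\<in>Pow S. of_bool (Q F))))"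
proof -
  \<comment> \<open>With sizes adding up to \<open>card E\<close>, being disjoint and covering
    \<open>E\<close> are equivalent. The terms with only one of the two sums vanish because
    \<open>p\<close> and \<open>q\<close> are positive.\<close>
  have "F \<inter> F' = {} \<longleftrightarrow> F \<union> F' = E" if "F \<subseteq> E" "F' \<subseteq> E" "P F" "Q F'" for F F'
  proof -
    have fin: "finite F" "finite F'" using that E finite_subset by auto
    then have "card (F \<union> F') + card (F \<inter> F') = card E"
      using card_Un_Int[OF fin] P[of F] Q[of F'] that pq by simp
    moreover have "F \<union> F' = E \<longleftrightarrow> card (F \<union> F') = card E"
      using that E card_subset_eq[of E "F \<union> F'"] by auto
    moreover have "F \<inter> F' = {} \<longleftrightarrow> card (F \<inter> F') = 0" using fin by auto
    ultimately show ?thesis by linarith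
  qed
  then have "(\<Sum>F\<in>Pow E. \<Sum>F'\<in>Pow E. of_bool (P F \<and> Q F' \<and> F \<inter> F' = {}) :: bit) =
     (\<Sum>F\<in>Pow E. \<Sum>F'\<in>Pow E. of_bool (P F \<and> Q F' \<and> F \<union> F' = E))"
    by (intro sum.cong refl) auto
  moreover have "\<not> P E" "\<not> Q E" using P[of E] Q[of E] pq by auto
  moreover have "F \<noteq> {}" if "F \<subseteq> E" "P F \<or> Q F" for F using P[of F] Q[of F] that pq by auto
  ultimately show ?thesis
    using E by (simp add: algebra_simps sum.distrib sum_Pow_dual sum_Pow_prim
        sum_Pow_dual_single sum_Pow_prim_single)
qed

context bit_forms
begin

text \<open>If the \<open>s\<close>'s join a graph to an additional vertex, a basis formed by
  \<open>F\<close> and two of them is a spanning tree. So \<open>F\<close> is a spanning forest with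
  two components that do not leave the ends of all three edges on one side.\<close>

definition separating :: "('v \<Rightarrow> bit) set \<Rightarrow> 'e \<Rightarrow> 'e \<Rightarrow> 'e \<Rightarrow> 'e set \<Rightarrow> bool" where
  "separating U s1 s2 s3 F \<longleftrightarrow> basis U (insert s1 (insert s2 F)) \<or>
     basis U (insert s1 (insert s3 F)) \<or> basis U (insert s2 (insert s3 F))"

definition full_on3 :: "'e \<Rightarrow> 'e \<Rightarrow> 'e \<Rightarrow> ('v \<Rightarrow> bit) set \<Rightarrow> bool" where
  "full_on3 s1 s2 s3 R \<longleftrightarrow> card R = 8 \<and>
     (\<forall>z\<in>R. b s1 z = 0 \<longrightarrow> b s2 z = 0 \<longrightarrow> b s3 z = 0 \<longrightarrow> z = 0)"

text \<open>The truth value \<open>c\<close> records whether \<open>Z\<close> is independent on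
  \<open>U\<close>, and therefore does not depend on \<open>T\<close>.\<close>

lemma basis_contract:
  assumes "finite Z" "subspace2 U"
  shows "\<exists>c. \<forall>T. finite T \<longrightarrow> T \<inter> Z = {} \<longrightarrow>
    (basis U (Z \<union> T) \<longleftrightarrow> c \<and> basis {z \<in> U. \<forall>e\<in>Z. b e z = 0} T)"
  using assms
proof (induction Z arbitrary: U rule: finite_induct)
  case (insert e Z)
  obtain c where c: "\<And>T. finite T \<Longrightarrow> T \<inter> Z = {} \<Longrightarrow>
      basis (ker U e) (Z \<union> T) \<longleftrightarrow> c \<and> basis {z \<in> ker U e. \<forall>e\<in>Z. b e z = 0} T"
    using insert.IH[of "ker U e"] insert.prems subspace2_ker_form by blast
  have "basis U (insert e Z \<union> T) \<longleftrightarrow>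
      ((\<exists>z\<in>U. b e z = 1) \<and> c) \<and> basis {z \<in> U. \<forall>e\<in>insert e Z. b e z = 0} T"
    if "finite T" "T \<inter> insert e Z = {}" for T
  proof -
    have "{z \<in> ker U e. \<forall>e\<in>Z. b e z = 0} = {z \<in> U. \<forall>e\<in>insert e Z. b e z = 0}" by auto
    then show ?thesis
      using basis_insert[of U "Z \<union> T" e] insert that c[of T] by auto
  qed
  then show ?case by blast
qed auto

lemma subspace2_kers: "subspace2 U \<Longrightarrow> subspace2 {z \<in> U. \<forall>e\<in>Z. b e z = 0}"
  by (auto simp: subspace2_def b_add)

end

text \<open>Here \<open>one\<close> plays the role of the constant vector: it is killed by the edges in \<open>S\<close> of the
  graph and detected by the edges in \<open>W\<close> that join the graph to an additional vertex.\<close>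

locale pointed_forms = bit_forms b for b :: "'e \<Rightarrow> ('v \<Rightarrow> bit) \<Rightarrow> bit" +
  fixes U :: "('v \<Rightarrow> bit) set" and S W :: "'e set" and one :: "'v \<Rightarrow> bit"
  assumes U: "subspace2 U" and S: "finite S" and SW: "S \<inter> W = {}"
    and one: "one \<in> U" "\<And>e. e \<in> S \<Longrightarrow> b e one = 0" "\<And>s. s \<in> W \<Longrightarrow> b s one = 1"
begin

text \<open>The vector \<open>one\<close> is killed by \<open>F\<close> and is 1 on every edge of
  \<open>W\<close>, so it serves as dual vector for the exchange of one such edge for
  another.\<close>

lemma basis_root_indep:
  assumes "F \<subseteq> S" "s \<in> W" "s' \<in> W" "basis U (insert s F)"
  shows "basis U (insert s' F)"
  using basis_exchange[OF U assms(4), of s' one] assms one SW by auto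

lemma basis_insert_root:
  assumes "F \<subseteq> S" "s \<in> W"
  shows "basis U (insert s F) \<longleftrightarrow> basis (ker U s) F"
  using basis_insert[OF U, of F s] assms one SW S finite_subset[of F S] by auto

lemma basis_insert_root2:
  assumes "F \<subseteq> S" "s \<in> W" "p \<in> W" "p \<noteq> s"
  shows "basis U (insert p (insert s F)) \<longleftrightarrow> (\<exists>z\<in>ker U s. b p z = 1) \<and> basis (ker (ker U s) p) F"
proof -
  have F: "finite F" "s \<notin> F" "p \<notin> F" using assms SW S finite_subset[of F S] by auto
  have "basis U (insert p (insert s F)) \<longleftrightarrow> basis U (insert s (insert p F))"
    by (simp add: insert_commute)
  also have "\<dots> \<longleftrightarrow> basis (ker U s) (insert p F)"
    using basis_insert[OF U, of "insert p F" s] F assms one by auto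
  also have "\<dots> \<longleftrightarrow> (\<exists>z\<in>ker U s. b p z = 1) \<and> basis (ker (ker U s) p) F"
    using F by (intro basis_insert subspace2_ker_form U)
  finally show ?thesis .
qed

section \<open>Tree and forest counts in terms of the kernel of the Laplacian\<close>

lemma pairing_one [simp]: "pairing S one y = 0" "pairing S y one = 0"
  unfolding pairing_def using one by (auto intro!: sum.neutral)

lemma one_ne_0: "s \<in> W \<Longrightarrow> one \<noteq> 0"
  using one by (metis b_zero zero_neq_one)

lemma one_radical: "one \<in> radical U S"
  using one by (auto simp: radical_def)

text \<open>\<open>U\<close> is spanned by \<open>ker U s\<close> and \<open>one\<close>, and
  \<open>one\<close> pairs to 0 with everything.\<close>

lemma radical_iff_ker:
  assumes "z \<in> U" "s \<in> W"
  shows "z \<in> radical U S \<longleftrightarrow> (\<forall>y\<in>ker U s. pairing S z y = 0)"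
proof -
  have "pairing S z y = 0" if y: "y \<in> U" and 0: "\<forall>y\<in>ker U s. pairing S z y = 0" for y
  proof (cases "b s y = 0")
    case False
    then have "y + one \<in> ker U s" using assms y U one by (auto simp: b_add subspace2D)
    then have "pairing S z (y + one) = 0" using 0 by blast
    then show ?thesis by (simp add: pairing_add)
  qed (use y 0 in auto)
  then show ?thesis using assms by (auto simp: radical_def)
qed

lemma radical_normalised:
  assumes "radical U S \<noteq> {0, one}" "s \<in> W"
  obtains r where "r \<in> radical U S" "r \<noteq> 0" "b s r = 0"
proof -
  note RR = subspace2_radical[OF U, of S]
  obtain r where r: "r \<in> radical U S" "r \<noteq> 0" "r \<noteq> one"
    using assms one_radical subspace2D(2)[OF RR] by blast
  show thesis
  proof (cases "b s r = 0")
    case False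
    then show thesis
      using r assms one subspace2D(3)[OF RR r(1) one_radical]
      by (intro that[of "r + one"]) (auto simp: b_add bit_vec_add_eq_0_iff)
  qed (use that r in blast)
qed

lemma radical4I:
  assumes r: "r \<in> radical U S" and s: "s \<in> W"
    and uniq: "\<And>x. x \<in> radical U S \<Longrightarrow> b s x = 0 \<Longrightarrow> x = 0 \<or> x = r"
  shows "radical U S = {0, one, r, r + one}"
proof -
  note RR = subspace2_radical[OF U, of S]
  have "x \<in> {0, one, r, r + one}" if x: "x \<in> radical U S" for x
  proof (cases "b s x = 0")
    case False
    then have "b s (x + one) = 0" using one s by (simp add: b_add)
    then have "x + one = 0 \<or> x + one = r" using uniq subspace2D(3)[OF RR x one_radical] by blast
    moreover have "x = r + one" if "x + one = r" using that by (auto simp: add.assoc)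
    ultimately show ?thesis by (auto simp: bit_vec_add_eq_0_iff)
  qed (use uniq x in auto)
  then show ?thesis
    using one_radical subspace2D(2)[OF RR] r subspace2D(3)[OF RR r one_radical] by auto
qed

text \<open>The matrix-tree theorem modulo 2: by \<open>cauchy_binet\<close> the count is the
  determinant of the Laplacian on \<open>ker U s\<close>, which is 1 exactly when the full kernel is
  spanned by \<open>one\<close>.\<close>

lemma sum_basis1:
  assumes s: "s \<in> W"
  shows "(\<Sum>F\<in>Pow S. of_bool (basis U (insert s F)) :: bit) = of_bool (radical U S = {0, one})"
proof -
  have "(\<Sum>F\<in>Pow S. of_bool (basis U (insert s F)) :: bit) =
     (\<Sum>F\<in>Pow S. of_bool (basis (ker U s) F \<and> basis (ker U s) F))"
    using s by (intro sum.cong refl) (auto simp: basis_insert_root)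
  also have "\<dots> = of_bool (nondegenerate (ker U s) (ker U s) S)"
    by (intro cauchy_binet S subspace2_ker_form U refl)
  also have "nondegenerate (ker U s) (ker U s) S \<longleftrightarrow> (\<forall>z\<in>radical U S. b s z = 0 \<longrightarrow> z = 0)"
    unfolding nondegenerate_def using radical_iff_ker[OF _ s]
    by (auto simp: radical_def)
  also have "\<dots> \<longleftrightarrow> radical U S = {0, one}"
  proof
    assume R: "\<forall>z\<in>radical U S. b s z = 0 \<longrightarrow> z = 0"
    have "z = one" if z: "z \<in> radical U S" "z \<noteq> 0" for z
    proof -
      have "b s z = 1" using R z by auto
      then have "b s (z + one) = 0" using one s by (simp add: b_add)
      moreover have "z + one \<in> radical U S"
        using subspace2D(3)[OF subspace2_radical[OF U]] z one_radical by blast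
      ultimately show ?thesis using R by (auto simp: bit_vec_add_eq_0_iff)
    qed
    then show "radical U S = {0, one}"
      using one_radical subspace2D(2)[OF subspace2_radical[OF U]] by auto
  qed (use one s in auto)
  finally show ?thesis .
qed

text \<open>An all-minors version: the Laplacian is restricted to the kernel of \<open>s\<close> and
  \<open>p\<close> on one side and of \<open>s\<close> and \<open>q\<close> on the other. Given that
  it is singular on \<open>ker U s\<close>, such a minor is nonzero only if the kernel has dimension
  2 and its extra vector tells \<open>s\<close> from \<open>p\<close> and from
  \<open>q\<close>.\<close>

lemma sum_basis2:
  assumes s: "s \<in> W" and p: "p \<in> W" "p \<noteq> s" and q: "q \<in> W" "q \<noteq> s"
    and R: "radical U S \<noteq> {0, one}"
  shows "(\<Sum>F\<in>Pow S. of_bool (basis U (insert p (insert s F)) \<and> basis U (insert q (insert s F))) :: bit) =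
     of_bool (\<exists>z. radical U S = {0, one, z, z + one} \<and> b p z \<noteq> b s z \<and> b q z \<noteq> b s z)"
    (is "?L = of_bool ?R")
proof -
  note RR = subspace2_radical[OF U, of S]
  note add = subspace2D(3)[OF RR] 
  let ?U = "ker U s"
  have U1: "subspace2 ?U" using U by (rule subspace2_ker_form)
  show ?thesis
  proof (cases "(\<exists>z\<in>?U. b p z = 1) \<and> (\<exists>z\<in>?U. b q z = 1)")
    case False
    have "\<not> ?R"
    proof
      assume ?R
      then obtain z where z: "radical U S = {0, one, z, z + one}" "b p z \<noteq> b s z" "b q z \<noteq> b s z"
        by blast
      have zU: "z \<in> U" using z(1) by (auto simp: radical_def)
      let ?z = "if b s z = 0 then z else z + one"
      have "?z \<in> ?U" "b p ?z = 1" "b q ?z = 1"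
        using z zU one U s p q by (auto simp: b_add subspace2D)
      then show False using False by blast
    qed
    moreover have "?L = 0"
      using False s p q by (intro sum.neutral) (auto simp: basis_insert_root2)
    ultimately show ?thesis by simp
  next
    case True
    then obtain zp zq where zz: "zp \<in> ?U" "b p zp = 1" "zq \<in> ?U" "b q zq = 1" by blast
    let ?A = "ker ?U p" and ?B = "ker ?U q"
    note A = subspace2_ker_form[OF U1, of p] and B = subspace2_ker_form[OF U1, of q]
    have "card ?U = 2 * card ?A" "card ?U = 2 * card ?B"
      using card_ker[OF U1, of "b p" zp] card_ker[OF U1, of "b q" zq] zz by (simp_all add: b_add)
    then have cAB: "card ?A = card ?B" by simp
    have "?L = (\<Sum>F\<in>Pow S. of_bool (basis ?A F \<and> basis ?B F))"
      using True s p q by (intro sum.cong refl) (auto simp: basis_insert_root2)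
    also have "\<dots> = of_bool (nondegenerate ?A ?B S)"
      by (intro cauchy_binet S A B cAB)
    also have "nondegenerate ?A ?B S \<longleftrightarrow> ?R"
    proof
      assume N: "nondegenerate ?A ?B S"
      have N0: "x = 0" if "x \<in> radical U S" "b s x = 0" "b p x = 0" for x
        using N that unfolding nondegenerate_def radical_def by blast
      obtain r where r: "r \<in> radical U S" "r \<noteq> 0" "b s r = 0" using radical_normalised[OF R s] .
      have rp: "b p r = 1" using N0[OF r(1,3)] r(2) by (metis bit_not_zero_iff)
      have "x = 0 \<or> x = r" if x: "x \<in> radical U S" "b s x = 0" for x
      proof (cases "b p x = 0")
        case False
        then have "b p (x + r) = 0" "b s (x + r) = 0" using rp r x by (simp_all add: b_add)
        then have "x + r = 0" using N0 add x r by blast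
        then show ?thesis by (simp add: bit_vec_add_eq_0_iff)
      qed (use N0 x in auto)
      then have rad: "radical U S = {0, one, r, r + one}" by (rule radical4I[OF r(1) s])
      \<comment> \<open>Otherwise \<open>r\<close> lies in the annihilator of \<open>?A\<close> in
        \<open>?B\<close>. As \<open>?A\<close> and \<open>?B\<close> have equal size, that
        annihilator is as small as the opposite one, which is trivial.\<close>
      have rq: "b q r = 1"
      proof (rule ccontr)
        assume "b q r \<noteq> 1"
        then have "r \<in> {y \<in> ?B. \<forall>x\<in>?A. pairing S x y = 0}"
          using r by (auto simp: radical_def pairing_commute[of S _ r])
        moreover have "0 \<in> {y \<in> ?B. \<forall>x\<in>?A. pairing S x y = 0}"
          using subspace2D(2)[OF B] by simp
        ultimately have "card {0, r} \<le> card {y \<in> ?B. \<forall>x\<in>?A. pairing S x y = 0}"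
          using subspace2D(1)[OF U] by (intro card_mono) auto
        moreover have "card {x \<in> ?A. \<forall>y\<in>?B. pairing S x y = 0} * card ?B =
            card ?A * card {y \<in> ?B. \<forall>x\<in>?A. pairing S x y = 0}"
          by (rule card_annihilator[OF A B]) (auto simp: pairing_add)
        moreover have "{x \<in> ?A. \<forall>y\<in>?B. pairing S x y = 0} = {0}"
        proof
          show "{x \<in> ?A. \<forall>y\<in>?B. pairing S x y = 0} \<subseteq> {0}"
            using N unfolding nondegenerate_def by blast
          show "{0} \<subseteq> {x \<in> ?A. \<forall>y\<in>?B. pairing S x y = 0}"
            using subspace2D(2)[OF A] by simp
        qed
        moreover have "card ?A > 0" using subspace2D(1,2)[OF A] card_gt_0_iff by blast
        ultimately show False using r cAB by simp
      qed
      show ?R using rad r rp rq by (intro exI[of _ r]) auto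
    next
      assume ?R
      then obtain z' where z': "radical U S = {0, one, z', z' + one}" "b p z' \<noteq> b s z'" "b q z' \<noteq> b s z'"
        by blast
      define z where "z = (if b s z' = 0 then z' else z' + one)"
      have z: "radical U S = {0, one, z, z + one}"
        unfolding z_def by (simp add: z' add.assoc insert_commute)
      have zv: "b s z = 0" "b p z = 1" "b q z = 1"
        using z' one s p q by (auto simp: z_def b_add)
      have zr: "z \<in> radical U S" using z by simp
      show "nondegenerate ?A ?B S"
        unfolding nondegenerate_def
      proof (intro ballI impI)
        fix x assume x: "x \<in> ?A" "\<forall>y\<in>?B. pairing S x y = 0"
        have xz: "pairing S x z = 0"
          using zr x by (auto simp: radical_def pairing_commute[of S x])
        have "pairing S x y = 0" if y: "y \<in> ?U" for y
        proof (cases "b q y = 0")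
          case False
          have "z \<in> U" using zr by (simp add: radical_def)
          then have "y + z \<in> ?B" using False y zv U by (auto simp: b_add subspace2D)
          then have "pairing S x (y + z) = 0" using x by blast
          then show ?thesis using xz by (simp add: pairing_add)
        qed (use x y in auto)
        then have "x \<in> radical U S" using radical_iff_ker[of x s] x s by blast
        then show "x = 0" using z zv x one s by (auto simp: b_add)
      qed
    qed
    finally show ?thesis .
  qed
qed

lemma sum_basis2_single:
  assumes "s \<in> W" "p \<in> W" "p \<noteq> s" "radical U S \<noteq> {0, one}"
  shows "(\<Sum>F\<in>Pow S. of_bool (basis U (insert p (insert s F))) :: bit) =
     of_bool (\<exists>z. radical U S = {0, one, z, z + one} \<and> b p z \<noteq> b s z)"
  using sum_basis2[OF assms(1-3,2-4)] by simp

text \<open>The vector \<open>z\<close> in a radical of size 4 is only determined up to adding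
  \<open>one\<close>.\<close>

lemma radical4_unique:
  assumes R: "radical U S = {0, one, z, z + one}" "radical U S \<noteq> {0, one}"
    and X: "X (z + one) \<longleftrightarrow> X z"
  shows "(\<exists>z'. radical U S = {0, one, z', z' + one} \<and> X z') \<longleftrightarrow> X z"
proof
  assume "\<exists>z'. radical U S = {0, one, z', z' + one} \<and> X z'"
  then obtain z' where z': "radical U S = {0, one, z', z' + one}" "X z'" by blast
  have "z' \<noteq> 0" "z' \<noteq> one" using z' R(2) by auto
  moreover have "z' \<in> {0, one, z, z + one}" unfolding R(1)[symmetric] z'(1) by simp
  ultimately show "X z" using z' X by auto
qed (use R in auto)

text \<open>If \<open>z\<close> is dual to \<open>s2\<close> in the given basis, then
  \<open>z + one\<close> is dual to \<open>s1\<close>. The form \<open>s3\<close> is 1 on exactly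
  one of these two vectors, so it can replace exactly one of the two edges.\<close>

lemma basis_two_of_three:
  assumes W: "s1 \<in> W" "s2 \<in> W" "s3 \<in> W" "s1 \<noteq> s2" "s1 \<noteq> s3" "s2 \<noteq> s3" and F: "F \<subseteq> S"
    and B: "basis U (insert s1 (insert s2 F))"
  shows "basis U (insert s1 (insert s3 F)) \<longleftrightarrow> \<not> basis U (insert s2 (insert s3 F))"
proof -
  have nF: "s1 \<notin> F" "s2 \<notin> F" "s3 \<notin> F" using W F SW by auto
  obtain z where z: "z \<in> U" "b s2 z = 1"
      "\<And>t. t \<in> insert s1 (insert s2 F) \<Longrightarrow> t \<noteq> s2 \<Longrightarrow> b t z = 0"
    using B by (rule basis_dual[of U _ s2]) auto
  have "basis U (insert s2 (insert s1 F))" using B by (simp add: insert_commute)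
  then have "basis U (insert s3 (insert s1 F)) \<longleftrightarrow> b s3 z = 1"
    using z nF W by (intro basis_exchange[OF U]) auto
  moreover have "basis U (insert s3 (insert s2 F)) \<longleftrightarrow> b s3 (z + one) = 1"
  proof (rule basis_exchange[OF U B])
    fix t assume "t \<in> insert s2 F"
    then show "b t (z + one) = 0" using z(2) z(3)[of t] one F W nF
      by (cases "t = s2") (auto simp: b_add subset_iff)
  next
    have "b s1 z = 0" using z(3)[of s1] W by auto
    then show "b s1 (z + one) = 1" using one W by (simp add: b_add)
  qed (use z one nF W U in \<open>auto simp: subspace2D\<close>)
  ultimately show ?thesis using one W by (auto simp: b_add insert_commute)
qed

text \<open>Two components leave three ends together or split them 2 to 1; accordingly none or
  exactly two of the three pairs are separated.\<close>

lemma basis_pairs_cases: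
  assumes W: "s1 \<in> W" "s2 \<in> W" "s3 \<in> W" "s1 \<noteq> s2" "s1 \<noteq> s3" "s2 \<noteq> s3" and F: "F \<subseteq> S"
  defines "B \<equiv> \<lambda>s t. basis U (insert s (insert t F))"
  shows "\<not> B s1 s2 \<and> \<not> B s1 s3 \<and> \<not> B s2 s3 \<or> B s1 s2 \<and> B s1 s3 \<and> \<not> B s2 s3 \<or>
    B s1 s2 \<and> \<not> B s1 s3 \<and> B s2 s3 \<or> \<not> B s1 s2 \<and> B s1 s3 \<and> B s2 s3"
proof -
  have c: "B s t = B t s" for s t by (simp add: B_def insert_commute)
  have "B s1 s2 \<longrightarrow> B s1 s3 = (\<not> B s2 s3)"
    using basis_two_of_three[of s1 s2 s3 F] W F by (auto simp: B_def)
  moreover have "B s1 s3 \<longrightarrow> B s1 s2 = (\<not> B s3 s2)"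
    using basis_two_of_three[of s1 s3 s2 F] W F by (auto simp: B_def)
  moreover have "B s2 s3 \<longrightarrow> B s2 s1 = (\<not> B s3 s1)"
    using basis_two_of_three[of s2 s3 s1 F] W F by (auto simp: B_def)
  ultimately show ?thesis unfolding c[of s3 s2] c[of s2 s1] c[of s3 s1] by argo
qed

text \<open>A separating forest isolates exactly one of the three ends, and the forests isolating a
  given end are those counted by \<open>sum_basis2\<close>.\<close>

lemma sum_separating:
  assumes W: "s1 \<in> W" "s2 \<in> W" "s3 \<in> W" "s1 \<noteq> s2" "s1 \<noteq> s3" "s2 \<noteq> s3"
    and R: "radical U S \<noteq> {0, one}"
  shows "(\<Sum>F\<in>Pow S. of_bool (separating U s1 s2 s3 F) :: bit) =
     of_bool (\<exists>z. radical U S = {0, one, z, z + one} \<and> \<not> (b s1 z = b s2 z \<and> b s1 z = b s3 z))"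
proof -
  let ?B = "\<lambda>s t F. basis U (insert s (insert t F))"
  have "(of_bool (separating U s1 s2 s3 F) :: bit) = of_bool (?B s2 s1 F \<and> ?B s3 s1 F) +
      of_bool (?B s1 s2 F \<and> ?B s3 s2 F) + of_bool (?B s1 s3 F \<and> ?B s2 s3 F)" if F: "F \<subseteq> S" for F
  proof -
    have c: "?B s2 s1 F = ?B s1 s2 F" "?B s3 s1 F = ?B s1 s3 F" "?B s3 s2 F = ?B s2 s3 F"
      by (simp_all add: insert_commute)
    from basis_pairs_cases[OF W F] show ?thesis
      unfolding separating_def c by (elim disjE conjE) simp_all
  qed
  then have "(\<Sum>F\<in>Pow S. of_bool (separating U s1 s2 s3 F) :: bit) =
      (\<Sum>F\<in>Pow S. of_bool (?B s2 s1 F \<and> ?B s3 s1 F)) +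
      (\<Sum>F\<in>Pow S. of_bool (?B s1 s2 F \<and> ?B s3 s2 F)) +
      (\<Sum>F\<in>Pow S. of_bool (?B s1 s3 F \<and> ?B s2 s3 F))"
    by (simp add: sum.distrib[symmetric])
  also have "\<dots> = of_bool (\<exists>z. radical U S = {0, one, z, z + one} \<and> b s2 z \<noteq> b s1 z \<and> b s3 z \<noteq> b s1 z) +
      of_bool (\<exists>z. radical U S = {0, one, z, z + one} \<and> b s1 z \<noteq> b s2 z \<and> b s3 z \<noteq> b s2 z) +
      of_bool (\<exists>z. radical U S = {0, one, z, z + one} \<and> b s1 z \<noteq> b s3 z \<and> b s2 z \<noteq> b s3 z)"
    using W R by (simp add: sum_basis2)
  also have "\<dots> = of_bool (\<exists>z. radical U S = {0, one, z, z + one} \<and> \<not> (b s1 z = b s2 z \<and> b s1 z = b s3 z))"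
  proof (cases "\<exists>z. radical U S = {0, one, z, z + one}")
    case True
    then obtain z where z: "radical U S = {0, one, z, z + one}" by blast
    have inv: "b s (z + one) = b t (z + one) \<longleftrightarrow> b s z = b t z" if "s \<in> W" "t \<in> W" for s t
      using one that by (simp add: b_add)
    note uniq = radical4_unique[OF z R]
    have e: "(\<exists>z. radical U S = {0, one, z, z + one} \<and> b t z \<noteq> b s z \<and> b u z \<noteq> b s z) \<longleftrightarrow>
        b t z \<noteq> b s z \<and> b u z \<noteq> b s z" if "s \<in> W" "t \<in> W" "u \<in> W" for s t u
      by (rule uniq) (simp add: inv that)
    have e': "(\<exists>z. radical U S = {0, one, z, z + one} \<and> \<not> (b s1 z = b s2 z \<and> b s1 z = b s3 z)) \<longleftrightarrow>
        \<not> (b s1 z = b s2 z \<and> b s1 z = b s3 z)"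
      by (rule uniq) (simp add: inv W)
    show ?thesis
      unfolding e' e[OF W(1,2,3)] e[OF W(2,1,3)] e[OF W(3,1,2)]
      by (cases "b s1 z"; cases "b s2 z"; cases "b s3 z"; simp)
  qed auto
  finally show ?thesis .
qed

text \<open>Once the tree count is even, all four sums are read off from the radical: a vector
  \<open>z\<close> that is not constant on the three edges distinguishes some pair of them.\<close>

lemma sums_basis2_all_0_iff:
  assumes W: "s1 \<in> W" "s2 \<in> W" "s3 \<in> W" "s1 \<noteq> s2" "s1 \<noteq> s3" "s2 \<noteq> s3"
    and R: "(\<Sum>F\<in>Pow S. of_bool (basis U (insert s1 F)) :: bit) = 0"
  shows "(\<Sum>F\<in>Pow S. of_bool (basis U (insert s1 (insert s2 F))) :: bit) = 0 \<and>
    (\<Sum>F\<in>Pow S. of_bool (basis U (insert s1 (insert s3 F))) :: bit) = 0 \<and>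
    (\<Sum>F\<in>Pow S. of_bool (basis U (insert s2 (insert s3 F))) :: bit) = 0 \<longleftrightarrow>
    (\<Sum>F\<in>Pow S. of_bool (separating U s1 s2 s3 F) :: bit) = 0"
proof -
  have R': "radical U S \<noteq> {0, one}" using R W by (simp add: sum_basis1)
  show ?thesis
    unfolding sum_separating[OF W R'] sum_basis2_single[OF W(2,1,4) R']
      sum_basis2_single[OF W(3,1,5) R'] sum_basis2_single[OF W(3,2,6) R']
    by auto
qed

text \<open>The vectors counted on the right form a coset, if any exist, of the radical vectors that
  vanish on both edges. Their number is odd only if that subspace is trivial, which leaves a radical
  of size 4.\<close>

lemma sum_basis2_parity:
  assumes W: "s1 \<in> W" "s2 \<in> W" "s1 \<noteq> s2"
  shows "(1 + (\<Sum>F\<in>Pow S. of_bool (basis U (insert s1 F)))) *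
      (\<Sum>F\<in>Pow S. of_bool (basis U (insert s1 (insert s2 F)))) =
    (\<Sum>z\<in>{z \<in> U. b s1 z = 0 \<and> b s2 z = 1}. of_bool (z \<in> radical U S) :: bit)"
proof -
  note RR = subspace2_radical[OF U, of S]
  have RU: "radical U S \<subseteq> U" by (auto simp: radical_def)
  let ?Y = "{z \<in> radical U S. b s1 z = 0 \<and> b s2 z = 1}"
  have fin: "finite U" using U by (simp add: subspace2D)
  have "{z \<in> {z \<in> U. b s1 z = 0 \<and> b s2 z = 1}. z \<in> radical U S} = ?Y" using RU by auto
  then have rhs: "(\<Sum>z\<in>{z \<in> U. b s1 z = 0 \<and> b s2 z = 1}. of_bool (z \<in> radical U S) :: bit) = of_nat (card ?Y)"
    using fin by (simp add: sum_of_bool_bit)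
  show ?thesis
  proof (cases "radical U S = {0, one}")
    case True
    then have "?Y = {}" using one W by auto
    then have "of_nat (card ?Y) = (0::bit)" by (simp only: card.empty of_nat_0)
    then show ?thesis unfolding rhs using True W by (simp add: sum_basis1)
  next
    case R: False
    have lhs: "(1 + (\<Sum>F\<in>Pow S. of_bool (basis U (insert s1 F)))) *
      (\<Sum>F\<in>Pow S. of_bool (basis U (insert s1 (insert s2 F)))) =
      (of_bool (\<exists>z. radical U S = {0, one, z, z + one} \<and> b s1 z \<noteq> b s2 z) :: bit)"
      using R W by (simp add: sum_basis1 sum_basis2_single)
    show ?thesis
    proof (cases "\<exists>r\<in>radical U S. r \<noteq> 0 \<and> b s1 r = 0 \<and> b s2 r = 0")
      case True
      then obtain r where r: "r \<in> radical U S" "r \<noteq> 0" "b s1 r = 0" "b s2 r = 0" by blast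
      have "(\<Sum>z\<in>?Y. 1 :: bit) = 0"
      proof (rule sum_involution_eq_0[where f = "\<lambda>z. z + r"])
        fix z assume "z \<in> ?Y"
        then show "z + r \<in> ?Y \<and> z + r + r = z \<and> z + r \<noteq> z \<and> (1::bit) = 1"
          using r subspace2D(3)[OF RR] by (auto simp: b_add add.assoc)
      qed (use subspace2D(1)[OF RR] in simp)
      moreover have "\<not> (\<exists>z. radical U S = {0, one, z, z + one} \<and> b s1 z \<noteq> b s2 z)"
      proof
        assume "\<exists>z. radical U S = {0, one, z, z + one} \<and> b s1 z \<noteq> b s2 z"
        then obtain z where "radical U S = {0, one, z, z + one}" "b s1 z \<noteq> b s2 z" by blast
        then show False using r one W by (auto simp: b_add bit_add_eq_0_iff)
      qed
      ultimately show ?thesis unfolding rhs lhs by simp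
    next
      case False
      obtain r where r: "r \<in> radical U S" "r \<noteq> 0" "b s1 r = 0" using radical_normalised[OF R W(1)] .
      then have r2: "b s2 r = 1" using False by auto
      have uniq: "x = 0 \<or> x = r" if x: "x \<in> radical U S" "b s1 x = 0" for x
      proof (cases "b s2 x = 0")
        case F: False
        then have "b s1 (x + r) = 0" "b s2 (x + r) = 0" using r r2 x by (simp_all add: b_add)
        then have "x + r = 0" using False subspace2D(3)[OF RR x(1) r(1)] by blast
        then show ?thesis by (simp add: bit_vec_add_eq_0_iff)
      qed (use False x in auto)
      have "radical U S = {0, one, r, r + one}" by (rule radical4I[OF r(1) W(1) uniq])
      then have "\<exists>z. radical U S = {0, one, z, z + one} \<and> b s1 z \<noteq> b s2 z"
        using r r2 by (intro exI[of _ r]) auto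
      moreover have "?Y = {r}" using uniq r r2 by fastforce
      ultimately show ?thesis unfolding rhs lhs by simp
    qed
  qed
qed

text \<open>The product is 1 unless the radical is \<open>{0, one}\<close> or has size 4 and is not
  constant on the three edges. The sum over \<open>z\<close> cancels the radicals with a nonzero
  vector that vanishes on all three edges; the rest embed into three coordinates, and only those of
  size 8 are left.\<close>

lemma separating_parity:
  assumes W: "s1 \<in> W" "s2 \<in> W" "s3 \<in> W" "s1 \<noteq> s2" "s1 \<noteq> s3" "s2 \<noteq> s3"
  shows "(1 + (\<Sum>F\<in>Pow S. of_bool (basis U (insert s1 F)))) *
      (1 + (\<Sum>F\<in>Pow S. of_bool (separating U s1 s2 s3 F))) +
    (\<Sum>z\<in>{z \<in> U. z \<noteq> 0 \<and> b s1 z = 0 \<and> b s2 z = 0 \<and> b s3 z = 0}. of_bool (z \<in> radical U S)) =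
    (of_bool (full_on3 s1 s2 s3 (radical U S)) :: bit)"
proof -
  note RR = subspace2_radical[OF U, of S]
  note add = subspace2D(3)[OF RR]
  have RU: "radical U S \<subseteq> U" by (auto simp: radical_def)
  have fin: "finite U" using U by (simp add: subspace2D)
  let ?R0 = "{z \<in> radical U S. b s1 z = 0 \<and> b s2 z = 0 \<and> b s3 z = 0}"
  have "{z \<in> {z \<in> U. z \<noteq> 0 \<and> b s1 z = 0 \<and> b s2 z = 0 \<and> b s3 z = 0}. z \<in> radical U S} = ?R0 - {0}"
    using RU by auto
  then have Y: "(\<Sum>z\<in>{z \<in> U. z \<noteq> 0 \<and> b s1 z = 0 \<and> b s2 z = 0 \<and> b s3 z = 0}. of_bool (z \<in> radical U S) :: bit)
      = of_nat (card (?R0 - {0}))"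
    using fin by (simp add: sum_of_bool_bit)
  have R00: "0 \<in> ?R0" using subspace2D(2)[OF RR] by simp
  have R0fin: "finite ?R0" using subspace2D(1)[OF RR] by simp
  let ?D = "\<exists>z. radical U S = {0, one, z, z + one} \<and> \<not> (b s1 z = b s2 z \<and> b s1 z = b s3 z)"
  have bad: "(1 + (\<Sum>F\<in>Pow S. of_bool (basis U (insert s1 F)))) *
      (1 + (\<Sum>F\<in>Pow S. of_bool (separating U s1 s2 s3 F))) =
      (of_bool (radical U S \<noteq> {0, one} \<and> \<not> ?D) :: bit)"
  proof (cases "radical U S = {0, one}")
    case True
    then show ?thesis unfolding sum_basis1[OF W(1)] by simp
  next
    case False
    then show ?thesis unfolding sum_basis1[OF W(1)] sum_separating[OF W False] by simp
  qed
  show ?thesis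
  proof (cases "?R0 = {0}")
    case False
    then obtain r where r: "r \<in> radical U S" "r \<noteq> 0" "b s1 r = 0" "b s2 r = 0" "b s3 r = 0"
      using R00 by blast
    have "(\<Sum>z\<in>?R0. 1 :: bit) = 0"
    proof (rule sum_involution_eq_0[where f = "\<lambda>z. z + r"])
      fix z assume "z \<in> ?R0"
      then show "z + r \<in> ?R0 \<and> z + r + r = z \<and> z + r \<noteq> z \<and> (1::bit) = 1"
        using r add by (auto simp: b_add add.assoc)
    qed (use R0fin in simp)
    then have "of_nat (card ?R0) = (0::bit)" by simp
    moreover have "card ?R0 = Suc (card (?R0 - {0}))"
      by (rule card.remove[OF R0fin R00])
    ultimately have "of_nat (card (?R0 - {0})) = (1::bit)"
      by (simp add: bit_add_eq_0_iff)
    moreover have "radical U S \<noteq> {0, one}" using r one W by auto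
    moreover have "\<not> ?D"
    proof
      assume ?D
      then obtain z where "radical U S = {0, one, z, z + one}" "\<not> (b s1 z = b s2 z \<and> b s1 z = b s3 z)"
        by blast
      then show False using r one W by (auto simp: b_add bit_add_eq_0_iff)
    qed
    moreover have "\<not> full_on3 s1 s2 s3 (radical U S)"
      using r by (auto simp: full_on3_def)
    ultimately show ?thesis unfolding Y bad by simp
  next
    case True
    then have inj0: "z = 0" if "z \<in> radical U S" "b s1 z = 0" "b s2 z = 0" "b s3 z = 0" for z
      using that by blast
    have "inj_on (\<lambda>z. (b s1 z, b s2 z, b s3 z)) (radical U S)"
    proof (rule inj_onI)
      fix x y assume xy: "x \<in> radical U S" "y \<in> radical U S" "(b s1 x, b s2 x, b s3 x) = (b s1 y, b s2 y, b s3 y)"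
      then have "x + y = 0" using add by (intro inj0) (auto simp: b_add)
      then show "x = y" by (simp add: bit_vec_add_eq_0_iff)
    qed
    moreover have "finite ({0, 1 :: bit} \<times> {0, 1 :: bit} \<times> {0, 1 :: bit})" "card ({0, 1 :: bit} \<times> {0, 1 :: bit} \<times> {0, 1 :: bit}) = 8"
      unfolding card_cartesian_product by simp_all
    then have "finite (UNIV :: (bit \<times> bit \<times> bit) set)" "card (UNIV :: (bit \<times> bit \<times> bit) set) = 8"
      unfolding UNIV_Times_UNIV[symmetric] UNIV_bit .
    ultimately have c8: "card (radical U S) \<le> 8"
      using card_inj_on_le[of "\<lambda>z. (b s1 z, b s2 z, b s3 z)" "radical U S" UNIV] by simp
    \<comment> \<open>A radical embedded into three coordinates has size 2, 4 or 8. In size 4 the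
      condition \<open>?D\<close> is automatic: if \<open>z\<close> were constant on the three
      edges, \<open>z\<close> or \<open>z + one\<close> would vanish there.\<close>
    have "radical U S \<noteq> {0, one} \<and> \<not> ?D \<longleftrightarrow> card (radical U S) = 8"
    proof
      assume c: "card (radical U S) = 8"
      have "radical U S \<noteq> {0, one}" using c card_length[of "[0, one]"] by auto
      moreover have "radical U S \<noteq> {0, one, z, z + one}" for z
        using c card_length[of "[0, one, z, z + one]"] by auto
      ultimately show "radical U S \<noteq> {0, one} \<and> \<not> ?D" by blast
    next
      assume bad: "radical U S \<noteq> {0, one} \<and> \<not> ?D"
      then obtain z where z: "z \<in> radical U S" "z \<noteq> 0" "z \<noteq> one"
        using one_radical subspace2D(2)[OF RR] by blast
      have "\<not> (b s1 z = b s2 z \<and> b s1 z = b s3 z)"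
      proof
        assume eq: "b s1 z = b s2 z \<and> b s1 z = b s3 z"
        show False
        proof (cases "b s1 z = 0")
          case True
          then show False using eq z inj0[of z] by auto
        next
          case False
          then have "z + one = 0"
            using eq z one W by (intro inj0 add one_radical) (auto simp: b_add)
          then show False using z by (simp add: bit_vec_add_eq_0_iff)
        qed
      qed
      then have "radical U S \<noteq> {0, one, z, z + one}" using bad by blast
      then obtain y where y: "y \<in> radical U S" "y \<notin> {0, one, z, z + one}"
        using one_radical subspace2D(2)[OF RR] z add[OF z(1) one_radical] by blast
      let ?X = "{0, one, z, z + one} \<union> {y, y + one, y + z, y + (z + one)}"
      have one0: "one \<noteq> 0" using one_ne_0 W by blast
      have "card {0, one, z, z + one} = 4"
        using z one0 z(2,3)[symmetric] one0[symmetric] bit_vec_add_eq_0_iff[of z one]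
        by (simp add: card_insert_if)
      moreover have "card {y, y + one, y + z, y + (z + one)} = card ((+) y ` {0, one, z, z + one})"
        by simp
      moreover have "card ((+) y ` {0, one, z, z + one}) = card {0, one, z, z + one}"
        by (rule card_image) (auto intro!: inj_onI simp del: inj_on_insert)
      moreover have "{0, one, z, z + one} \<inter> {y, y + one, y + z, y + (z + one)} = {}"
      proof -
        have "y + t \<notin> {0, one, z, z + one}" if t: "t \<in> {0, one, z, z + one}" for t
        proof
          assume "y + t \<in> {0, one, z, z + one}"
          then obtain t' where t': "t' \<in> {0, one, z, z + one}" "y + t = t'" by blast
          then have "y = t' + t" by (metis add.assoc add.right_neutral bit_vec_add_self)
          moreover have "t' + t \<in> {0, one, z, z + one}"
            using t t'(1) by (elim insertE emptyE) (simp_all add: ac_simps)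
          ultimately show False using y by simp
        qed
        from this[of 0] this[of one] this[of z] this[of "z + one"] show ?thesis by auto
      qed
      ultimately have "card ?X = 8" by (subst card_Un_disjoint) auto
      moreover have "?X \<subseteq> radical U S"
        using y z one_radical subspace2D(2)[OF RR] add by auto
      then have "card ?X \<le> card (radical U S)"
        using subspace2D(1)[OF RR] by (intro card_mono) auto
      ultimately show "card (radical U S) = 8" using c8 by linarith
    qed
    moreover have "full_on3 s1 s2 s3 (radical U S) \<longleftrightarrow> card (radical U S) = 8"
      using inj0 by (auto simp: full_on3_def)
    ultimately show ?thesis unfolding Y bad True by simp
  qed
qed

end

section \<open>Kernels restricting to three coordinates\<close>

text \<open>Vectors indexed by \<open>V\<close> are extended by zero, so that equality of functions
  is equality of vectors.\<close>

definition vecs :: "'v set \<Rightarrow> ('v \<Rightarrow> bit) set" where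
  "vecs V = {z. \<forall>x. x \<notin> V \<longrightarrow> z x = 0}"

lemma vecs_bij: "bij_betw (\<lambda>z. {x. z x = 1}) (vecs V) (Pow V)"
proof (rule bij_betwI[where g = "\<lambda>X x. of_bool (x \<in> X)"])
  show "(\<lambda>xa. of_bool (xa \<in> {xa. x xa = 1})) = x" for x :: "'v \<Rightarrow> bit"
    by (rule ext, rule bit_eqI) simp
qed (auto simp: vecs_def)

lemma finite_vecs: "finite V \<Longrightarrow> finite (vecs V)"
  using bij_betw_finite[OF vecs_bij, of V] by (metis finite_Pow_iff)

lemma card_vecs: "finite V \<Longrightarrow> card (vecs V) = 2 ^ card V"
  using bij_betw_same_card[OF vecs_bij, of V] by (simp add: card_Pow)

lemma subspace2_vecs: "finite V \<Longrightarrow> subspace2 (vecs V)"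
  by (auto simp: subspace2_def finite_vecs) (auto simp: vecs_def)

lemma card_kers_le:
  assumes "finite P" "subspace2 K"
  shows "card K \<le> 2 ^ card P * card {z \<in> K. \<forall>p\<in>P. z p = 0}"
  using assms
proof (induction P rule: finite_induct)
  case (insert p P)
  let ?K = "{z \<in> K. \<forall>p\<in>P. z p = 0}"
  have sub: "subspace2 ?K" using insert.prems by (auto simp: subspace2_def)
  have eq: "{z \<in> ?K. z p = 0} = {z \<in> K. \<forall>p\<in>insert p P. z p = 0}" by auto
  have "card ?K \<le> 2 * card {z \<in> ?K. z p = 0}"
  proof (cases "\<exists>z\<in>?K. z p = 1")
    case True
    then obtain z where "z \<in> ?K" "z p = 1" by blast
    then show ?thesis using card_ker[OF sub, of "\<lambda>z. z p" z] by simp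
  next
    case False
    then have "{z \<in> ?K. z p = 0} = ?K" by auto
    then show ?thesis by (simp only:)
  qed
  then have "2 ^ card P * card ?K \<le> 2 ^ card P * (2 * card {z \<in> K. \<forall>p\<in>insert p P. z p = 0})"
    unfolding eq by (rule mult_left_mono) simp
  moreover have "card K \<le> 2 ^ card P * card ?K" using insert by blast
  moreover have "2 ^ card (insert p P) = 2 ^ card P * (2::nat)" using insert.hyps by simp
  ultimately show ?case by (metis (no_types, lifting) mult.assoc order_trans)
qed simp

lemma card_image_kernel:
  assumes W: "subspace2 W" and m: "\<And>x y. m (x + y) = m x + (m y :: 'v \<Rightarrow> bit)"
  shows "card (m ` W) * card {z \<in> W. m z = 0} = card W"
proof -
  have fin: "finite W" using W by (simp add: subspace2D)
  have fib: "card {z \<in> W. m z = s} = card {z \<in> W. m z = 0}" if "s \<in> m ` W" for s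
  proof -
    from that obtain y where y: "y \<in> W" "m y = s" by blast
    have "bij_betw (\<lambda>z. z + y) {z \<in> W. m z = s} {z \<in> W. m z = 0}"
      by (rule bij_betwI[where g = "\<lambda>z. z + y"])
        (use y W m in \<open>auto simp: subspace2D add.assoc\<close>)
    then show ?thesis by (rule bij_betw_same_card)
  qed
  have "card W = (\<Sum>s\<in>m ` W. card {z \<in> W. m z = s})"
    using sum.image_gen[OF fin, of "\<lambda>_. 1::nat" m] by simp
  also have "\<dots> = card (m ` W) * card {z \<in> W. m z = 0}"
    using fib by simp
  finally show ?thesis by simp
qed

text \<open>\<open>g\<close> is linear on F_2^E. If \<open>H\<close> has codimension below
  \<open>card E\<close> in \<open>W\<close>, two pairs \<open>(T, h)\<close> have the same value
  \<open>g T + h\<close>, so \<open>g\<close> maps some nonempty edge set into \<open>H\<close>, and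
  toggling that set does not affect membership.\<close>

lemma sum_Pow_subspace_eq_0:
  assumes E: "finite E" and W: "finite W" "\<And>T. T \<subseteq> E \<Longrightarrow> g T \<in> W"
    and H: "subspace2 H" "H \<subseteq> W" and add: "\<And>x y. x \<in> W \<Longrightarrow> y \<in> W \<Longrightarrow> x + y \<in> W"
    and g: "\<And>S T. S \<subseteq> E \<Longrightarrow> T \<subseteq> E \<Longrightarrow> g (sym_difference S T) = g S + (g T :: 'v \<Rightarrow> bit)"
    and c: "card W < 2 ^ card E * card H"
  shows "(\<Sum>T\<in>Pow E. of_bool (g T \<in> H) :: bit) = 0"
proof -
  have "\<not> inj_on (\<lambda>(T, h). g T + h) (Pow E \<times> H)"
  proof
    assume "inj_on (\<lambda>(T, h). g T + h) (Pow E \<times> H)"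
    then have "card (Pow E \<times> H) \<le> card W"
      by (rule card_inj_on_le) (use W H add in auto)
    then show False using c E by (simp add: card_cartesian_product card_Pow)
  qed
  then obtain S h T h' where st: "S \<subseteq> E" "T \<subseteq> E" "h \<in> H" "h' \<in> H" "g S + h = g T + h'" "(S, h) \<noteq> (T, h')"
    unfolding inj_on_def by auto
  then have "S \<noteq> T" by auto
  have "g S + g T = h + h'" using st(5)
    by (metis (no_types, lifting) add.assoc add.commute bit_vec_add_self_left)
  then have gH: "g (sym_difference S T) \<in> H" using g[of S T] st H by (simp add: subspace2D)
  show ?thesis
  proof (rule sum_Pow_toggle_eq_0[OF E, of "sym_difference S T"])
    fix X assume X: "X \<subseteq> E"
    have "g (sym_difference X (sym_difference S T)) = g X + g (sym_difference S T)"
      using X st by (intro g) auto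
    moreover have "g X + g (sym_difference S T) \<in> H \<longleftrightarrow> g X \<in> H"
      using gH H(1) subspace2D(3)[OF H(1), of "g X + g (sym_difference S T)" "g (sym_difference S T)"]
      by (auto simp: subspace2D add.assoc)
    ultimately show "(of_bool (g (sym_difference X (sym_difference S T)) \<in> H) :: bit) = of_bool (g X \<in> H)"
      by simp
  qed (use st \<open>S \<noteq> T\<close> in auto)
qed

text \<open>For a subspace \<open>K\<close> and \<open>card P = 3\<close> this says that restriction to \<open>P\<close> is an isomorphism.\<close>

definition full_on :: "'v set \<Rightarrow> ('v \<Rightarrow> bit) set \<Rightarrow> bool" where
  "full_on P K \<longleftrightarrow> card K = 8 \<and> (\<forall>z\<in>K. (\<forall>p\<in>P. z p = 0) \<longrightarrow> z = 0)"

lemma full_on_card: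
  assumes "finite P" "subspace2 K" "full_on P K"
  shows "card P \<ge> 3"
proof -
  have "{z \<in> K. \<forall>p\<in>P. z p = 0} = {0}"
    using assms by (auto simp: full_on_def subspace2D)
  then have "(2::nat) ^ 3 \<le> 2 ^ card P"
    using card_kers_le[OF assms(1,2)] assms(3) by (simp add: full_on_def)
  then show ?thesis by (simp only: power_increasing_iff)
qed

text \<open>If restriction to \<open>Q\<close> is injective, it is onto by size and exactly one
  \<open>u\<close> is 1 on \<open>Q\<close>. Otherwise adding a nonzero vector of \<open>K\<close>
  that vanishes on \<open>Q\<close> pairs off the candidates.\<close>

lemma full_on_parity:
  assumes K: "subspace2 K" "K \<subseteq> U" "card K = 8" and U: "finite U" and Q: "finite Q" "card Q \<le> 3"
  shows "(of_bool (full_on Q K) :: bit) = (\<Sum>u\<in>{u \<in> U. \<forall>q\<in>Q. u q = 1}. of_bool (u \<in> K))"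
proof -
  let ?Y = "{u \<in> K. \<forall>q\<in>Q. u q = 1}"
  have "{u \<in> {u \<in> U. \<forall>q\<in>Q. u q = 1}. u \<in> K} = ?Y" using K by auto
  then have rhs: "(\<Sum>u\<in>{u \<in> U. \<forall>q\<in>Q. u q = 1}. of_bool (u \<in> K) :: bit) = of_nat (card ?Y)"
    using U by (simp add: sum_of_bool_bit)
  show ?thesis
  proof (cases "full_on Q K")
    case True
    then have inj0: "z = 0" if "z \<in> K" "\<And>p. p \<in> Q \<Longrightarrow> z p = 0" for z
      using that by (auto simp: full_on_def)
    have eqI: "x = y" if "x \<in> K" "y \<in> K" "\<And>q. q \<in> Q \<Longrightarrow> x q = y q" for x y
    proof -
      have "x + y = 0" using that K by (intro inj0) (auto simp: subspace2D)
      then show ?thesis by (simp add: bit_vec_add_eq_0_iff)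
    qed
    have "inj_on (\<lambda>z. {q \<in> Q. z q = 1}) K"
    proof (rule inj_onI)
      fix x y assume xy: "x \<in> K" "y \<in> K" "{q \<in> Q. x q = 1} = {q \<in> Q. y q = 1}"
      show "x = y"
      proof (rule eqI[OF xy(1,2)])
        fix q assume "q \<in> Q"
        then have "x q = 1 \<longleftrightarrow> y q = 1" using xy(3) by blast
        then show "x q = y q" by (rule bit_eqI)
      qed
    qed
    then have "card ((\<lambda>z. {q \<in> Q. z q = 1}) ` K) = 8" using K by (simp add: card_image)
    moreover have "card (Pow Q) \<le> 2 ^ 3" unfolding card_Pow[OF Q(1)]
      by (rule power_increasing[OF Q(2)]) simp
    ultimately have "(\<lambda>z. {q \<in> Q. z q = 1}) ` K = Pow Q"
      using Q(1) by (intro card_seteq) auto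
    then obtain u where "u \<in> K" "{q \<in> Q. u q = 1} = Q" by (metis (no_types, lifting) Pow_top imageE)
    then have u: "u \<in> ?Y" by blast
    moreover have "x = u" if "x \<in> ?Y" for x using that u by (intro eqI) auto
    ultimately have "?Y = {u}" by blast
    then have "card ?Y = 1" by simp
    then show ?thesis unfolding rhs using True by simp
  next
    case False
    then obtain r where r: "r \<in> K" "r \<noteq> 0" "\<forall>q\<in>Q. r q = 0" using K by (auto simp: full_on_def)
    have "(\<Sum>z\<in>?Y. 1 :: bit) = 0"
    proof (rule sum_involution_eq_0[where f = "\<lambda>z. z + r"])
      fix z assume "z \<in> ?Y"
      then show "z + r \<in> ?Y \<and> z + r + r = z \<and> z + r \<noteq> z \<and> (1::bit) = 1"
        using r K by (auto simp: subspace2D add.assoc)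
    qed (use K in \<open>simp add: subspace2D\<close>)
    then show ?thesis unfolding rhs using False by simp
  qed
qed

section \<open>Bordered symmetric matrices\<close>

text \<open>The symmetric operator \<open>m\<close> on \<open>vecs (V - {x})\<close> is bordered by the column \<open>s\<close> and the diagonal
  entry \<open>\<delta>\<close>.\<close>

locale bordered =
  fixes V :: "'v set" and x :: 'v and m :: "('v \<Rightarrow> bit) \<Rightarrow> 'v \<Rightarrow> bit"
  assumes V: "finite V" "x \<in> V"
    and m_add: "m (z + z') = m z + m z'"
    and m_vecs: "z \<in> vecs (V - {x}) \<Longrightarrow> m z \<in> vecs (V - {x})"
    and m_sym: "z \<in> vecs (V - {x}) \<Longrightarrow> z' \<in> vecs (V - {x}) \<Longrightarrow>
      (\<Sum>y\<in>V - {x}. m z y * z' y) = (\<Sum>y\<in>V - {x}. z y * m z' y)"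
begin

abbreviation "W \<equiv> vecs (V - {x})"

definition K :: "('v \<Rightarrow> bit) \<Rightarrow> bit \<Rightarrow> ('v \<Rightarrow> bit) set" where
  "K s \<delta> = {z \<in> vecs V. (\<forall>y\<in>V - {x}. m (z(x := 0)) y + s y * z x = 0) \<and>
     (\<Sum>y\<in>V - {x}. s y * z y) + \<delta> * z x = 0}"

definition K0 :: "('v \<Rightarrow> bit) set" where
  "K0 = {z \<in> W. m z = 0}"

text \<open>The solutions of all rows except that of \<open>x\<close>; the diagonal entry at
  \<open>x\<close> only enters the omitted row.\<close>

definition Kp :: "('v \<Rightarrow> bit) \<Rightarrow> ('v \<Rightarrow> bit) set" where
  "Kp s = {z \<in> vecs V. \<forall>y\<in>V - {x}. m (z(x := 0)) y = s y * z x}"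

lemma m_zero [simp]: "m 0 = 0"
  using m_add[of 0 0] by simp

lemma W_subspace: "subspace2 W"
  using V by (simp add: subspace2_vecs)

lemma upd_W: "z \<in> vecs V \<Longrightarrow> z(x := 0) \<in> W"
  by (auto simp: vecs_def)

lemma W_upd: "z \<in> W \<Longrightarrow> z(x := c) \<in> vecs V"
  using V by (auto simp: vecs_def)

lemma W_x: "z \<in> W \<Longrightarrow> z x = 0" "z \<in> W \<Longrightarrow> z(x := 0) = z"
  by (auto simp: vecs_def)

lemma m_eqI: "z \<in> W \<Longrightarrow> s \<in> W \<Longrightarrow> (\<And>y. y \<in> V - {x} \<Longrightarrow> m z y = s y) \<Longrightarrow> m z = s"
proof (rule ext)
  fix y assume "z \<in> W" "s \<in> W" "\<And>y. y \<in> V - {x} \<Longrightarrow> m z y = s y"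
  then show "m z y = s y"
    using m_vecs[of z] by (cases "y \<in> V - {x}") (auto simp: vecs_def)
qed

lemma K_eq:
  assumes "s \<in> W"
  shows "K s \<delta> = {z \<in> Kp s. (\<Sum>y\<in>V - {x}. s y * z y) = \<delta> * z x}"
  by (auto simp: K_def Kp_def bit_add_eq_0_iff)

lemma Kp_m: "z \<in> Kp s \<Longrightarrow> s \<in> W \<Longrightarrow> z x = 1 \<Longrightarrow> m (z(x := 0)) = s"
  by (rule m_eqI) (auto simp: Kp_def upd_W)

lemma Kp_0: "s \<in> W \<Longrightarrow> {z \<in> Kp s. z x = 0} = K0"
proof (intro equalityI subsetI)
  fix z assume "s \<in> W" and z: "z \<in> {z \<in> Kp s. z x = 0}"
  then have zW: "z \<in> W" by (auto simp: Kp_def vecs_def)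
  moreover have "m z = 0"
    by (rule m_eqI) (use z zW in \<open>auto simp: Kp_def W_x subspace2D(2)[OF W_subspace]\<close>)
  ultimately show "z \<in> K0" by (simp add: K0_def)
next
  fix z assume "s \<in> W" and z: "z \<in> K0"
  then show "z \<in> {z \<in> Kp s. z x = 0}"
    by (auto simp: K0_def Kp_def W_x) (auto simp: vecs_def)
qed

lemma Kp_subspace: "subspace2 (Kp s)"
proof -
  have "(z + z')(x := 0) = z(x := 0) + z'(x := 0)" for z z' :: "'v \<Rightarrow> bit" by (auto simp: fun_eq_iff)
  moreover have "(0 :: 'v \<Rightarrow> bit)(x := 0) = 0" by (auto simp: fun_eq_iff)
  ultimately show ?thesis
    using V finite_vecs[of V] unfolding subspace2_def Kp_def
    by (auto simp: m_add algebra_simps) (auto simp: vecs_def)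
qed

lemma K0_subspace: "subspace2 K0"
  using W_subspace m_add unfolding K0_def subspace2_def by auto

text \<open>The rows other than that of \<open>x\<close> force \<open>z x = 0\<close>, so the
  diagonal entry multiplies 0.\<close>

lemma K_outside:
  assumes s: "s \<in> W" "s \<notin> m ` W"
  shows "K s \<delta> = K s \<delta>'"
proof -
  have "z x = 0" if "z \<in> Kp s" for z
  proof (rule ccontr)
    assume "z x \<noteq> 0"
    then have "m (z(x := 0)) = s" by (intro Kp_m[OF that s(1)]) simp
    moreover have "z(x := 0) \<in> W" by (rule upd_W) (use that in \<open>simp add: Kp_def\<close>)
    ultimately show False using s by blast
  qed
  then show ?thesis using s by (auto simp: K_eq)
qed

text \<open>With \<open>m y0 = s\<close>, symmetry of \<open>m\<close> makes \<open>s\<close>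
  orthogonal to \<open>K0\<close>. Hence on \<open>Kp s\<close> the row of \<open>x\<close> reads
  \<open>(d + \<delta>) * z x = 0\<close>, where \<open>d\<close> is the product of \<open>s\<close>
  and \<open>y0\<close>: it is void for one diagonal entry and says \<open>z x = 0\<close> for the
  other.\<close>

lemma K_inside:
  assumes s: "s \<in> W" "s \<in> m ` W"
  shows "\<exists>\<delta>. K s \<delta> = Kp s \<and> K s (\<delta> + 1) = K0"
proof -
  obtain y0 where y0: "y0 \<in> W" "m y0 = s" using s by blast
  define d where "d = (\<Sum>y\<in>V - {x}. s y * y0 y)"
  have orth: "(\<Sum>y\<in>V - {x}. s y * z y) = 0" if "z \<in> K0" for z
  proof -
    have "(\<Sum>y\<in>V - {x}. m y0 y * z y) = (\<Sum>y\<in>V - {x}. y0 y * m z y)"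
      by (rule m_sym) (use y0 that in \<open>auto simp: K0_def\<close>)
    then show ?thesis using y0 that by (simp add: K0_def)
  qed
  have key: "(\<Sum>y\<in>V - {x}. s y * z y) = d * z x" if z: "z \<in> Kp s" for z
  proof (cases "z x = 0")
    case True
    then show ?thesis using orth Kp_0[OF s(1)] z by auto
  next
    case False
    let ?z = "z(x := 0)"
    have "z x = 1" using False by simp
    then have "m ?z = s" by (rule Kp_m[OF z s(1)])
    moreover have "?z \<in> W" by (rule upd_W) (use z in \<open>simp add: Kp_def\<close>)
    ultimately have "?z + y0 \<in> K0" using y0 W_subspace by (auto simp: K0_def m_add subspace2D)
    then have "(\<Sum>y\<in>V - {x}. s y * (?z + y0) y) = 0" by (rule orth)
    then have "(\<Sum>y\<in>V - {x}. s y * z y) + d = 0"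
      by (simp add: d_def algebra_simps sum.distrib)
    then show ?thesis using False by (simp add: bit_add_eq_0_iff)
  qed
  have "K s d = Kp s" using key by (auto simp: K_eq s)
  moreover have "K s (d + 1) = {z \<in> Kp s. z x = 0}"
    using key by (auto simp: K_eq s algebra_simps)
  ultimately show ?thesis using Kp_0[OF s(1)] by auto
qed

lemma sum_border:
  assumes s: "s \<in> W"
  shows "of_bool (Q (K s 0)) + of_bool (Q (K s 1)) =
    (of_bool (s \<in> m ` W) * (of_bool (Q K0) + of_bool (Q (Kp s))) :: bit)"
proof (cases "s \<in> m ` W")
  case True
  then obtain \<delta> where "K s \<delta> = Kp s" "K s (\<delta> + 1) = K0" using K_inside s by blast
  then show ?thesis using True by (cases \<delta>) auto
next
  case False
  then show ?thesis using K_outside[OF s False, of 0 1] by simp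
qed

lemma card_Kp:
  assumes "s \<in> W" "s \<in> m ` W"
  shows "card (Kp s) = 2 * card K0"
proof -
  obtain y0 where y0: "y0 \<in> W" "m y0 = s" using assms by blast
  then have "y0(x := 1) \<in> Kp s" by (auto simp: Kp_def W_upd W_x)
  from card_ker[OF Kp_subspace, of "\<lambda>z. z x", OF _ this] show ?thesis
    unfolding Kp_0[OF assms(1)] by simp
qed

lemma card_W: "card W = card (m ` W) * card K0"
  using card_image_kernel[OF W_subspace, of m] m_add by (simp add: K0_def)

lemma image_subspace: "subspace2 Y \<Longrightarrow> subspace2 (m ` Y)"
  unfolding subspace2_def
proof (intro conjI ballI; elim conjE)
  fix u v assume "u \<in> m ` Y" "v \<in> m ` Y" "\<forall>x\<in>Y. \<forall>y\<in>Y. x + y \<in> Y"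
  then show "u + v \<in> m ` Y" by (auto simp flip: m_add)
qed (auto simp: image_iff intro!: bexI[of _ 0])

section \<open>Varying the row of a vertex at which a kernel vector vanishes\<close>

context
  fixes E :: "'e set" and g :: "'e set \<Rightarrow> 'v \<Rightarrow> bit" and P :: "'v set" and u :: "'v \<Rightarrow> bit"
  assumes E: "finite E" and gW: "\<And>T. T \<subseteq> E \<Longrightarrow> g T \<in> W"
    and g_add: "\<And>S T. S \<subseteq> E \<Longrightarrow> T \<subseteq> E \<Longrightarrow> g (sym_difference S T) = g S + g T"
    and P: "finite P" and u: "u \<in> vecs V" "u x = 0"
begin

lemma u_Kp: "u \<in> Kp s \<longleftrightarrow> u \<in> K0" if "s \<in> W"
  using Kp_0[OF that] u by auto

lemma sum_in_subspace:
  assumes "subspace2 H" "H \<subseteq> W" "card W < 2 ^ card E * card H"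
  shows "(\<Sum>T\<in>Pow E. of_bool (g T \<in> H) :: bit) = 0"
  using assms gW g_add E W_subspace by (intro sum_Pow_subspace_eq_0[where W = W]) (auto simp: subspace2D)

lemma card_pos: "subspace2 H \<Longrightarrow> card H > 0"
  using subspace2D(1,2)[of H] card_gt_0_iff by blast

lemma image_sub: "m ` W \<subseteq> W"
  using m_vecs by auto

text \<open>If \<open>K0\<close> restricts isomorphically to \<open>P\<close>, the image of
  \<open>m\<close> has codimension 3. If instead \<open>K0\<close> has dimension 2, the relevant
  columns lie in the image of \<open>m\<close>, of codimension 2, but outside a subspace of
  codimension at most 3. Four free entries beat each of these.\<close>

lemma sum_border_outside:
  assumes xP: "x \<notin> P" and c: "card E = 4" "card P \<le> 3"
  shows "(\<Sum>T\<in>Pow E. of_bool (u \<in> K (g T) 0 \<and> full_on P (K (g T) 0)) +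
            of_bool (u \<in> K (g T) 1 \<and> full_on P (K (g T) 1)) :: bit) = 0"
proof -
  note imW = image_subspace[OF W_subspace]
  have "(\<Sum>T\<in>Pow E. of_bool (u \<in> K (g T) 0 \<and> full_on P (K (g T) 0)) +
            of_bool (u \<in> K (g T) 1 \<and> full_on P (K (g T) 1)) :: bit) =
      (\<Sum>T\<in>Pow E. of_bool (g T \<in> m ` W) * (of_bool (u \<in> K0 \<and> full_on P K0) +
            of_bool (u \<in> Kp (g T) \<and> full_on P (Kp (g T)))))"
    using gW by (intro sum.cong refl sum_border) auto
  also have "\<dots> = of_bool (u \<in> K0) * (of_bool (full_on P K0) * (\<Sum>T\<in>Pow E. of_bool (g T \<in> m ` W)) +
        (\<Sum>T\<in>Pow E. of_bool (g T \<in> m ` W \<and> full_on P (Kp (g T)))))"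
    unfolding sum_distrib_left sum.distrib[symmetric]
    by (intro sum.cong refl) (auto simp: u_Kp gW algebra_simps)
  also have "of_bool (full_on P K0) * (\<Sum>T\<in>Pow E. of_bool (g T \<in> m ` W)) = (0::bit)"
  proof (cases "full_on P K0")
    case True
    then have "card W < 2 ^ card E * card (m ` W)"
      using c card_pos[OF imW] by (simp add: card_W full_on_def)
    from sum_in_subspace[OF imW image_sub this] show ?thesis by simp
  qed simp
  also have "(\<Sum>T\<in>Pow E. of_bool (g T \<in> m ` W \<and> full_on P (Kp (g T)))) = (0::bit)"
  proof (cases "card K0 = 4 \<and> (\<forall>z\<in>K0. (\<forall>p\<in>P. z p = 0) \<longrightarrow> z = 0)")
    case False
    have "\<not> full_on P (Kp s)" if "s \<in> W" "s \<in> m ` W" for s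
      using False card_Kp[OF that] Kp_0[OF that(1)] by (auto simp: full_on_def)
    then show ?thesis using gW by (intro sum.neutral) auto
  next
    case True
    let ?Y = "{z \<in> W. \<forall>p\<in>P. z p = 0}"
    have Y: "subspace2 ?Y" using W_subspace by (auto simp: subspace2_def)
    \<comment> \<open>A vector of \<open>Kp s\<close> that is 1 at \<open>x\<close> and vanishes on
      \<open>P\<close> amounts to a solution of \<open>m y = s\<close> with \<open>y\<close>
      vanishing on \<open>P\<close>.\<close>
    have iff: "full_on P (Kp s) \<longleftrightarrow> s \<notin> m ` ?Y" if s: "s \<in> W" "s \<in> m ` W" for s
    proof
      assume f: "full_on P (Kp s)"
      show "s \<notin> m ` ?Y"
      proof
        assume "s \<in> m ` ?Y"
        then obtain y where y: "y \<in> W" "\<forall>p\<in>P. y p = 0" "m y = s" by blast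
        have "y(x := 1) \<in> Kp s" using y by (auto simp: Kp_def W_upd W_x)
        moreover have "\<forall>p\<in>P. (y(x := 1)) p = 0" using y xP by auto
        ultimately have "y(x := 1) = 0" using f by (auto simp: full_on_def)
        then show False by (metis fun_upd_same zero_fun_apply zero_neq_one)
      qed
    next
      assume n: "s \<notin> m ` ?Y"
      have "z = 0" if z: "z \<in> Kp s" "\<forall>p\<in>P. z p = 0" for z
      proof (cases "z x = 0")
        case zx: True
        then have "z \<in> K0" using z Kp_0[OF s(1)] by auto
        then show ?thesis using True z by blast
      next
        case False
        then have "m (z(x := 0)) = s" by (intro Kp_m[OF z(1) s(1)]) simp
        moreover have "z(x := 0) \<in> ?Y" using z upd_W[of z] xP by (auto simp: Kp_def)
        ultimately show ?thesis using n by blast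
      qed
      then show "full_on P (Kp s)" using card_Kp[OF s] True by (auto simp: full_on_def)
    qed
    have "(\<Sum>T\<in>Pow E. of_bool (g T \<in> m ` W \<and> full_on P (Kp (g T))) :: bit) =
        (\<Sum>T\<in>Pow E. of_bool (g T \<in> m ` W) + of_bool (g T \<in> m ` ?Y))"
      by (intro sum.cong refl) (use gW iff in auto)
    moreover have "(\<Sum>T\<in>Pow E. of_bool (g T \<in> m ` W) :: bit) = 0"
      by (rule sum_in_subspace[OF imW image_sub])
        (use c True card_pos[OF imW] in \<open>simp add: card_W\<close>)
    moreover have "(\<Sum>T\<in>Pow E. of_bool (g T \<in> m ` ?Y) :: bit) = 0"
    proof (rule sum_in_subspace[OF image_subspace[OF Y]])
      show "m ` ?Y \<subseteq> W" using m_vecs by auto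
      have "{z \<in> ?Y. m z = 0} = {0}"
        using True subspace2D(2)[OF Y] by (auto simp: K0_def)
      then have eq: "card (m ` ?Y) = card ?Y"
        using card_image_kernel[OF Y, of m] m_add by simp
      have "card W \<le> 2 ^ card P * card ?Y"
        by (rule card_kers_le[OF P W_subspace])
      moreover have "(2::nat) ^ card P \<le> 2 ^ 3" using c by (intro power_increasing) auto
      then have "2 ^ card P * card ?Y \<le> 2 ^ 3 * card ?Y" by (rule mult_right_mono) simp
      moreover have "2 ^ 3 * card ?Y < 2 ^ card E * card ?Y"
        unfolding c by (rule mult_strict_right_mono) (use card_pos[OF Y] in simp_all)
      ultimately show "card W < 2 ^ card E * card (m ` ?Y)" unfolding eq by linarith
    qed
    ultimately show ?thesis by (simp add: sum.distrib)
  qed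
  finally show ?thesis by simp
qed

text \<open>\<open>K0\<close> vanishes at \<open>x\<close>, a point of \<open>P\<close>, so it
  cannot restrict isomorphically to \<open>P\<close>. Only \<open>Kp\<close> contributes, with
  \<open>K0\<close> of dimension 2, and the image of \<open>m\<close> has codimension 2 against
  three free entries.\<close>

lemma sum_border_inside:
  assumes xP: "x \<in> P" and c: "card E = 3" "card P = 3"
  shows "(\<Sum>T\<in>Pow E. of_bool (u \<in> K (g T) 0 \<and> full_on P (K (g T) 0)) +
            of_bool (u \<in> K (g T) 1 \<and> full_on P (K (g T) 1)) :: bit) = 0"
proof -
  note imW = image_subspace[OF W_subspace]
  let ?C = "card K0 = 4 \<and> (\<forall>z\<in>K0. (\<forall>p\<in>P. z p = 0) \<longrightarrow> z = 0)"
  have K0: "\<not> full_on P K0"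
  proof
    assume f: "full_on P K0"
    then have "full_on (P - {x}) K0"
      using W_x by (auto simp: full_on_def K0_def)
    then have "card (P - {x}) \<ge> 3" using P K0_subspace by (intro full_on_card) auto
    then show False using c xP P by simp
  qed
  have Kp: "full_on P (Kp s) \<longleftrightarrow> ?C" if s: "s \<in> W" "s \<in> m ` W" for s
    using card_Kp[OF s] Kp_0[OF s(1)] xP by (auto simp: full_on_def)
  have "(\<Sum>T\<in>Pow E. of_bool (u \<in> K (g T) 0 \<and> full_on P (K (g T) 0)) +
            of_bool (u \<in> K (g T) 1 \<and> full_on P (K (g T) 1)) :: bit) =
      (\<Sum>T\<in>Pow E. of_bool (g T \<in> m ` W) * (of_bool (u \<in> K0 \<and> full_on P K0) +
            of_bool (u \<in> Kp (g T) \<and> full_on P (Kp (g T)))))"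
    using gW by (intro sum.cong refl sum_border) auto
  also have "\<dots> = (\<Sum>T\<in>Pow E. of_bool (u \<in> K0 \<and> ?C) * of_bool (g T \<in> m ` W))"
    using K0 Kp gW u_Kp by (intro sum.cong refl) auto
  also have "\<dots> = of_bool (u \<in> K0 \<and> ?C) * (\<Sum>T\<in>Pow E. of_bool (g T \<in> m ` W))"
    by (simp add: sum_distrib_left)
  also have "\<dots> = 0"
  proof (cases ?C)
    case True
    then have "card W < 2 ^ card E * card (m ` W)"
      using c card_pos[OF imW] by (simp add: card_W)
    from sum_in_subspace[OF imW image_sub this] show ?thesis by simp
  qed auto
  finally show ?thesis .
qed

end

end

section \<open>Symmetric matrices supported on a graph\<close>

text \<open>The coboundary modulo 2. The test on the cardinality sends loops to 0.\<close>

definition cob :: "('e \<Rightarrow> 'v set) \<Rightarrow> 'e \<Rightarrow> ('v \<Rightarrow> bit) \<Rightarrow> bit" where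
  "cob nd e z = (if card (nd e) = 2 then \<Sum>x\<in>nd e. z x else 0)"

lemma cob_add: "cob nd e (x + y) = cob nd e x + cob nd e y"
  by (simp add: cob_def sum.distrib)

interpretation cob: bit_forms "cob nd" for nd :: "'e \<Rightarrow> 'v set"
  by standard (rule cob_add)

locale edge_space =
  fixes nd :: "'e \<Rightarrow> 'v set" and V :: "'v set" and E :: "'e set"
  assumes fin: "finite V" "finite E"
    and nd: "e \<in> E \<Longrightarrow> nd e \<subseteq> V" "e \<in> E \<Longrightarrow> card (nd e) = 1 \<or> card (nd e) = 2"
begin

text \<open>The symmetric matrix whose off-diagonal entries count the edges of \<open>S\<close>
  modulo 2 and whose diagonal is the indicator of \<open>D\<close>. A loop contributes
  nothing.\<close>

definition adj :: "'e set \<Rightarrow> 'v set \<Rightarrow> ('v \<Rightarrow> bit) \<Rightarrow> 'v \<Rightarrow> bit" where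
  "adj S D z x = (\<Sum>e\<in>S. of_bool (x \<in> nd e) * (\<Sum>y\<in>nd e - {x}. z y)) + of_bool (x \<in> D) * z x"

definition kern :: "'e set \<Rightarrow> 'v set \<Rightarrow> ('v \<Rightarrow> bit) set" where
  "kern S D = {z \<in> vecs V. \<forall>x\<in>V. adj S D z x = 0}"

lemma adj_add: "adj S D (z + z') x = adj S D z x + adj S D z' x"
  by (simp add: adj_def sum.distrib algebra_simps)

lemma kern_subspace: "subspace2 (kern S D)"
proof -
  have "adj S D 0 x = 0" for x by (simp add: adj_def)
  then show ?thesis
    using subspace2_vecs[OF fin(1)] by (auto simp: subspace2_def kern_def adj_add)
qed

lemma nd_cases:
  assumes "e \<in> E"
  obtains x where "nd e = {x}" | x y where "nd e = {x, y}" "x \<noteq> y"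
  using nd(2)[OF assms] by (auto simp: card_1_singleton_iff card_2_iff)

lemma edge_form_sym:
  assumes e: "e \<in> E" and A: "finite A" "nd e \<subseteq> A"
  shows "(\<Sum>y\<in>A. of_bool (y \<in> nd e) * (\<Sum>y'\<in>nd e - {y}. z y') * z' y :: bit) =
    (\<Sum>y\<in>A. z y * (of_bool (y \<in> nd e) * (\<Sum>y'\<in>nd e - {y}. z' y')))"
proof -
  have 1: "(\<Sum>y\<in>A. of_bool (y \<in> nd e) * f y :: bit) = (\<Sum>y\<in>nd e. f y)" for f
    using A by (intro sum.mono_neutral_cong_right) auto
  have "(\<Sum>y\<in>A. of_bool (y \<in> nd e) * (\<Sum>y'\<in>nd e - {y}. z y') * z' y :: bit) =
      (\<Sum>y\<in>nd e. (\<Sum>y'\<in>nd e - {y}. z y') * z' y)"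
    by (simp add: 1[symmetric] mult.assoc)
  also have "\<dots> = (\<Sum>y\<in>nd e. z y * (\<Sum>y'\<in>nd e - {y}. z' y'))"
  proof (cases rule: nd_cases[OF e])
    case (2 a c)
    then have "nd e - {a} = {c}" "nd e - {c} = {a}" by auto
    then show ?thesis using 2 by (simp add: algebra_simps)
  qed simp
  also have "\<dots> = (\<Sum>y\<in>A. z y * (of_bool (y \<in> nd e) * (\<Sum>y'\<in>nd e - {y}. z' y')))"
    by (simp add: 1[symmetric] mult.left_commute)
  finally show ?thesis .
qed

text \<open>The edges of \<open>S\<close> away from \<open>x\<close> and the diagonal entries away
  from \<open>x\<close> form the inner matrix of a bordered one, the edges at \<open>x\<close> its
  column. The sum vanishes for each fixed inner matrix.\<close>

lemma sum_kern_eq_0: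
  assumes x: "x \<in> V" and u: "u \<in> vecs V" "u x = 0" and P: "finite P"
    and c: "x \<notin> P \<and> card {e \<in> E. x \<in> nd e} = 4 \<and> card P \<le> 3 \<or>
            x \<in> P \<and> card {e \<in> E. x \<in> nd e} = 3 \<and> card P = 3"
  shows "(\<Sum>S\<in>Pow E. \<Sum>D\<in>Pow V. of_bool (u \<in> kern S D \<and> full_on P (kern S D)) :: bit) = 0"
proof -
  let ?Ex = "{e \<in> E. x \<in> nd e}" and ?E' = "E - {e \<in> E. x \<in> nd e}"
  let ?f = "\<lambda>S D. of_bool (u \<in> kern S D \<and> full_on P (kern S D)) :: bit"
  have inner: "(\<Sum>T\<in>Pow ?Ex. ?f (S \<union> T) D + ?f (S \<union> T) (insert x D)) = 0"
    if S: "S \<subseteq> ?E'" and D: "D \<subseteq> V - {x}" for S D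
  proof -
    define m where "m z y = (if y \<in> V - {x} then adj S D z y else 0)" for z y
    define g where "g T y = (if y \<in> V - {x} then \<Sum>e\<in>T. of_bool (y \<in> nd e) else 0 :: bit)" for T y
    have finS: "finite S" using S fin(2) by (auto intro: finite_subset)
    interpret B: bordered V x m
    proof
      fix z z' :: "'v \<Rightarrow> bit"
      show "m (z + z') = m z + m z'" by (simp add: m_def adj_add fun_eq_iff)
      show "m z \<in> vecs (V - {x})" by (simp add: m_def vecs_def)
      have "(\<Sum>y\<in>V - {x}. (\<Sum>e\<in>S. of_bool (y \<in> nd e) * (\<Sum>y'\<in>nd e - {y}. z y')) * z' y) =
          (\<Sum>e\<in>S. \<Sum>y\<in>V - {x}. of_bool (y \<in> nd e) * (\<Sum>y'\<in>nd e - {y}. z y') * z' y)"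
        unfolding sum_distrib_right by (rule sum.swap)
      also have "\<dots> = (\<Sum>e\<in>S. \<Sum>y\<in>V - {x}. z y * (of_bool (y \<in> nd e) * (\<Sum>y'\<in>nd e - {y}. z' y')))"
      proof (rule sum.cong[OF refl])
        fix e assume "e \<in> S"
        then have "e \<in> E" "nd e \<subseteq> V - {x}" using S nd(1)[of e] by auto
        then show "(\<Sum>y\<in>V - {x}. of_bool (y \<in> nd e) * (\<Sum>y'\<in>nd e - {y}. z y') * z' y) =
            (\<Sum>y\<in>V - {x}. z y * (of_bool (y \<in> nd e) * (\<Sum>y'\<in>nd e - {y}. z' y')))"
          using fin(1) by (intro edge_form_sym) auto
      qed
      also have "\<dots> = (\<Sum>y\<in>V - {x}. z y * (\<Sum>e\<in>S. of_bool (y \<in> nd e) * (\<Sum>y'\<in>nd e - {y}. z' y')))"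
        unfolding sum_distrib_left by (rule sum.swap)
      finally show "(\<Sum>y\<in>V - {x}. m z y * z' y) = (\<Sum>y\<in>V - {x}. z y * m z' y)"
        by (simp add: m_def adj_def algebra_simps sum.distrib)
    qed (use fin x in auto)
    have kern: "kern (S \<union> T) (D \<union> d) = B.K (g T) (of_bool (x \<in> d))" if T: "T \<subseteq> ?Ex" and d: "d \<subseteq> {x}" for T d
    proof -
      have finT: "finite T" using T fin(2) by (auto intro: finite_subset)
      have ST: "S \<inter> T = {}" using S T by auto
      have 1: "adj (S \<union> T) (D \<union> d) z y = m (z(x := 0)) y + g T y * z x" if y: "y \<in> V - {x}" for z y
      proof -
        have "(\<Sum>e\<in>S. of_bool (y \<in> nd e) * (\<Sum>y'\<in>nd e - {y}. (z(x := 0)) y')) =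
            (\<Sum>e\<in>S. of_bool (y \<in> nd e) * (\<Sum>y'\<in>nd e - {y}. z y'))"
        proof (intro sum.cong refl arg_cong2[where f = "(*)"])
          fix e y' assume "e \<in> S" "y' \<in> nd e - {y}"
          then have "y' \<noteq> x" using S by auto
          then show "(z(x := 0)) y' = z y'" by simp
        qed
        moreover have "(\<Sum>e\<in>T. of_bool (y \<in> nd e) * (\<Sum>y'\<in>nd e - {y}. z y')) = (\<Sum>e\<in>T. of_bool (y \<in> nd e) * z x)"
        proof (intro sum.cong refl)
          fix e assume e: "e \<in> T"
          then have eE: "e \<in> E" "x \<in> nd e" using T by auto
          show "(of_bool (y \<in> nd e) * (\<Sum>y'\<in>nd e - {y}. z y') :: bit) = of_bool (y \<in> nd e) * z x"
          proof (cases "y \<in> nd e")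
            case True
            then have "nd e - {y} = {x}" using eE y by (cases rule: nd_cases[OF eE(1)]) auto
            then show ?thesis by simp
          qed simp
        qed
        moreover have "y \<in> D \<union> d \<longleftrightarrow> y \<in> D" using y d by auto
        ultimately show ?thesis
          using y finS finT ST by (simp add: adj_def m_def g_def sum.union_disjoint sum_distrib_left algebra_simps)
      qed
      have 2: "adj (S \<union> T) (D \<union> d) z x = (\<Sum>y\<in>V - {x}. g T y * z y) + of_bool (x \<in> d) * z x" for z
      proof -
        have "(\<Sum>e\<in>S. of_bool (x \<in> nd e) * (\<Sum>y'\<in>nd e - {x}. z y')) = 0"
          using S by (intro sum.neutral) auto
        moreover have "(\<Sum>e\<in>T. of_bool (x \<in> nd e) * (\<Sum>y'\<in>nd e - {x}. z y')) =
           (\<Sum>e\<in>T. \<Sum>y\<in>V - {x}. of_bool (y \<in> nd e) * z y)"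
        proof (intro sum.cong refl)
          fix e assume e: "e \<in> T"
          have "(\<Sum>y\<in>V - {x}. of_bool (y \<in> nd e) * z y) = (\<Sum>y'\<in>nd e - {x}. z y')"
            using e T nd(1)[of e] fin by (intro sum.mono_neutral_cong_right) auto
          then show "of_bool (x \<in> nd e) * (\<Sum>y'\<in>nd e - {x}. z y') = (\<Sum>y\<in>V - {x}. of_bool (y \<in> nd e) * z y)"
            using e T by auto
        qed
        moreover have "(\<Sum>e\<in>T. \<Sum>y\<in>V - {x}. of_bool (y \<in> nd e) * z y) = (\<Sum>y\<in>V - {x}. g T y * z y)"
          by (subst sum.swap) (simp add: g_def sum_distrib_right)
        moreover have "x \<in> D \<union> d \<longleftrightarrow> x \<in> d" using D by auto
        ultimately show ?thesis
          using finS finT ST by (simp add: adj_def sum.union_disjoint)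
      qed
      have "V = insert x (V - {x})" using x by auto
      then have "(\<forall>y\<in>V. adj (S \<union> T) (D \<union> d) z y = 0) \<longleftrightarrow>
          (\<forall>y\<in>V - {x}. adj (S \<union> T) (D \<union> d) z y = 0) \<and> adj (S \<union> T) (D \<union> d) z x = 0" for z
        by auto
      then show ?thesis unfolding kern_def B.K_def using 1 2 by auto
    qed
    have gW: "g T \<in> vecs (V - {x})" for T by (simp add: g_def vecs_def)
    have g_add: "g (sym_difference T T') = g T + g T'" if "T \<subseteq> ?Ex" "T' \<subseteq> ?Ex" for T T'
    proof -
      have fT: "finite T" "finite T'" using that fin(2) by (auto intro: finite_subset)
      then show ?thesis by (simp add: g_def fun_eq_iff sum_sym_difference)
    qed
    have finEx: "finite ?Ex" using fin by simp
    have "(\<Sum>T\<in>Pow ?Ex. of_bool (u \<in> B.K (g T) 0 \<and> full_on P (B.K (g T) 0)) +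
            of_bool (u \<in> B.K (g T) 1 \<and> full_on P (B.K (g T) 1)) :: bit) = 0"
      using c
    proof
      assume "x \<notin> P \<and> card ?Ex = 4 \<and> card P \<le> 3"
      then show ?thesis
        using B.sum_border_outside[of ?Ex g P u] finEx gW g_add P u by blast
    next
      assume "x \<in> P \<and> card ?Ex = 3 \<and> card P = 3"
      then show ?thesis
        using B.sum_border_inside[of ?Ex g P u] finEx gW g_add P u by blast
    qed
    moreover have "kern (S \<union> T) D = B.K (g T) 0" "kern (S \<union> T) (insert x D) = B.K (g T) 1" if "T \<subseteq> ?Ex" for T
      using kern[OF that, of "{}"] kern[OF that, of "{x}"] by simp_all
    ultimately show ?thesis by simp
  qed
  have "(\<Sum>S\<in>Pow E. \<Sum>D\<in>Pow V. ?f S D) = (\<Sum>S\<in>Pow (?E' \<union> ?Ex). \<Sum>D\<in>Pow (insert x (V - {x})). ?f S D)"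
    using x by (intro sum.cong) (auto simp: insert_absorb)
  also have "\<dots> = (\<Sum>S\<in>Pow ?E'. \<Sum>T\<in>Pow ?Ex. \<Sum>D\<in>Pow (V - {x}). ?f (S \<union> T) D + ?f (S \<union> T) (insert x D))"
  proof -
    have "(\<Sum>D\<in>Pow (insert x (V - {x})). h D) = (\<Sum>D\<in>Pow (V - {x}). h D + h (insert x D))" for h :: "'v set \<Rightarrow> bit"
      unfolding sum.distrib using fin(1) by (intro sum_Pow_insert) auto
    then show ?thesis using fin by (simp only:) (rule sum_Pow_union; auto)
  qed
  also have "\<dots> = (\<Sum>S\<in>Pow ?E'. \<Sum>D\<in>Pow (V - {x}). \<Sum>T\<in>Pow ?Ex. ?f (S \<union> T) D + ?f (S \<union> T) (insert x D))"
    by (intro sum.cong refl sum.swap)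
  also have "\<dots> = 0"
    by (rule sum.neutral, rule ballI, rule sum.neutral, rule ballI, rule inner) auto
  finally show ?thesis .
qed

section \<open>Laplacians among the symmetric matrices\<close>

lemma radical_iff_unit:
  assumes S: "S \<subseteq> E"
  shows "z \<in> cob.radical nd (vecs V) S \<longleftrightarrow>
    z \<in> vecs V \<and> (\<forall>x\<in>V. (\<Sum>e\<in>S. cob nd e z * cob nd e (\<lambda>y. of_bool (y = x))) = 0)"
proof -
  have "(\<forall>x\<in>V. (\<Sum>e\<in>S. cob nd e z * cob nd e (\<lambda>y. of_bool (y = x))) = 0) \<longleftrightarrow>
      (\<forall>y\<in>vecs V. cob.pairing nd S z y = 0)"
  proof
    assume L: "\<forall>x\<in>V. (\<Sum>e\<in>S. cob nd e z * cob nd e (\<lambda>y. of_bool (y = x))) = 0"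
    show "\<forall>y\<in>vecs V. cob.pairing nd S z y = 0"
    proof
      fix y :: "'v \<Rightarrow> bit" assume "y \<in> vecs V"
      have "cob nd e y = (\<Sum>x\<in>V. y x * cob nd e (\<lambda>y. of_bool (y = x)))" if "e \<in> S" for e
      proof -
        have e: "e \<in> E" using that S by auto
        show ?thesis
        proof (cases rule: nd_cases[OF e])
          case (2 a c)
          have "(\<Sum>x\<in>V. y x * cob nd e (\<lambda>y. of_bool (y = x))) = (\<Sum>x\<in>{a, c}. y x)"
            using 2 nd(1)[OF e] fin by (intro sum.mono_neutral_cong_right) (auto simp: cob_def)
          then show ?thesis using 2 by (simp add: cob_def)
        qed (simp add: cob_def)
      qed
      then have "cob.pairing nd S z y = (\<Sum>e\<in>S. \<Sum>x\<in>V. y x * (cob nd e z * cob nd e (\<lambda>y. of_bool (y = x))))"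
        unfolding cob.pairing_def by (intro sum.cong refl) (simp add: sum_distrib_left mult.left_commute)
      also have "\<dots> = (\<Sum>x\<in>V. y x * (\<Sum>e\<in>S. cob nd e z * cob nd e (\<lambda>y. of_bool (y = x))))"
        by (subst sum.swap) (simp add: sum_distrib_left)
      also have "\<dots> = 0" using L by simp
      finally show "cob.pairing nd S z y = 0" .
    qed
  next
    assume R: "\<forall>y\<in>vecs V. cob.pairing nd S z y = 0"
    show "\<forall>x\<in>V. (\<Sum>e\<in>S. cob nd e z * cob nd e (\<lambda>y. of_bool (y = x))) = 0"
    proof
      fix x assume x: "x \<in> V"
      then have "(\<lambda>y. of_bool (y = x)) \<in> vecs V" by (auto simp: vecs_def)
      then show "(\<Sum>e\<in>S. cob nd e z * cob nd e (\<lambda>y. of_bool (y = x))) = 0"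
        using R by (simp add: cob.pairing_def)
    qed
  qed
  then show ?thesis by (auto simp: cob.radical_def)
qed

text \<open>The constant vector is in the kernel exactly when each diagonal entry is the sum of the
  other entries of its row. This leaves a single diagonal \<open>D0\<close>, for which the matrix is
  the Laplacian of \<open>S\<close>.\<close>

lemma kern_one:
  assumes S: "S \<subseteq> E" and P: "\<And>K. K = cob.radical nd (vecs V) S \<Longrightarrow> Q K = q"
  shows "(\<Sum>D\<in>Pow V. of_bool ((\<lambda>x. of_bool (x \<in> V)) \<in> kern S D \<and> Q (kern S D)) :: bit) = of_bool q"
proof -
  let ?one = "(\<lambda>x. of_bool (x \<in> V)) :: 'v \<Rightarrow> bit"
  define d where "d x = (\<Sum>e\<in>S. of_bool (x \<in> nd e) * (\<Sum>y\<in>nd e - {x}. 1 :: bit))" for x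
  define D0 where "D0 = {x \<in> V. d x = 1}"
  have finS: "finite S" using S fin(2) by (rule finite_subset)
  have one: "?one \<in> vecs V" by (simp add: vecs_def)
  have a1: "adj S D ?one x = d x + of_bool (x \<in> D)" if "x \<in> V" for x D
  proof -
    have "(\<Sum>y\<in>nd e - {x}. ?one y) = (\<Sum>y\<in>nd e - {x}. 1)" if "e \<in> S" for e
      using that S nd(1) by (intro sum.cong) auto
    then show ?thesis using that by (simp add: adj_def d_def)
  qed
  have D: "?one \<in> kern S D \<longleftrightarrow> D = D0" if "D \<subseteq> V" for D
  proof -
    have "?one \<in> kern S D \<longleftrightarrow> (\<forall>x\<in>V. d x = of_bool (x \<in> D))"
      using one a1 by (auto simp: kern_def bit_add_eq_0_iff)
    also have "\<dots> \<longleftrightarrow> D = D0"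
      using that unfolding D0_def by (auto simp: bit_eqI)
    finally show ?thesis .
  qed
  have a2: "adj S D0 z x = (\<Sum>e\<in>S. cob nd e z * cob nd e (\<lambda>y. of_bool (y = x)))" if x: "x \<in> V" for z x
  proof -
    have "adj S D0 z x = (\<Sum>e\<in>S. of_bool (x \<in> nd e) * (\<Sum>y\<in>nd e - {x}. z y)) + d x * z x"
      using x by (auto simp: adj_def D0_def)
    also have "\<dots> = (\<Sum>e\<in>S. of_bool (x \<in> nd e) * (\<Sum>y\<in>nd e - {x}. z y) + of_bool (x \<in> nd e) * (\<Sum>y\<in>nd e - {x}. 1) * z x)"
      by (simp add: d_def sum_distrib_right sum.distrib)
    also have "\<dots> = (\<Sum>e\<in>S. cob nd e z * cob nd e (\<lambda>y. of_bool (y = x)))"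
    proof (intro sum.cong refl)
      fix e assume "e \<in> S"
      then have e: "e \<in> E" using S by auto
      show "of_bool (x \<in> nd e) * (\<Sum>y\<in>nd e - {x}. z y) + of_bool (x \<in> nd e) * (\<Sum>y\<in>nd e - {x}. 1) * z x =
          cob nd e z * cob nd e (\<lambda>y. of_bool (y = x))"
      proof (cases rule: nd_cases[OF e])
        case (1 a)
        then show ?thesis by (simp add: cob_def)
      next
        case (2 a c)
        then have "nd e - {a} = {c}" "nd e - {c} = {a}" by auto
        moreover have "card (nd e) = 2" "x \<in> nd e \<longleftrightarrow> x = a \<or> x = c" using 2 by auto
        moreover have "(\<Sum>y\<in>nd e. z y) = z a + z c"
          "(\<Sum>y\<in>nd e. of_bool (y = x) :: bit) = of_bool (a = x) + of_bool (c = x)"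
          using 2 by simp_all
        ultimately show ?thesis
          using 2(2) by (cases "x = a"; cases "x = c"; simp add: cob_def add.commute)
      qed
    qed
    finally show ?thesis .
  qed
  have kern: "kern S D0 = cob.radical nd (vecs V) S"
    using a2 by (auto simp: kern_def radical_iff_unit[OF S])
  have "(\<Sum>D\<in>Pow V. of_bool (?one \<in> kern S D \<and> Q (kern S D)) :: bit) = (\<Sum>D\<in>Pow V. of_bool (D = D0) * of_bool q)"
    using D P kern by (intro sum.cong refl) auto
  also have "\<dots> = of_bool q"
    unfolding sum_distrib_right[symmetric]
    using fin(1) by (simp add: sum_of_bool_bit D0_def of_bool_def Collect_conv_if)
  finally show ?thesis .
qed

text \<open>The count of matrices whose kernel restricts isomorphically to both \<open>P\<close> and \<open>Q\<close> does not
  distinguish \<open>P\<close> from \<open>Q\<close>; summing over the kernel vector that is 1 on \<open>Q\<close> reduces it to Laplacians.\<close>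

lemma full_on_kern_both:
  assumes PQ: "P \<subseteq> V" "Q \<subseteq> V" "P \<inter> Q = {}" "card P \<le> 3" "card Q \<le> 3"
    and c4: "\<And>x. x \<in> V \<Longrightarrow> x \<notin> P \<Longrightarrow> x \<notin> Q \<Longrightarrow> card {e \<in> E. x \<in> nd e} = 4"
    and c3: "\<And>x. x \<in> P \<Longrightarrow> card P = 3 \<Longrightarrow> card {e \<in> E. x \<in> nd e} = 3"
  shows "(\<Sum>S\<in>Pow E. \<Sum>D\<in>Pow V. of_bool (full_on P (kern S D) \<and> full_on Q (kern S D)) :: bit) =
    (\<Sum>S\<in>Pow E. of_bool (full_on P (cob.radical nd (vecs V) S)))"
proof -
  have finP: "finite P" "finite Q" by (rule finite_subset[OF PQ(1) fin(1)], rule finite_subset[OF PQ(2) fin(1)])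
  note U = subspace2_vecs[OF fin(1)]
  let ?one = "(\<lambda>x. of_bool (x \<in> V)) :: 'v \<Rightarrow> bit"
  let ?U1 = "{u \<in> vecs V. \<forall>q\<in>Q. u q = 1}"
  have fU: "finite ?U1" using finite_vecs[OF fin(1)] by simp
  have one: "?one \<in> ?U1" using PQ by (auto simp: vecs_def)
  let ?f = "\<lambda>u S D. of_bool (u \<in> kern S D \<and> full_on P (kern S D)) :: bit"
  show ?thesis
  proof (cases "card P = 3")
    case False
    \<comment> \<open>An 8-element space does not embed into fewer than three coordinates, so with
      repeated neighbours both sides are 0.\<close>
    have "\<not> full_on P K" if "subspace2 K" for K :: "('v \<Rightarrow> bit) set"
      using full_on_card[OF finP(1) that] PQ False by auto
    moreover have "subspace2 (cob.radical nd (vecs V) S)" for S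
      by (rule cob.subspace2_radical[OF U])
    ultimately show ?thesis using kern_subspace by simp
  next
    case True
    have "(\<Sum>S\<in>Pow E. \<Sum>D\<in>Pow V. of_bool (full_on P (kern S D) \<and> full_on Q (kern S D)) :: bit) =
        (\<Sum>S\<in>Pow E. \<Sum>D\<in>Pow V. \<Sum>u\<in>?U1. ?f u S D)"
    proof (intro sum.cong refl)
      fix S D
      have sub: "kern S D \<subseteq> vecs V" by (auto simp: kern_def)
      show "(of_bool (full_on P (kern S D) \<and> full_on Q (kern S D)) :: bit) =
          (\<Sum>u\<in>?U1. ?f u S D)"
      proof (cases "full_on P (kern S D)")
        case True
        then have "card (kern S D) = 8" by (simp add: full_on_def)
        from full_on_parity[OF kern_subspace sub this finite_vecs[OF fin(1)] finP(2) PQ(5)] True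
        show ?thesis by simp
      qed simp
    qed
    also have "\<dots> = (\<Sum>S\<in>Pow E. \<Sum>u\<in>?U1. \<Sum>D\<in>Pow V. ?f u S D)"
      by (intro sum.cong refl sum.swap)
    also have "\<dots> = (\<Sum>u\<in>?U1. \<Sum>S\<in>Pow E. \<Sum>D\<in>Pow V. ?f u S D)"
      by (rule sum.swap)
    also have "\<dots> = (\<Sum>u\<in>{?one}. \<Sum>S\<in>Pow E. \<Sum>D\<in>Pow V. ?f u S D)"
    proof (rule sum.mono_neutral_right[OF fU])
      show "\<forall>u\<in>?U1 - {?one}. (\<Sum>S\<in>Pow E. \<Sum>D\<in>Pow V. ?f u S D) = 0"
      proof
        fix u assume u: "u \<in> ?U1 - {?one}"
        have "\<exists>x\<in>V. u x = 0"
        proof (rule ccontr)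
          assume "\<not> (\<exists>x\<in>V. u x = 0)"
          then have "u = ?one" using u by (auto simp: vecs_def fun_eq_iff)
          then show False using u by simp
        qed
        then obtain x where x: "x \<in> V" "u x = 0" by blast
        \<comment> \<open>\<open>u\<close> is 1 on \<open>Q\<close>. Hence \<open>x\<close> has
          three edges if it lies in \<open>P\<close> and four otherwise.\<close>
        then have "x \<notin> Q" using u by auto
        then show "(\<Sum>S\<in>Pow E. \<Sum>D\<in>Pow V. ?f u S D) = 0"
          using x u c4[of x] c3[of x] True finP by (intro sum_kern_eq_0[of x]) auto
      qed
    qed (use one in auto)
    also have "\<dots> = (\<Sum>S\<in>Pow E. of_bool (full_on P (cob.radical nd (vecs V) S)))"
      by (simp add: kern_one)
    finally show ?thesis .
  qed
qed

theorem sum_full_on_swap: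
  assumes PQ: "P \<subseteq> V" "Q \<subseteq> V" "P \<inter> Q = {}" "card P \<le> 3" "card Q \<le> 3"
    and c4: "\<And>x. x \<in> V \<Longrightarrow> x \<notin> P \<Longrightarrow> x \<notin> Q \<Longrightarrow> card {e \<in> E. x \<in> nd e} = 4"
    and c3: "\<And>x. x \<in> P \<Longrightarrow> card P = 3 \<Longrightarrow> card {e \<in> E. x \<in> nd e} = 3"
      "\<And>x. x \<in> Q \<Longrightarrow> card Q = 3 \<Longrightarrow> card {e \<in> E. x \<in> nd e} = 3"
  shows "(\<Sum>S\<in>Pow E. of_bool (full_on P (cob.radical nd (vecs V) S)) :: bit) =
    (\<Sum>S\<in>Pow E. of_bool (full_on Q (cob.radical nd (vecs V) S)))"
  using full_on_kern_both[of P Q] full_on_kern_both[of Q P] assms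
  by (simp add: conj_commute Int_commute)

end

section \<open>Spanning trees as bases\<close>

lemma cob_pair:
  assumes "nd e = {a, c}"
  shows "cob nd e z = z a + z c"
  using assms by (cases "a = c") (simp_all add: cob_def)

lemma rtranclp_distinct_path:
  assumes "r\<^sup>*\<^sup>* x y"
  shows "\<exists>ps. ps \<noteq> [] \<and> hd ps = x \<and> last ps = y \<and> distinct ps \<and>
    (\<forall>i. Suc i < length ps \<longrightarrow> r (ps ! i) (ps ! Suc i))"
  using assms
proof (induction rule: rtranclp_induct)
  case base
  show ?case by (rule exI[of _ "[x]"]) simp
next
  case (step y y')
  then obtain ps where ps: "ps \<noteq> []" "hd ps = x" "last ps = y" "distinct ps"
    "\<And>i. Suc i < length ps \<Longrightarrow> r (ps ! i) (ps ! Suc i)" by blast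
  show ?case
  proof (cases "y' \<in> set ps")
    case True
    then obtain as bs where ab: "ps = as @ y' # bs" by (meson split_list)
    let ?qs = "as @ [y']"
    have "r (?qs ! i) (?qs ! Suc i)" if "Suc i < length ?qs" for i
    proof -
      have "Suc i < length ps" using that ab by simp
      moreover have "ps ! i = ?qs ! i" "ps ! Suc i = ?qs ! Suc i"
        using that ab by (auto simp: nth_append)
      ultimately show ?thesis using ps(5) by metis
    qed
    moreover have "hd ?qs = x" using ps(2) ab by (cases as) auto
    ultimately show ?thesis using ps(4) ab by (intro exI[of _ ?qs]) auto
  next
    case False
    let ?qs = "ps @ [y']"
    have "r (?qs ! i) (?qs ! Suc i)" if "Suc i < length ?qs" for i
    proof (cases "Suc i < length ps")
      case True
      then show ?thesis using ps(5)[of i] by (simp add: nth_append)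
    next
      case F: False
      then have i: "Suc i = length ps" using that by simp
      then have "ps ! i = y" using ps(1,3) by (metis diff_Suc_1 last_conv_nth)
      then show ?thesis using i step(2) by (simp add: nth_append)
    qed
    then show ?thesis using ps False by (intro exI[of _ ?qs]) auto
  qed
qed

lemma path_gives_cycle:
  assumes e: "e \<in> edges H" "ends H e = {x, y}" "x \<noteq> y"
    and path: "(\<lambda>a c. \<exists>e'\<in>edges H - {e}. ends H e' = {a, c})\<^sup>*\<^sup>* x y"
  shows "\<exists>vs es. is_cycle H vs es"
proof -
  obtain ps where ps: "ps \<noteq> []" "hd ps = x" "last ps = y" "distinct ps"
    "\<And>i. Suc i < length ps \<Longrightarrow> \<exists>e'\<in>edges H - {e}. ends H e' = {ps ! i, ps ! Suc i}"
    using rtranclp_distinct_path[OF path] by blast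
  then obtain f where f: "\<And>i. Suc i < length ps \<Longrightarrow> f i \<in> edges H - {e} \<and> ends H (f i) = {ps ! i, ps ! Suc i}"
    by metis
  obtain k where k: "length ps = Suc k" using ps(1) by (cases ps) auto
  let ?es = "map f [0..<k] @ [e]"
  have inj: "i = j" if ij: "i < k" "j < k" "f i = f j" for i j
  proof -
    have "{ps ! i, ps ! Suc i} = {ps ! j, ps ! Suc j}" using f[of i] f[of j] ij k by auto
    then show ?thesis
      using ij k ps(4) by (auto simp: doubleton_eq_iff nth_eq_iff_index_eq)
  qed
  have "is_cycle H ps ?es"
    unfolding is_cycle_def
  proof (intro conjI allI impI)
    have "f i \<noteq> e" if "i < k" for i using f[of i] that k by auto
    then have "e \<notin> f ` {0..<k}" by (metis atLeastLessThan_iff imageE)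
    then show "distinct ?es" using inj by (simp add: distinct_map inj_on_def)
    show "set ?es \<subseteq> edges H" using f k e by auto
    fix i assume "i < length ?es"
    then consider "i < k" | "i = k" by fastforce
    then show "ends H (?es ! i) = {ps ! i, ps ! (Suc i mod length ps)}"
    proof cases
      case 1
      then show ?thesis using f[of i] k by (simp add: nth_append)
    next
      case 2
      then have "ps ! i = y" "ps ! 0 = x" using ps(1-3) k by (simp_all add: last_conv_nth hd_conv_nth)
      then show ?thesis using 2 e k by (simp add: nth_append insert_commute)
    qed
  qed (use ps k in auto)
  then show ?thesis by blast
qed

text \<open>Each vertex of the cycle contributes its value twice; indexing by list positions covers
  the cycles of length 1 and 2 as well.\<close>

lemma cycle_sum_cob:
  assumes "is_cycle H vs es"
  shows "(\<Sum>i<length es. cob (ends H) (es ! i) z) = 0"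
proof -
  obtain k where k: "length es = Suc k" using assms by (cases es) (auto simp: is_cycle_def)
  have n: "length vs = Suc k" using assms k by (simp add: is_cycle_def)
  have "(\<Sum>i<length es. cob (ends H) (es ! i) z) = (\<Sum>i<Suc k. z (vs ! i) + z (vs ! (Suc i mod Suc k)))"
    using assms k n by (intro sum.cong) (auto simp: is_cycle_def intro: cob_pair)
  also have "\<dots> = (\<Sum>i<Suc k. z (vs ! i)) + (\<Sum>i<Suc k. z (vs ! (Suc i mod Suc k)))"
    by (rule sum.distrib)
  also have "(\<Sum>i<Suc k. z (vs ! (Suc i mod Suc k))) = (\<Sum>i<k. z (vs ! Suc i)) + z (vs ! 0)"
    by simp
  also have "\<dots> = (\<Sum>i<Suc k. z (vs ! i))"
    by (simp only: sum.lessThan_Suc_shift add.commute)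
  finally show ?thesis by simp
qed

text \<open>Requiring the value 0 at \<open>w\<close> removes the constants. Connectedness then says
  that a function with zero coboundary along \<open>T\<close> is 0, and acyclicity that each edge of
  \<open>T\<close> has a dual vector, so the two halves of \<open>is_tree\<close> match the two
  halves of \<open>basis\<close>.\<close>

lemma tree_iff_basis:
  assumes H: "wf_graph H" and w: "w \<in> verts H" and T: "T \<subseteq> edges H"
  shows "is_tree (H\<lparr>edges := T\<rparr>) \<longleftrightarrow> cob.basis (ends H) (vecs (verts H - {w})) T"
proof -
  let ?H = "H\<lparr>edges := T\<rparr>" and ?U = "vecs (verts H - {w})" and ?b = "cob (ends H)"
  let ?r = "\<lambda>x y. y \<in> neighbours ?H x"
  have ends: "ends H e \<subseteq> verts H" "card (ends H e) = 1 \<or> card (ends H e) = 2" if "e \<in> T" for e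
    using H T that by (auto simp: wf_graph_def)
  have pair: "\<exists>x y. ends H e = {x, y}" if "e \<in> T" for e
    using ends(2)[OF that] by (metis card_1_singleton_iff card_2_iff insert_absorb2 One_nat_def)
  have r: "?r x y \<longleftrightarrow> (\<exists>e\<in>T. ends H e = {x, y})" for x y by (simp add: neighbours_def)
  have sym: "symp ?r" unfolding symp_def r by (metis insert_commute)
  have con: "connected_graph ?H \<longleftrightarrow> (\<forall>z\<in>?U. (\<forall>e\<in>T. ?b e z = 0) \<longrightarrow> z = 0)"
  proof
    assume C: "connected_graph ?H"
    show "\<forall>z\<in>?U. (\<forall>e\<in>T. ?b e z = 0) \<longrightarrow> z = 0"
    proof (intro ballI impI ext)
      fix z u assume z: "z \<in> ?U" "\<forall>e\<in>T. ?b e z = 0"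
      show "z u = 0 u"
      proof (cases "u \<in> verts H")
        case True
        then have "?r\<^sup>*\<^sup>* w u" using C w by (auto simp: connected_graph_def)
        then have "z u = z w"
        proof (induction rule: rtranclp_induct)
          case (step y y')
          then obtain e where "e \<in> T" "ends H e = {y, y'}" using r by blast
          then have "z y + z y' = 0" using z cob_pair[of "ends H" e y y' z] by simp
          then show ?case using step by (simp add: bit_add_eq_0_iff)
        qed simp
        then show ?thesis using z by (simp add: vecs_def)
      qed (use z in \<open>simp add: vecs_def\<close>)
    qed
  next
    assume I: "\<forall>z\<in>?U. (\<forall>e\<in>T. ?b e z = 0) \<longrightarrow> z = 0"
    \<comment> \<open>The vertices out of reach of \<open>w\<close> form a union of components, so
      no edge of \<open>T\<close> leaves them.\<close>
    let ?z = "\<lambda>y. of_bool (y \<in> verts H \<and> \<not> ?r\<^sup>*\<^sup>* w y) :: bit"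
    have "?z \<in> ?U" by (auto simp: vecs_def)
    moreover have "?b e ?z = 0" if e: "e \<in> T" for e
    proof -
      obtain x y where xy: "ends H e = {x, y}" using pair e by blast
      then have "?r x y" "?r y x" using e r by (auto simp: insert_commute)
      then have "?r\<^sup>*\<^sup>* w x \<longleftrightarrow> ?r\<^sup>*\<^sup>* w y" by (meson rtranclp.rtrancl_into_rtrancl)
      moreover have "x \<in> verts H" "y \<in> verts H" using ends[OF e] xy by auto
      ultimately show ?thesis using cob_pair[of "ends H" e x y ?z] xy by simp
    qed
    ultimately have "?z = 0" using I by blast
    then have reach: "?r\<^sup>*\<^sup>* w u" if "u \<in> verts H" for u
      using that by (auto simp: fun_eq_iff)
    have "?r\<^sup>*\<^sup>* u v" if "u \<in> verts H" "v \<in> verts H" for u v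
      using reach[OF that(1)] reach[OF that(2)] symp_rtranclp[OF sym]
      by (meson rtranclp_trans sympD)
    then show "connected_graph ?H" using w by (auto simp: connected_graph_def)
  qed
  have acyc: "(\<nexists>vs es. is_cycle ?H vs es) \<longleftrightarrow>
      (\<forall>e\<in>T. \<exists>z\<in>?U. ?b e z = 1 \<and> (\<forall>e'\<in>T - {e}. ?b e' z = 0))"
  proof
    assume A: "\<nexists>vs es. is_cycle ?H vs es"
    show "\<forall>e\<in>T. \<exists>z\<in>?U. ?b e z = 1 \<and> (\<forall>e'\<in>T - {e}. ?b e' z = 0)"
    proof
      fix e assume e: "e \<in> T"
      obtain x y where xy: "ends H e = {x, y}" using pair e by blast
      have "x \<noteq> y"
      proof
        assume "x = y"
        then have "is_cycle ?H [x] [e]" using xy e by (simp add: is_cycle_def)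
        then show False using A by blast
      qed
      let ?s = "\<lambda>a c. \<exists>e'\<in>T - {e}. ends H e' = {a, c}"
      have nr: "\<not> ?s\<^sup>*\<^sup>* x y"
        using path_gives_cycle[of e ?H x y] A e xy \<open>x \<noteq> y\<close> by auto
      \<comment> \<open>The indicator of the component of \<open>x\<close> after removal of
        \<open>e\<close>; among the edges of \<open>T\<close> its coboundary only sees
        \<open>e\<close>. The second summand is a constant that makes it vanish at
        \<open>w\<close>.\<close>
      let ?z = "\<lambda>a. of_bool (a \<in> verts H) * (of_bool (?s\<^sup>*\<^sup>* x a) + of_bool (?s\<^sup>*\<^sup>* x w)) :: bit"
      have V: "x \<in> verts H" "y \<in> verts H" using ends[OF e] xy by auto
      have "?z \<in> ?U" by (auto simp: vecs_def)
      moreover have "?b e ?z = 1"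
        using cob_pair[of "ends H" e x y ?z] xy V nr by (simp add: algebra_simps)
      moreover have "?b e' ?z = 0" if e': "e' \<in> T - {e}" for e'
      proof -
        obtain a c where ac: "ends H e' = {a, c}" using pair e' by blast
        then have "?s a c" "?s c a" using e' by (auto simp: insert_commute)
        then have "?s\<^sup>*\<^sup>* x a \<longleftrightarrow> ?s\<^sup>*\<^sup>* x c"
          using rtranclp.rtrancl_into_rtrancl[of ?s x a c] rtranclp.rtrancl_into_rtrancl[of ?s x c a] by blast
        moreover have "a \<in> verts H" "c \<in> verts H" using ends[of e'] e' ac by auto
        ultimately show ?thesis using cob_pair[of "ends H" e' a c ?z] ac by simp
      qed
      ultimately show "\<exists>z\<in>?U. ?b e z = 1 \<and> (\<forall>e'\<in>T - {e}. ?b e' z = 0)" by blast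
    qed
  next
    assume D: "\<forall>e\<in>T. \<exists>z\<in>?U. ?b e z = 1 \<and> (\<forall>e'\<in>T - {e}. ?b e' z = 0)"
    show "\<nexists>vs es. is_cycle ?H vs es"
    proof (intro notI, elim exE)
      fix vs es assume C: "is_cycle ?H vs es"
      then have es: "set es \<subseteq> T" "distinct es" "length es > 0" by (auto simp: is_cycle_def)
      then have "es ! 0 \<in> T" by auto
      then obtain z where z: "?b (es ! 0) z = 1" "\<forall>e'\<in>T - {es ! 0}. ?b e' z = 0" using D by blast
      obtain k where k: "length es = Suc k" using es(3) by (cases es) auto
      have "?b (es ! Suc i) z = 0" if "i < k" for i
      proof -
        have "es ! Suc i \<in> set es" using k that by (intro nth_mem) simp
        moreover have "es ! Suc i \<noteq> es ! 0" using es(2) k that by (simp add: nth_eq_iff_index_eq)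
        ultimately show ?thesis using z(2) es(1) by blast
      qed
      then have "(\<Sum>i<length es. ?b (es ! i) z) = 1"
        using z(1) by (simp only: k sum.lessThan_Suc_shift) simp
      then show False using cycle_sum_cob[OF C, of z] by simp
    qed
  qed
  show ?thesis
    unfolding is_tree_def cob.basis_def con acyc ..
qed

lemma spanning_trees_eq_basis:
  assumes "wf_graph H" "w \<in> verts H"
  shows "spanning_trees H = {T \<in> Pow (edges H). cob.basis (ends H) (vecs (verts H - {w})) T}"
  using tree_iff_basis[OF assms] by (auto simp: spanning_trees_def)

lemma of_int_bit_eq_0_iff: "of_int i = (0::bit) \<longleftrightarrow> even i"
  by (cases i rule: int_cases2) (simp_all add: of_nat_bit_eq_0_iff)

text \<open>A point is given by the set \<open>A\<close> of variables equal to 1, and the monomial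
  of a tree \<open>T\<close> is 1 there exactly when \<open>A\<close> contains every edge outside
  \<open>T\<close>.\<close>

lemma zero_count_2:
  assumes H: "wf_graph H" and w: "w \<in> verts H"
  shows "zero_count 2 H = card {A \<in> Pow (edges H).
    (\<Sum>T\<in>Pow (edges H). of_bool (edges H - T \<subseteq> A \<and>
        cob.basis (ends H) (vecs (verts H - {w})) T) :: bit) = 0}"
proof -
  let ?E = "edges H" and ?B = "cob.basis (ends H) (vecs (verts H - {w}))"
  have fin: "finite ?E" using H by (simp add: wf_graph_def)
  define f where "f A e = (if e \<in> ?E then of_bool (e \<in> A) else undefined :: int)" for A e
  let ?X = "{\<alpha> \<in> ?E \<rightarrow>\<^sub>E {0..<int 2}. [graph_poly H \<alpha> = 0] (mod int 2)}"
  let ?Y = "{A \<in> Pow ?E. (\<Sum>T\<in>Pow ?E. of_bool (?E - T \<subseteq> A \<and> ?B T) :: bit) = 0}"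
  have poly: "[graph_poly H (f A) = 0] (mod int 2) \<longleftrightarrow>
      (\<Sum>T\<in>Pow ?E. of_bool (?E - T \<subseteq> A \<and> ?B T) :: bit) = 0" for A
  proof -
    have "of_int (graph_poly H (f A)) = (\<Sum>T\<in>spanning_trees H. \<Prod>e\<in>?E - T. of_int (f A e) :: bit)"
      by (simp add: graph_poly_def)
    also have "\<dots> = (\<Sum>T\<in>spanning_trees H. of_bool (?E - T \<subseteq> A))"
    proof (rule sum.cong[OF refl])
      fix T
      have "(\<Prod>e\<in>?E - T. of_int (f A e) :: bit) = (\<Prod>e\<in>?E - T. of_bool (e \<in> A))"
        by (rule prod.cong) (auto simp: f_def)
      also have "\<dots> = of_bool (?E - T \<subseteq> A)"
      proof (cases "?E - T \<subseteq> A")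
        case True
        then show ?thesis by (simp add: prod.neutral subset_iff)
      next
        case False
        then show ?thesis using fin by (subst prod_zero) auto
      qed
      finally show "(\<Prod>e\<in>?E - T. of_int (f A e) :: bit) = of_bool (?E - T \<subseteq> A)" .
    qed
    also have "\<dots> = (\<Sum>T\<in>Pow ?E. of_bool (?E - T \<subseteq> A \<and> ?B T))"
      unfolding spanning_trees_eq_basis[OF H w]
      using fin by (intro sum.mono_neutral_cong_left) auto
    finally show ?thesis by (simp add: cong_0_iff flip: of_int_bit_eq_0_iff)
  qed
  have "bij_betw f ?Y ?X"
  proof (rule bij_betwI[where g = "\<lambda>\<alpha>. {e \<in> ?E. \<alpha> e = 1}"])
    show "f \<in> ?Y \<rightarrow> ?X"
    proof (rule Pi_I)
      fix A assume A: "A \<in> ?Y"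
      have "f A \<in> ?E \<rightarrow>\<^sub>E {0..<int 2}" by (auto simp: f_def)
      then show "f A \<in> ?X" using poly[of A] A by simp
    qed
    have inv: "f {e \<in> ?E. \<alpha> e = 1} = \<alpha>" if "\<alpha> \<in> ?E \<rightarrow>\<^sub>E {0..<int 2}" for \<alpha>
    proof
      fix e
      show "f {e \<in> ?E. \<alpha> e = 1} e = \<alpha> e"
      proof (cases "e \<in> ?E")
        case True
        then have "\<alpha> e \<in> {0..<int 2}" using that by blast
        then have "\<alpha> e = 0 \<or> \<alpha> e = 1" by auto
        then show ?thesis using True by (auto simp: f_def)
      next
        case False
        then show ?thesis using PiE_arb[OF that False] by (simp add: f_def)
      qed
    qed
    show "(\<lambda>\<alpha>. {e \<in> ?E. \<alpha> e = 1}) \<in> ?X \<rightarrow> ?Y"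
    proof (rule Pi_I)
      fix \<alpha> assume \<alpha>: "\<alpha> \<in> ?X"
      then have eq: "f {e \<in> ?E. \<alpha> e = 1} = \<alpha>" using inv by blast
      have "[graph_poly H \<alpha> = 0] (mod int 2)" using \<alpha> by blast
      then show "{e \<in> ?E. \<alpha> e = 1} \<in> ?Y"
        using poly[of "{e \<in> ?E. \<alpha> e = 1}"] unfolding eq by blast
    qed
    show "f {e \<in> ?E. \<alpha> e = 1} = \<alpha>" if "\<alpha> \<in> ?X" for \<alpha> using inv that by blast
    show "{e \<in> ?E. f A e = 1} = A" if "A \<in> ?Y" for A using that by (auto simp: f_def)
  qed
  from bij_betw_same_card[OF this] show ?thesis unfolding zero_count_def by simp
qed

section \<open>Expansion at an additional vertex\<close>

lemma sum_Pow_supersets: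
  assumes "finite E" "A \<subseteq> E"
  shows "(\<Sum>F\<in>Pow E. of_bool (E - F \<subseteq> A \<and> P F) :: bit) = (\<Sum>F\<in>Pow A. of_bool (P (E - A \<union> F)))"
proof -
  have "(\<Sum>F\<in>Pow E. of_bool (E - F \<subseteq> A \<and> P F) :: bit) = (\<Sum>F\<in>(\<lambda>F. E - A \<union> F) ` Pow A. of_bool (P F))"
  proof (rule sum.mono_neutral_cong_right)
    show "\<forall>F\<in>Pow E - (\<lambda>F. E - A \<union> F) ` Pow A. (of_bool (E - F \<subseteq> A \<and> P F) :: bit) = 0"
    proof
      fix F assume F: "F \<in> Pow E - (\<lambda>F. E - A \<union> F) ` Pow A"
      have "\<not> E - F \<subseteq> A"
      proof
        assume "E - F \<subseteq> A"
        then have "F = E - A \<union> (F \<inter> A)" using F by auto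
        then have "F \<in> (\<lambda>F. E - A \<union> F) ` Pow A" by (rule image_eqI) simp
        then show False using F by simp
      qed
      then show "(of_bool (E - F \<subseteq> A \<and> P F) :: bit) = 0" by simp
    qed
  qed (use assms in auto)
  also have "\<dots> = (\<Sum>F\<in>Pow A. of_bool (P (E - A \<union> F)))"
  proof (rule sum.reindex_cong[where l = "\<lambda>F. E - A \<union> F"])
    show "inj_on (\<lambda>F. E - A \<union> F) (Pow A)"
      by (rule inj_on_inverseI[where g = "\<lambda>F. F \<inter> A"]) auto
  qed auto
  finally show ?thesis .
qed

context bit_forms
begin

text \<open>Expanding the polynomial in the variables of the star edges, this is the coefficient,
  evaluated at the point \<open>A\<close>, of the product of the variables of the star edges outside
  \<open>J\<close>.\<close>

definition dual_sum :: "('v \<Rightarrow> bit) set \<Rightarrow> 'e set \<Rightarrow> 'e set \<Rightarrow> 'e set \<Rightarrow> bit" where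
  "dual_sum U E J A = (\<Sum>F\<in>Pow E. of_bool (E - F \<subseteq> A \<and> basis U (F \<union> J)))"

lemma card_zeros_split:
  assumes "finite E" "finite W" "E \<inter> W = {}"
  shows "card {A \<in> Pow (E \<union> W). (\<Sum>T\<in>Pow (E \<union> W). of_bool (E \<union> W - T \<subseteq> A \<and> basis U T) :: bit) = 0} =
    (\<Sum>A\<in>Pow E. \<Sum>X\<in>Pow W. of_bool ((\<Sum>J\<in>Pow W. of_bool (W - J \<subseteq> X) * dual_sum U E J A) = 0))"
proof -
  let ?\<phi> = "\<lambda>A. (\<Sum>T\<in>Pow (E \<union> W). of_bool (E \<union> W - T \<subseteq> A \<and> basis U T) :: bit)"
  have fin: "finite (Pow (E \<union> W))" using assms by simp
  have "card {A \<in> Pow (E \<union> W). ?\<phi> A = 0} = (\<Sum>A\<in>Pow (E \<union> W). of_bool (?\<phi> A = 0))"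
    using fin by (simp add: sum_of_bool_eq Int_def)
  also have "\<dots> = (\<Sum>A\<in>Pow E. \<Sum>X\<in>Pow W. of_bool (?\<phi> (A \<union> X) = 0))"
    using assms by (rule sum_Pow_union)
  also have "\<dots> = (\<Sum>A\<in>Pow E. \<Sum>X\<in>Pow W. of_bool ((\<Sum>J\<in>Pow W. of_bool (W - J \<subseteq> X) * dual_sum U E J A) = 0))"
  proof (rule sum.cong[OF refl], rule sum.cong[OF refl])
    fix A X assume AX: "A \<in> Pow E" "X \<in> Pow W"
    have "?\<phi> (A \<union> X) = (\<Sum>F\<in>Pow E. \<Sum>J\<in>Pow W. of_bool (E \<union> W - (F \<union> J) \<subseteq> A \<union> X \<and> basis U (F \<union> J)))"
      using assms by (rule sum_Pow_union)
    also have "\<dots> = (\<Sum>J\<in>Pow W. \<Sum>F\<in>Pow E. of_bool (E \<union> W - (F \<union> J) \<subseteq> A \<union> X \<and> basis U (F \<union> J)))"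
      by (rule sum.swap)
    also have "\<dots> = (\<Sum>J\<in>Pow W. of_bool (W - J \<subseteq> X) * dual_sum U E J A)"
      unfolding dual_sum_def sum_distrib_left
    proof (intro sum.cong refl)
      fix J F assume JF: "J \<in> Pow W" "F \<in> Pow E"
      have "E \<union> W - (F \<union> J) \<subseteq> A \<union> X \<longleftrightarrow> E - F \<subseteq> A \<and> W - J \<subseteq> X"
        using AX JF assms(3) by blast
      then show "(of_bool (E \<union> W - (F \<union> J) \<subseteq> A \<union> X \<and> basis U (F \<union> J)) :: bit) =
          of_bool (W - J \<subseteq> X) * of_bool (E - F \<subseteq> A \<and> basis U (F \<union> J))" by auto
    qed
    finally show "of_bool (?\<phi> (A \<union> X) = 0) = (of_bool ((\<Sum>J\<in>Pow W. of_bool (W - J \<subseteq> X) * dual_sum U E J A) = 0) :: nat)"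
      by simp
  qed
  finally show ?thesis .
qed

end

lemma bit_add_eq_imp: "x + y = z \<Longrightarrow> x = z + (y::bit)"
  by (auto simp: add.assoc)

context pointed_forms
begin

lemma basis_no_root: "F \<subseteq> S \<Longrightarrow> s \<in> W \<Longrightarrow> \<not> basis U F"
  using basis_inj[of U F one] one one_ne_0 by blast

lemma dual_sum_empty: "s \<in> W \<Longrightarrow> dual_sum U S {} A = 0"
  unfolding dual_sum_def using basis_no_root by (intro sum.neutral) auto

lemma dual_sum_root:
  assumes "s \<in> W" "s' \<in> W"
  shows "dual_sum U S {s} A = dual_sum U S {s'} A"
  unfolding dual_sum_def using basis_root_indep[of _ s s'] basis_root_indep[of _ s' s] assms
  by (intro sum.cong refl arg_cong[where f = of_bool]) auto

lemma dual_sum_pairs: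
  assumes W: "s1 \<in> W" "s2 \<in> W" "s3 \<in> W" "s1 \<noteq> s2" "s1 \<noteq> s3" "s2 \<noteq> s3"
  shows "dual_sum U S {s1, s2} A + dual_sum U S {s1, s3} A + dual_sum U S {s2, s3} A = 0"
proof -
  have "(of_bool (S - F \<subseteq> A \<and> basis U (F \<union> {s1, s2})) + of_bool (S - F \<subseteq> A \<and> basis U (F \<union> {s1, s3})) +
      of_bool (S - F \<subseteq> A \<and> basis U (F \<union> {s2, s3})) :: bit) = 0" if F: "F \<subseteq> S" for F
  proof -
    have "F \<union> {s, t} = insert s (insert t F)" for s t by auto
    then show ?thesis using basis_pairs_cases[OF W F] by (simp only:) (elim disjE conjE; simp)
  qed
  then show ?thesis unfolding dual_sum_def sum.distrib[symmetric] by (intro sum.neutral) auto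
qed

text \<open>Edges whose variable is 0 must belong to the forest, so the edges outside
  \<open>A\<close> are contracted. What remains are sums over all subsets of \<open>A\<close> on the
  contracted space, to which \<open>sums_basis2_all_0_iff\<close> applies.\<close>

lemma dual_sums_0_iff:
  assumes W: "s1 \<in> W" "s2 \<in> W" "s3 \<in> W" "s1 \<noteq> s2" "s1 \<noteq> s3" "s2 \<noteq> s3" and A: "A \<subseteq> S"
    and 0: "dual_sum U S {s1} A = 0"
  shows "dual_sum U S {s1, s2} A = 0 \<and> dual_sum U S {s1, s3} A = 0 \<and> dual_sum U S {s2, s3} A = 0 \<longleftrightarrow>
    (\<Sum>F\<in>Pow S. of_bool (S - F \<subseteq> A \<and> separating U s1 s2 s3 F) :: bit) = 0"
proof -
  let ?U = "{z \<in> U. \<forall>e\<in>S - A. b e z = 0}"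
  have fW: "finite {s1, s2, s3}" "{s1, s2, s3} \<inter> S = {}" using W SW by auto
  have "finite (S - A)" using S by simp
  from basis_contract[OF this U] obtain c where c0: "\<And>T. finite T \<Longrightarrow> T \<inter> (S - A) = {} \<Longrightarrow>
      (basis U (S - A \<union> T) \<longleftrightarrow> c \<and> basis ?U T)" by blast
  have c: "basis U (S - A \<union> F \<union> J) \<longleftrightarrow> c \<and> basis ?U (F \<union> J)"
    if "F \<subseteq> A" "J \<subseteq> {s1, s2, s3}" for F J
  proof -
    have "finite F" "finite J"
      using finite_subset[OF subset_trans[OF that(1) A] S] finite_subset[OF that(2) fW(1)] .
    moreover have "(F \<union> J) \<inter> (S - A) = {}" using that fW(2) by blast
    ultimately show ?thesis using c0[of "F \<union> J"] by (simp add: Un_assoc)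
  qed
  have ds: "dual_sum U S J A = (\<Sum>F\<in>Pow A. of_bool (c \<and> basis ?U (F \<union> J)))" if "J \<subseteq> {s1, s2, s3}" for J
    unfolding dual_sum_def sum_Pow_supersets[OF S A] using c that by (intro sum.cong refl) auto
  have sep: "separating U s1 s2 s3 (S - A \<union> F) \<longleftrightarrow> c \<and> separating ?U s1 s2 s3 F" if "F \<subseteq> A" for F
    using c[OF that, of "{s1, s2}"] c[OF that, of "{s1, s3}"] c[OF that, of "{s2, s3}"]
    unfolding separating_def by auto
  have t: "(\<Sum>F\<in>Pow S. of_bool (S - F \<subseteq> A \<and> separating U s1 s2 s3 F) :: bit) =
      (\<Sum>F\<in>Pow A. of_bool (c \<and> separating ?U s1 s2 s3 F))"
    unfolding sum_Pow_supersets[OF S A] using sep by (intro sum.cong refl) auto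
  show ?thesis
  proof (cases c)
    case False
    then show ?thesis unfolding t using ds by simp
  next
    case True
    interpret Z: pointed_forms b ?U A W one
    proof
      show "subspace2 ?U" by (rule subspace2_kers[OF U])
      show "finite A" using A S finite_subset by blast
    qed (use one A SW in auto)
    have ds': "dual_sum U S {s} A = (\<Sum>F\<in>Pow A. of_bool (basis ?U (insert s F)))" if "s \<in> {s1, s2, s3}" for s
      using ds[of "{s}"] that True by simp
    have ds2: "dual_sum U S {s, s'} A = (\<Sum>F\<in>Pow A. of_bool (basis ?U (insert s (insert s' F))))"
      if "s \<in> {s1, s2, s3}" "s' \<in> {s1, s2, s3}" for s s'
      using ds[of "{s, s'}"] that True by simp
    show ?thesis
      unfolding t using Z.sums_basis2_all_0_iff[OF W] 0 True by (simp add: ds' ds2)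
  qed
qed

text \<open>The condition is put into product form because \<open>sum_Pow_dual_eq_prim\<close>
  trades omitted for contained edges in such products.\<close>

lemma sum_not_bad:
  assumes W: "s1 \<in> W" "s2 \<in> W" "s3 \<in> W" "s1 \<noteq> s2" "s1 \<noteq> s3" "s2 \<noteq> s3" and A: "A \<subseteq> S"
  shows "(of_bool (dual_sum U S {s1} A = 0 \<and> dual_sum U S {s1, s2} A = 0 \<and>
      dual_sum U S {s1, s3} A = 0 \<and> dual_sum U S {s2, s3} A = 0) :: bit) =
    (1 + (\<Sum>F\<in>Pow S. of_bool (S - F \<subseteq> A \<and> basis U (insert s1 F)))) *
    (1 + (\<Sum>F\<in>Pow S. of_bool (S - F \<subseteq> A \<and> separating U s1 s2 s3 F)))"
proof -
  let ?t = "(\<Sum>F\<in>Pow S. of_bool (S - F \<subseteq> A \<and> separating U s1 s2 s3 F)) :: bit"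
  have f: "(\<Sum>F\<in>Pow S. of_bool (S - F \<subseteq> A \<and> basis U (insert s1 F))) = dual_sum U S {s1} A"
    by (simp add: dual_sum_def)
  show ?thesis
    unfolding f using dual_sums_0_iff[OF W A]
    by (cases "dual_sum U S {s1} A"; cases ?t) auto
qed

lemma card_tree_edges:
  assumes "F \<subseteq> S" "s \<in> W" "basis U (insert s F)" "card U = 2 ^ m"
  shows "card F + 1 = m"
proof -
  have F: "finite F" "s \<notin> F" using assms S SW finite_subset by auto
  then have "(2::nat) ^ m = 2 ^ card (insert s F)" using card_basis[OF _ U assms(3)] assms(4) by simp
  then have "m = card (insert s F)" by (metis one_less_numeral_iff power_inject_exp semiring_norm(76))
  then show ?thesis using F by simp
qed

lemma card_forest_edges:
  assumes "F \<subseteq> S" "s \<in> W" "s' \<in> W" "s \<noteq> s'" "basis U (insert s (insert s' F))" "card U = 2 ^ m"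
  shows "card F + 2 = m"
proof -
  have F: "finite F" "s \<notin> F" "s' \<notin> F" using assms S SW finite_subset by auto
  then have "(2::nat) ^ m = 2 ^ card (insert s (insert s' F))"
    using card_basis[OF _ U assms(5)] assms(6) by simp
  then have "m = card (insert s (insert s' F))" by (metis one_less_numeral_iff power_inject_exp semiring_norm(76))
  then show ?thesis using F assms by simp
qed

end

context edge_space
begin

lemma cob_one:
  assumes "e \<in> E"
  shows "cob nd e (\<lambda>x. of_bool (x \<in> V)) = 0"
  using nd(1)[OF assms] by (cases rule: nd_cases[OF assms]) (auto simp: cob_def)

text \<open>The Laplacian of \<open>S\<close> applied to \<open>z\<close> depends linearly on
  \<open>S\<close> and has coordinate sum 0. Since \<open>card V - 1 < card E\<close>, some nonempty
  edge set is mapped to 0 and can be toggled.\<close>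

lemma sum_radical_eq_0:
  assumes m: "card V \<le> card E" "V \<noteq> {}" and z: "z \<in> vecs V"
  shows "(\<Sum>S\<in>Pow E. of_bool (z \<in> cob.radical nd (vecs V) S) :: bit) = 0"
proof -
  let ?u = "\<lambda>x y. of_bool (y = x) :: bit"
  define g where "g S x = (if x \<in> V then \<Sum>e\<in>S. cob nd e z * cob nd e (?u x) else 0)" for S x
  let ?W = "{y \<in> vecs V. (\<Sum>x\<in>V. y x) = 0}"
  obtain x0 where x0: "x0 \<in> V" using m by blast
  have "card (vecs V) = 2 * card ?W"
    by (rule card_ker[OF subspace2_vecs[OF fin(1)], of "\<lambda>y. \<Sum>x\<in>V. y x" "?u x0"])
      (use x0 fin in \<open>auto simp: sum.distrib vecs_def of_bool_def\<close>)
  then have cW: "2 ^ card V = 2 * card ?W" using card_vecs[OF fin(1)] by simp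
  have W: "subspace2 ?W"
    by (rule subspace2_ker[OF subspace2_vecs[OF fin(1)]]) (simp add: sum.distrib)
  have one: "(\<Sum>x\<in>V. cob nd e (?u x)) = 0" if e: "e \<in> E" for e
  proof (cases rule: nd_cases[OF e])
    case (2 a c)
    have "(\<Sum>x\<in>V. cob nd e (?u x)) = (\<Sum>x\<in>{a, c}. 1)"
      using 2 nd(1)[OF e] fin by (intro sum.mono_neutral_cong_right) (auto simp: cob_def)
    then show ?thesis using 2 by simp
  qed (simp add: cob_def)
  have gW: "g S \<in> ?W" if "S \<subseteq> E" for S
  proof -
    have "(\<Sum>x\<in>V. g S x) = (\<Sum>e\<in>S. \<Sum>x\<in>V. cob nd e z * cob nd e (?u x))"
      by (subst sum.swap) (simp add: g_def)
    also have "\<dots> = 0" using one that by (intro sum.neutral) (auto simp flip: sum_distrib_left)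
    finally show ?thesis by (auto simp: vecs_def g_def)
  qed
  have iff: "z \<in> cob.radical nd (vecs V) S \<longleftrightarrow> g S \<in> {0}" if "S \<subseteq> E" for S
    using z by (auto simp: radical_iff_unit[OF that] g_def fun_eq_iff)
  have "(\<Sum>S\<in>Pow E. of_bool (g S \<in> {0}) :: bit) = 0"
  proof (rule sum_Pow_subspace_eq_0[where W = ?W])
    show "g (sym_difference S T) = g S + g T" if "S \<subseteq> E" "T \<subseteq> E" for S T
    proof
      fix x
      have "finite S" "finite T" using that fin(2) finite_subset by auto
      then show "g (sym_difference S T) x = (g S + g T) x"
        by (simp add: g_def sum_sym_difference)
    qed
    have "(2::nat) ^ card V \<le> 2 ^ card E" using m by (intro power_increasing) auto
    moreover have "(0::nat) < 2 ^ card V" by simp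
    ultimately show "card ?W < 2 ^ card E * card {0}" using cW by simp
    show "subspace2 {0}" by (simp add: subspace2_def)
    show "{0} \<subseteq> ?W" using subspace2D(2)[OF W] by blast
    show "x + y \<in> ?W" if "x \<in> ?W" "y \<in> ?W" for x y using subspace2D(3)[OF W that] .
    show "finite ?W" using subspace2D(1)[OF W] .
  qed (use fin gW in auto)
  then show ?thesis using iff by simp
qed

text \<open>A loop has coboundary 0, so toggling it does not change the Laplacian.\<close>

lemma sum_radical_loop_eq_0:
  assumes l: "l \<in> E" "card (nd l) = 1"
  shows "(\<Sum>S\<in>Pow E. of_bool (Q (cob.radical nd (vecs V) S)) :: bit) = 0"
proof (rule sum_Pow_toggle_eq_0[OF fin(2), of "{l}"])
  fix S assume S: "S \<subseteq> E"
  have "finite S" using S fin(2) by (rule finite_subset)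
  then have "cob.pairing nd (sym_difference S {l}) y y' = cob.pairing nd S y y'" for y y'
    unfolding cob.pairing_def using l by (subst sum_sym_difference) (auto simp: cob_def)
  then have "cob.radical nd (vecs V) (sym_difference S {l}) = cob.radical nd (vecs V) S"
    by (simp add: cob.radical_def)
  then show "(of_bool (Q (cob.radical nd (vecs V) (sym_difference S {l}))) :: bit) =
      of_bool (Q (cob.radical nd (vecs V) S))" by simp
qed (use l in auto)

end

section \<open>The star of edges at an additional vertex\<close>

locale star_space = edge_space nd V E for nd :: "'e \<Rightarrow> 'v set" and V and E +
  fixes W :: "'e set" and hub :: 'v and p :: "'e \<Rightarrow> 'v"
  assumes W: "finite W" "E \<inter> W = {}" "hub \<notin> V"
    and star: "s \<in> W \<Longrightarrow> nd s = {hub, p s}" "s \<in> W \<Longrightarrow> p s \<in> V"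
begin

abbreviation "U \<equiv> vecs V"
abbreviation "one \<equiv> (\<lambda>x. of_bool (x \<in> V)) :: 'v \<Rightarrow> bit"
abbreviation "ds \<equiv> cob.dual_sum nd U E"

lemma cob_star: "s \<in> W \<Longrightarrow> z \<in> U \<Longrightarrow> cob nd s z = z (p s)"
  using star[of s] W(3) by (subst cob_pair[of nd s hub "p s"]) (auto simp: vecs_def)

lemma pointed: "S \<subseteq> E \<Longrightarrow> pointed_forms (cob nd) U S W one"
proof
  assume S: "S \<subseteq> E"
  show "subspace2 U" by (rule subspace2_vecs[OF fin(1)])
  show "finite S" using S fin(2) by (rule finite_subset)
  show "S \<inter> W = {}" using S W by blast
  show one: "one \<in> U" by (simp add: vecs_def)
  show "cob nd e one = 0" if "e \<in> S" for e using cob_one that S by blast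
  show "cob nd s one = 1" if "s \<in> W" for s using cob_star[OF that one] star[OF that] by simp
qed

sublocale P: pointed_forms "cob nd" U E W one
  by (rule pointed) simp

lemma basis_same_end:
  assumes "s \<in> W" "s' \<in> W" "s \<noteq> s'" "p s = p s'"
  shows "\<not> cob.basis nd U (insert s (insert s' F))"
proof
  assume "cob.basis nd U (insert s (insert s' F))"
  then obtain z where z: "z \<in> U" "cob nd s z = 1"
      "\<And>e'. e' \<in> insert s (insert s' F) \<Longrightarrow> e' \<noteq> s \<Longrightarrow> cob nd e' z = 0"
    by (rule cob.basis_dual[of nd U _ s]) auto
  then have "cob nd s' z = 0" using assms by auto
  then show False using z(2) cob_star[OF assms(1) z(1)] cob_star[OF assms(2) z(1)] assms(4) by simp
qed

lemma dual_sum_same_end: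
  assumes "s \<in> W" "s' \<in> W" "s \<noteq> s'" "p s = p s'"
  shows "ds {s, s'} A = 0"
  unfolding cob.dual_sum_def using basis_same_end[OF assms] by (intro sum.neutral) auto

text \<open>The sizes \<open>card V - 1\<close> of a tree and \<open>card V - 2\<close> of a forest
  add up to \<open>card E\<close>, so omitted edges can be traded for contained ones. The correction
  term of \<open>separating_parity\<close> disappears after exchanging the sums, by
  \<open>sum_radical_eq_0\<close>.\<close>

lemma sum_bad3:
  assumes s: "s1 \<in> W" "s2 \<in> W" "s3 \<in> W" "s1 \<noteq> s2" "s1 \<noteq> s3" "s2 \<noteq> s3"
    and m: "card V \<ge> 3" "card E + 3 = 2 * card V"
  shows "(\<Sum>A\<in>Pow E. of_bool (ds {s1} A = 0 \<and> ds {s1, s2} A = 0 \<and>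
      ds {s1, s3} A = 0 \<and> ds {s2, s3} A = 0) :: bit) =
    (\<Sum>S\<in>Pow E. of_bool (full_on {p s1, p s2, p s3} (cob.radical nd U S)))"
proof -
  note cU = card_vecs[OF fin(1)]
  let ?B = "\<lambda>F. cob.basis nd U (insert s1 F)" and ?T = "cob.separating nd U s1 s2 s3"
  let ?Z = "{z \<in> U. z \<noteq> 0 \<and> cob nd s1 z = 0 \<and> cob nd s2 z = 0 \<and> cob nd s3 z = 0}"
  have "(\<Sum>A\<in>Pow E. of_bool (ds {s1} A = 0 \<and> ds {s1, s2} A = 0 \<and>
      ds {s1, s3} A = 0 \<and> ds {s2, s3} A = 0) :: bit) =
    (\<Sum>A\<in>Pow E. (1 + (\<Sum>F\<in>Pow E. of_bool (E - F \<subseteq> A \<and> ?B F))) * (1 + (\<Sum>F\<in>Pow E. of_bool (E - F \<subseteq> A \<and> ?T F))))"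
    using P.sum_not_bad[OF s] by (intro sum.cong refl) auto
  also have "\<dots> = (\<Sum>S\<in>Pow E. (1 + (\<Sum>F\<in>Pow S. of_bool (?B F))) * (1 + (\<Sum>F\<in>Pow S. of_bool (?T F))))"
  proof (rule sum_Pow_dual_eq_prim[where p = "card V - 1" and q = "card V - 2"])
    show "card F = card V - 1" if "F \<subseteq> E" "?B F" for F
      using P.card_tree_edges[OF that(1) s(1) that(2) cU] by simp
    show "card F = card V - 2" if "F \<subseteq> E" "?T F" for F
      using P.card_forest_edges[OF that(1) _ _ _ _ cU] that s unfolding cob.separating_def
      by fastforce
  qed (use fin m in auto)
  also have "\<dots> = (\<Sum>S\<in>Pow E. of_bool (cob.full_on3 nd s1 s2 s3 (cob.radical nd U S)) +
      (\<Sum>z\<in>?Z. of_bool (z \<in> cob.radical nd U S)))"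
  proof (rule sum.cong[OF refl])
    fix S assume "S \<in> Pow E"
    then interpret Q: pointed_forms "cob nd" U S W one by (intro pointed) simp
    show "(1 + (\<Sum>F\<in>Pow S. of_bool (?B F))) * (1 + (\<Sum>F\<in>Pow S. of_bool (?T F))) =
      of_bool (cob.full_on3 nd s1 s2 s3 (cob.radical nd U S)) +
      (\<Sum>z\<in>?Z. of_bool (z \<in> cob.radical nd U S) :: bit)"
      using Q.separating_parity[OF s] by (rule bit_add_eq_imp)
  qed
  also have "\<dots> = (\<Sum>S\<in>Pow E. of_bool (cob.full_on3 nd s1 s2 s3 (cob.radical nd U S))) +
      (\<Sum>z\<in>?Z.
        \<Sum>S\<in>Pow E. of_bool (z \<in> cob.radical nd U S))"
    unfolding sum.distrib by (subst sum.swap) (rule refl)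
  also have "(\<Sum>z\<in>?Z.
        \<Sum>S\<in>Pow E. of_bool (z \<in> cob.radical nd U S)) = (0::bit)"
    using m by (intro sum.neutral ballI sum_radical_eq_0) auto
  also have "(\<Sum>S\<in>Pow E. of_bool (cob.full_on3 nd s1 s2 s3 (cob.radical nd U S)) :: bit) =
      (\<Sum>S\<in>Pow E. of_bool (full_on {p s1, p s2, p s3} (cob.radical nd U S)))"
  proof (intro sum.cong refl arg_cong[where f = of_bool])
    fix S
    have "cob nd s z = z (p s)" if "s \<in> W" "z \<in> cob.radical nd U S" for s z
      using that by (intro cob_star) (auto simp: cob.radical_def)
    then show "cob.full_on3 nd s1 s2 s3 (cob.radical nd U S) = full_on {p s1, p s2, p s3} (cob.radical nd U S)"
      using s by (auto simp: cob.full_on3_def full_on_def)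
  qed
  finally show ?thesis by simp
qed

text \<open>With \<open>f\<close> and \<open>g\<close> for the two coefficients, the indicator of
  \<open>f = 0 \<and> g = 0\<close> is that of \<open>f = 0\<close> plus \<open>g + f * g\<close>.
  So it suffices that \<open>g\<close> and \<open>f * g\<close> sum to 0.\<close>

lemma sum_bad2:
  assumes s: "s1 \<in> W" "s2 \<in> W" "s1 \<noteq> s2"
    and m: "card V \<ge> 3" "card E + 2 = 2 * card V"
  shows "(\<Sum>A\<in>Pow E. of_bool (ds {s1} A = 0 \<and> ds {s1, s2} A = 0) :: bit) =
    (\<Sum>A\<in>Pow E. of_bool (ds {s1} A = 0))"
proof -
  note cU = card_vecs[OF fin(1)]
  let ?P = "\<lambda>F. cob.basis nd U (insert s1 F)" and ?Q = "\<lambda>F. cob.basis nd U (insert s1 (insert s2 F))"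
  let ?Z = "{z \<in> U. cob nd s1 z = 0 \<and> cob nd s2 z = 1}"
  let ?c = "\<lambda>e F F'. F \<subseteq> E - {e} \<and> F' \<subseteq> E - {e} \<and> ?P F \<and> ?Q F' \<and> F \<union> F' = E - {e}"
  have cP: "card F + 1 = card V" if "F \<subseteq> E" "?P F" for F
    using P.card_tree_edges[OF that(1) s(1) that(2) cU] .
  have cQ: "card F + 2 = card V" if "F \<subseteq> E" "?Q F" for F
    using P.card_forest_edges[OF that(1) s that(2) cU] .
  let ?f = "\<lambda>A. ds {s1} A" and ?g = "\<lambda>A. ds {s1, s2} A"
  have f: "?f A = (\<Sum>F\<in>Pow E. of_bool (E - F \<subseteq> A \<and> ?P F))" for A
    by (simp add: cob.dual_sum_def)
  have g: "?g A = (\<Sum>F\<in>Pow E. of_bool (E - F \<subseteq> A \<and> ?Q F))" for A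
    by (simp add: cob.dual_sum_def)
  have "(\<Sum>A\<in>Pow E. ?g A) = 0"
    unfolding g by (rule sum_Pow_dual_single[OF fin(2)]) (use cQ m in fastforce)
  moreover have "(\<Sum>A\<in>Pow E. ?f A * ?g A) = 0"
  proof -
    have "(\<Sum>A\<in>Pow E. ?f A * ?g A) = (\<Sum>F\<in>Pow E. \<Sum>F'\<in>Pow E. of_bool (?P F \<and> ?Q F' \<and> F \<inter> F' = {}))"
      unfolding f g by (rule sum_Pow_dual[OF fin(2)])
    \<comment> \<open>A tree and a forest have \<open>card E - 1\<close> edges together. So a
      disjoint pair misses exactly one edge \<open>e\<close>, while an overlapping pair covers
      \<open>E - {e}\<close> for no \<open>e\<close>.\<close>
    also have "\<dots> = (\<Sum>F\<in>Pow E. \<Sum>F'\<in>Pow E. \<Sum>e\<in>E.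
        of_bool (?c e F F'))"
    proof (intro sum.cong refl)
      fix F F' assume FF: "F \<in> Pow E" "F' \<in> Pow E"
      let ?X = "{e \<in> E. ?c e F F'}"
      have "card ?X = of_bool (?P F \<and> ?Q F' \<and> F \<inter> F' = {})"
      proof (cases "?P F \<and> ?Q F'")
        case True
        have finF: "finite F" "finite F'" using FF fin(2) finite_subset by auto
        have un: "card (F \<union> F') + card (F \<inter> F') + 1 = card E"
          using card_Un_Int[OF finF] cP[of F] cQ[of F'] FF True m by auto
        show ?thesis
        proof (cases "F \<inter> F' = {}")
          case disj: True
          have "card (E - (F \<union> F')) = 1"
            using un disj FF finF by (subst card_Diff_subset) auto
          then obtain e where e: "E - (F \<union> F') = {e}" by (auto simp: card_1_singleton_iff)
          then have E: "E = insert e (F \<union> F')" "e \<notin> F \<union> F'" using FF by auto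
          have "x = e" if "x \<in> ?X" for x
          proof -
            have "F \<union> F' = E - {x}" "x \<in> E" using that by auto
            then show ?thesis using E by auto
          qed
          moreover have "e \<in> ?X" using E True by auto
          ultimately have "?X = {e}" by blast
          then have "card ?X = 1" by simp
          then show ?thesis using True disj by simp
        next
          case False
          have "?X = {}"
          proof (rule ccontr)
            assume "?X \<noteq> {}"
            then obtain e where "e \<in> E" "F \<union> F' = E - {e}" by blast
            then have "card (F \<union> F') + 1 = card E" using card_Suc_Diff1[OF fin(2)] by simp
            moreover have "card (F \<inter> F') > 0" using False finF by (simp add: card_gt_0_iff)
            ultimately show False using un by simp
          qed
          then have "card ?X = 0" by (simp only: card.empty)
          then show ?thesis using False by simp
        qed
      next
        case False
        then have "?X = {}" by blast
        then have "card ?X = 0" by (simp only: card.empty)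
        moreover have "\<not> (?P F \<and> ?Q F' \<and> F \<inter> F' = {})" using False by blast
        ultimately show ?thesis by (simp only: of_bool_eq)
      qed
      then show "(of_bool (?P F \<and> ?Q F' \<and> F \<inter> F' = {}) :: bit) = (\<Sum>e\<in>E.
          of_bool (?c e F F'))"
        by (simp only: sum_of_bool_bit[OF fin(2)]) simp
    qed
    also have "\<dots> = (\<Sum>F\<in>Pow E. \<Sum>e\<in>E. \<Sum>F'\<in>Pow E.
        of_bool (?c e F F'))"
      by (rule sum.cong[OF refl], rule sum.swap)
    also have "\<dots> = (\<Sum>e\<in>E. \<Sum>F\<in>Pow E. \<Sum>F'\<in>Pow E.
        of_bool (?c e F F'))"
      by (rule sum.swap)
    also have "\<dots> = 0"
    proof (rule sum.neutral, rule ballI)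
      fix e assume e: "e \<in> E"
      let ?E = "E - {e}"
      interpret K: edge_space nd V ?E
        by standard (use fin nd in auto)
      have cE: "card ?E + 3 = 2 * card V" using m e fin(2) by auto
      have fE: "finite ?E" using fin by simp
      have "(\<Sum>F\<in>Pow E. \<Sum>F'\<in>Pow E.
          of_bool (?c e F F') :: bit) =
        (\<Sum>F\<in>Pow E. \<Sum>F'\<in>Pow ?E. of_bool (F \<subseteq> ?E \<and> ?P F \<and> ?Q F' \<and> F \<union> F' = ?E))"
        using fin by (intro sum.cong refl sum.mono_neutral_cong_right) auto
      also have "\<dots> = (\<Sum>F\<in>Pow ?E. \<Sum>F'\<in>Pow ?E. of_bool (?P F \<and> ?Q F' \<and> F \<union> F' = ?E))"
        using fin by (intro sum.mono_neutral_cong_right) auto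
      also have "\<dots> = (\<Sum>S\<in>Pow ?E. (\<Sum>F\<in>Pow S. of_bool (?P F)) * (\<Sum>F\<in>Pow S. of_bool (?Q F)))"
        by (rule sum_Pow_prim[OF fE, symmetric])
      \<comment> \<open>The summand 1 makes \<open>sum_basis2_parity\<close> applicable; the sum it
        adds is 0 because \<open>?E\<close> itself is too large to be a forest.\<close>
      also have "\<dots> = (\<Sum>S\<in>Pow ?E. (1 + (\<Sum>F\<in>Pow S. of_bool (?P F))) * (\<Sum>F\<in>Pow S. of_bool (?Q F))) +
          (\<Sum>S\<in>Pow ?E. \<Sum>F\<in>Pow S. of_bool (?Q F))"
        unfolding sum.distrib[symmetric] by (intro sum.cong refl) (simp add: algebra_simps)
      also have "(\<Sum>S\<in>Pow ?E. \<Sum>F\<in>Pow S. of_bool (?Q F) :: bit) = 0"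
        by (rule sum_Pow_prim_single[OF fE]) (use cQ[of ?E] cE m in auto)
      also have "(\<Sum>S\<in>Pow ?E. (1 + (\<Sum>F\<in>Pow S. of_bool (?P F))) * (\<Sum>F\<in>Pow S. of_bool (?Q F))) =
          (\<Sum>S\<in>Pow ?E. \<Sum>z\<in>?Z. of_bool (z \<in> cob.radical nd U S) :: bit)"
      proof (rule sum.cong[OF refl])
        fix S assume "S \<in> Pow ?E"
        then interpret Q: pointed_forms "cob nd" U S W one by (intro pointed) auto
        show "(1 + (\<Sum>F\<in>Pow S. of_bool (?P F))) * (\<Sum>F\<in>Pow S. of_bool (?Q F)) =
          (\<Sum>z\<in>?Z. of_bool (z \<in> cob.radical nd U S) :: bit)"
          by (rule Q.sum_basis2_parity[OF s])
      qed
      also have "\<dots> = (\<Sum>z\<in>?Z. \<Sum>S\<in>Pow ?E. of_bool (z \<in> cob.radical nd U S))"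
        by (rule sum.swap)
      also have "\<dots> = 0"
        using cE m by (intro sum.neutral ballI K.sum_radical_eq_0) auto
      finally show "(\<Sum>F\<in>Pow E. \<Sum>F'\<in>Pow E.
          of_bool (?c e F F') :: bit) = 0" by simp
    qed
    finally show ?thesis .
  qed
  moreover have "(of_bool (x = 0 \<and> y = 0) :: bit) = of_bool (x = 0) + y + x * y" for x y :: bit
    by (cases x; cases y) auto
  ultimately show ?thesis by (simp add: sum.distrib)
qed

end

section \<open>Counting zeros\<close>

lemma sum_Pow1: "(\<Sum>J\<in>Pow {a}. g J) = g {} + (g {a} :: 'b::comm_monoid_add)"
  by (simp add: sum_Pow_insert)

lemma sum_Pow2:
  assumes "a \<noteq> c"
  shows "(\<Sum>J\<in>Pow {a, c}. g J) = g {} + g {c} + (g {a} + (g {a, c} :: 'b::comm_monoid_add))"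
proof -
  have "(\<Sum>J\<in>Pow {a, c}. g J) = (\<Sum>J\<in>Pow {c}. g J) + (\<Sum>J\<in>Pow {c}. g (insert a J))"
    using assms by (intro sum_Pow_insert) auto
  then show ?thesis by (simp only: sum_Pow1)
qed

lemma sum_Pow3:
  assumes "a \<noteq> c" "a \<noteq> d" "c \<noteq> d"
  shows "(\<Sum>J\<in>Pow {a, c, d}. g J) = g {} + g {d} + (g {c} + g {c, d}) +
    (g {a} + g {a, d} + (g {a, c} + (g {a, c, d} :: 'b::comm_monoid_add)))"
proof -
  have "(\<Sum>J\<in>Pow {a, c, d}. g J) = (\<Sum>J\<in>Pow {c, d}. g J) + (\<Sum>J\<in>Pow {c, d}. g (insert a J))"
    using assms by (intro sum_Pow_insert) auto
  then show ?thesis using assms by (simp only: sum_Pow2 not_False_eq_True)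
qed

text \<open>For one, two and three edges at the additional vertex the polynomial is respectively \<open>f\<close>,
  \<open>f (x + y) + g\<close> and a quadratic polynomial with leading part \<open>f (x y + x z + y z)\<close>.\<close>

lemma count_zeros1:
  fixes h :: "'e set \<Rightarrow> bit"
  assumes "h {} = 0"
  shows "(\<Sum>X\<in>Pow {a}. of_bool ((\<Sum>J\<in>Pow {a}. of_bool ({a} - J \<subseteq> X) * h J) = 0)) =
    (if h {a} = 0 then 2 else 0 :: nat)"
  unfolding sum_Pow1 using assms by simp

lemma count_zeros2:
  fixes h :: "'e set \<Rightarrow> bit"
  assumes "a \<noteq> c" "h {} = 0" "h {c} = h {a}"
  shows "(\<Sum>X\<in>Pow {a, c}. of_bool ((\<Sum>J\<in>Pow {a, c}. of_bool ({a, c} - J \<subseteq> X) * h J) = 0)) =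
    (if h {a} = 0 then if h {a, c} = 0 then 4 else 0 else 2 :: nat)"
  unfolding sum_Pow2[OF assms(1)] using assms
  by (cases "h {a}"; cases "h {a, c}") (simp_all add: insert_Diff_if)

lemma count_zeros3:
  fixes h :: "'e set \<Rightarrow> bit"
  assumes d: "a \<noteq> c" "a \<noteq> d" "c \<noteq> d"
    and h: "h {} = 0" "h {c} = h {a}" "h {d} = h {a}" "h {a, c} + h {a, d} + h {c, d} = 0"
  shows "(\<Sum>X\<in>Pow {a, c, d}. of_bool ((\<Sum>J\<in>Pow {a, c, d}. of_bool ({a, c, d} - J \<subseteq> X) * h J) = 0)) =
    (if h {a} = 0 \<and> h {a, c} = 0 \<and> h {a, d} = 0 \<and> h {c, d} = 0
     then if h {a, c, d} = 0 then 8 else 0 else 4 :: nat)"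
proof -
  have e: "h {c, d} = h {a, c} + h {a, d}" using h(4) by (simp add: bit_add_eq_0_iff)
  show ?thesis
    unfolding sum_Pow3[OF d] using d d[symmetric] h(1-3) e
    by (cases "h {a}"; cases "h {a, c}"; cases "h {a, d}"; cases "h {a, c, d}")
      (simp_all add: insert_Diff_if)
qed

lemma of_nat_bit_mod_2: "of_nat m = (of_nat n :: bit) \<Longrightarrow> m mod 2 = n mod 2"
  by (metis bit_add_eq_0_iff even_add mod2_eq_if of_nat_add of_nat_bit_eq_0_iff)

context star_space
begin

definition zeros :: nat where
  "zeros = (\<Sum>A\<in>Pow E. \<Sum>X\<in>Pow W. of_bool ((\<Sum>J\<in>Pow W. of_bool (W - J \<subseteq> X) * ds J A) = 0))"

lemma zeros1:
  assumes "W = {s}"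
  shows "zeros = (\<Sum>A\<in>Pow E. if ds {s} A = 0 then 2 else 0)"
  unfolding zeros_def unfolding assms
  by (intro sum.cong refl count_zeros1 P.dual_sum_empty) (simp add: assms)

lemma zeros2:
  assumes W2: "W = {s1, s2}" "s1 \<noteq> s2"
  shows "zeros = 2 * card {A \<in> Pow E. ds {s1} A = 1} + 4 * card {A \<in> Pow E. ds {s1} A = 0 \<and> ds {s1, s2} A = 0}"
proof -
  have "zeros = (\<Sum>A\<in>Pow E. if ds {s1} A = 0 then if ds {s1, s2} A = 0 then 4 else 0 else 2)"
    unfolding zeros_def unfolding W2(1)
    by (intro sum.cong refl count_zeros2 P.dual_sum_empty[of s1] P.dual_sum_root W2(2)) (simp_all add: W2)
  also have "\<dots> = (\<Sum>A\<in>Pow E. 2 * of_bool (ds {s1} A = 1) + 4 * of_bool (ds {s1} A = 0 \<and> ds {s1, s2} A = 0))"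
    by (intro sum.cong refl) auto
  also have "\<dots> = 2 * (\<Sum>A\<in>Pow E. of_bool (ds {s1} A = 1)) + 4 * (\<Sum>A\<in>Pow E. of_bool (ds {s1} A = 0 \<and> ds {s1, s2} A = 0))"
    by (simp add: sum.distrib sum_distrib_left)
  also have "\<dots> = 2 * card {A \<in> Pow E. ds {s1} A = 1} + 4 * card {A \<in> Pow E. ds {s1} A = 0 \<and> ds {s1, s2} A = 0}"
    using fin(2) by (simp add: sum_of_bool_eq Int_def)
  finally show ?thesis .
qed

text \<open>The right-hand side involves only trees completed by one star edge, which makes it
  independent of the star. Two star edges with the same end have pair coefficient 0.\<close>

lemma zeros2_parity:
  assumes W2: "W = {s1, s2}" "s1 \<noteq> s2" and m: "card V \<ge> 3 \<or> p s1 = p s2" "card E + 2 = 2 * card V"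
  shows "(of_nat (card {A \<in> Pow E. ds {s1} A = 0 \<and> ds {s1, s2} A = 0}) :: bit) =
    (\<Sum>A\<in>Pow E. of_bool (ds {s1} A = 0))"
proof -
  have "(of_nat (card {A \<in> Pow E. ds {s1} A = 0 \<and> ds {s1, s2} A = 0}) :: bit) =
      (\<Sum>A\<in>Pow E. of_bool (ds {s1} A = 0 \<and> ds {s1, s2} A = 0))"
    using fin(2) by (simp add: sum_of_bool_bit)
  also have "\<dots> = (\<Sum>A\<in>Pow E. of_bool (ds {s1} A = 0))"
  proof (cases "p s1 = p s2")
    case True
    then show ?thesis using dual_sum_same_end[of s1 s2] W2 by simp
  next
    case False
    then show ?thesis using sum_bad2[of s1 s2] W2 m by simp
  qed
  finally show ?thesis .
qed

text \<open>If the leading coefficient is 1, put a = x + z and b = y + z. As the linear coefficients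
  sum to 0, the polynomial is a b + z plus a combination of a, b and 1, and z balances it: 4 of 8
  points are zeros. A nonconstant linear polynomial has 4 zeros too. Otherwise there are 8 or 0, and
  a quarter of that is even.\<close>

lemma zeros3_parity:
  assumes W3: "W = {s1, s2, s3}" "s1 \<noteq> s2" "s1 \<noteq> s3" "s2 \<noteq> s3"
  shows "(of_nat (zeros div 4) :: bit) = (\<Sum>A\<in>Pow E. 1 + of_bool (ds {s1} A = 0 \<and> ds {s1, s2} A = 0 \<and>
    ds {s1, s3} A = 0 \<and> ds {s2, s3} A = 0))"
proof -
  let ?bad = "\<lambda>A. ds {s1} A = 0 \<and> ds {s1, s2} A = 0 \<and> ds {s1, s3} A = 0 \<and> ds {s2, s3} A = 0"
  have sW: "s1 \<in> W" "s2 \<in> W" "s3 \<in> W" using W3 by auto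
  have "zeros = (\<Sum>A\<in>Pow E. if ?bad A then if ds {s1, s2, s3} A = 0 then 8 else 0 else 4)"
    unfolding zeros_def unfolding W3(1)
    by (intro sum.cong refl count_zeros3 P.dual_sum_empty[OF sW(1)] P.dual_sum_root sW W3(2-4)
        P.dual_sum_pairs)
  also have "\<dots> = 4 * (\<Sum>A\<in>Pow E. if ?bad A then if ds {s1, s2, s3} A = 0 then 2 else 0 else 1)"
    unfolding sum_distrib_left by (intro sum.cong refl) simp
  finally have div4: "zeros div 4 = (\<Sum>A\<in>Pow E. if ?bad A then if ds {s1, s2, s3} A = 0 then 2 else 0 else 1)"
    by simp
  show ?thesis unfolding div4
  proof -
    have "(of_nat (if q then if r then 2 else 0 else 1) :: bit) = 1 + of_bool q" for q r
      by (cases q; cases r) simp_all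
    then show "of_nat (\<Sum>A\<in>Pow E. if ?bad A then if ds {s1, s2, s3} A = 0 then 2 else 0 else 1) =
        (\<Sum>A\<in>Pow E. 1 + of_bool (?bad A) :: bit)"
      unfolding of_nat_sum by (intro sum.cong refl)
  qed
qed

end

section \<open>The two vertex-deleted graphs of a 4-regular graph\<close>

lemma sum_degree:
  assumes "wf_graph G"
  shows "(\<Sum>x\<in>verts G. degree G x) = 2 * card (edges G)"
proof -
  have fin: "finite (verts G)" "finite (edges G)" using assms by (auto simp: wf_graph_def)
  have "(\<Sum>x\<in>verts G. degree G x) =
      (\<Sum>x\<in>verts G. \<Sum>e\<in>edges G. of_bool (x \<in> ends G e) + of_bool (ends G e = {x}))"
    using fin by (simp add: degree_def sum.distrib sum_of_bool_eq Int_def)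
  also have "\<dots> = (\<Sum>e\<in>edges G. \<Sum>x\<in>verts G. of_bool (x \<in> ends G e) + of_bool (ends G e = {x}))"
    by (rule sum.swap)
  also have "\<dots> = (\<Sum>e\<in>edges G. 2)"
  proof (rule sum.cong[OF refl])
    fix e assume e: "e \<in> edges G"
    have sub: "ends G e \<subseteq> verts G" "card (ends G e) = 1 \<or> card (ends G e) = 2"
      using assms e by (auto simp: wf_graph_def)
    have "(\<Sum>x\<in>verts G. of_bool (x \<in> ends G e) + of_bool (ends G e = {x})) =
        card {x \<in> verts G. x \<in> ends G e} + card {x \<in> verts G. ends G e = {x}}"
      using fin by (simp add: sum.distrib sum_of_bool_eq Int_def)
    also have "{x \<in> verts G. x \<in> ends G e} = ends G e" using sub by auto
    also have "card (ends G e) + card {x \<in> verts G. ends G e = {x}} = 2"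
      using sub(2)
    proof
      assume "card (ends G e) = 1"
      then obtain x where x: "ends G e = {x}" by (auto simp: card_1_singleton_iff)
      then have "{y \<in> verts G. ends G e = {y}} = {x}" using sub by auto
      then show ?thesis using x by simp
    next
      assume 2: "card (ends G e) = 2"
      then have "{y \<in> verts G. ends G e = {y}} = {}" by auto
      then have "card {y \<in> verts G. ends G e = {y}} = 0" by (simp only: card.empty)
      then show ?thesis using 2 by simp
    qed
    finally show "(\<Sum>x\<in>verts G. of_bool (x \<in> ends G e) + of_bool (ends G e = {x})) = (2::nat)" .
  qed
  also have "\<dots> = 2 * card (edges G)" by simp
  finally show ?thesis .
qed

lemma wf_delete_vertex: "wf_graph G \<Longrightarrow> wf_graph (delete_vertex G v)"
  by (auto simp: wf_graph_def delete_vertex_def)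

theorem theorem5p10:
  fixes G :: "('v, 'e) graph" and v w :: 'v
  assumes "wf_graph G"
    and "connected_graph G"
    and "regular_graph 4 G"
    and "v \<in> verts G" and "w \<in> verts G"
    and "w \<in> neighbours G v"
    and "neighbours G v \<inter> neighbours G w = {}"
  shows "c2 2 (delete_vertex G v) = c2 2 (delete_vertex G w)"
proof -
  note wf = assms(1) and vw = assms(4,5)
  let ?nd = "ends G"
  let ?at = "\<lambda>A x. {e \<in> A. x \<in> ?nd e}"
  define V where "V = verts G - {v, w}"
  define E where "E = {e \<in> edges G. v \<notin> ?nd e \<and> w \<notin> ?nd e}"
  define Ev where "Ev = {e \<in> edges G. v \<in> ?nd e \<and> w \<notin> ?nd e}"
  define Ew where "Ew = {e \<in> edges G. w \<in> ?nd e \<and> v \<notin> ?nd e}"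
  define Evw where "Evw = {e \<in> edges G. v \<in> ?nd e \<and> w \<in> ?nd e}"
  have fin: "finite (verts G)" "finite (edges G)"
    and nd: "\<And>e. e \<in> edges G \<Longrightarrow> ?nd e \<subseteq> verts G \<and> (card (?nd e) = 1 \<or> card (?nd e) = 2)"
    using wf by (auto simp: wf_graph_def)
  have fE: "finite E" "finite Ev" "finite Ew" "finite Evw" "finite V"
    using fin by (auto simp: E_def Ev_def Ew_def Evw_def V_def)
  have pair: "\<exists>y. ?nd e = {x, y}" if e: "e \<in> edges G" and x: "x \<in> ?nd e" for e x
  proof -
    consider a where "?nd e = {a}" | a c where "?nd e = {a, c}"
      using nd[OF e] by (auto simp: card_1_singleton_iff card_2_iff)
    then show ?thesis
    proof cases
      case 1
      then have "?nd e = {x, x}" using x by simp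
      then show ?thesis by blast
    next
      case 2
      then have "?nd e = {x, a} \<or> ?nd e = {x, c}" using x by auto
      then show ?thesis by blast
    qed
  qed
  have deg: "degree G x = 4" if "x \<in> verts G" for x
    using assms(3) that by (simp add: regular_graph_def)
  have v_in: "v \<in> neighbours G w" and w_in: "w \<in> neighbours G v"
    using assms(6) by (auto simp: neighbours_def insert_commute)
  have disj: "x \<notin> neighbours G w" if "x \<in> neighbours G v" for x using assms(7) that by blast
  \<comment> \<open>A loop at one of the two vertices would make that vertex a common
    neighbour.\<close>
  have "v \<notin> neighbours G v" "w \<notin> neighbours G w" using disj v_in w_in by auto
  then have noloop: "?nd e \<noteq> {v}" "?nd e \<noteq> {w}" if "e \<in> edges G" for e
    using that by (auto simp: neighbours_def)
  have "v \<noteq> w" using w_in \<open>v \<notin> neighbours G v\<close> by auto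
  have Evw_ne: "Evw \<noteq> {}" using w_in by (auto simp: neighbours_def Evw_def)
  have "\<exists>y. ?nd e = {w, y} \<and> y \<in> V" if e: "e \<in> Ew" for e
  proof -
    have e': "e \<in> edges G" "w \<in> ?nd e" "v \<notin> ?nd e" using e by (auto simp: Ew_def)
    then obtain y where y: "?nd e = {w, y}" using pair by blast
    then have "y \<noteq> w" using noloop[OF e'(1)] by auto
    then show ?thesis using y e' nd[OF e'(1)] by (auto simp: V_def)
  qed
  then obtain pw where pw: "\<And>e. e \<in> Ew \<Longrightarrow> ?nd e = {w, pw e} \<and> pw e \<in> V" by metis
  have "\<exists>y. ?nd e = {v, y} \<and> y \<in> V" if e: "e \<in> Ev" for e
  proof -
    have e': "e \<in> edges G" "v \<in> ?nd e" "w \<notin> ?nd e" using e by (auto simp: Ev_def)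
    then obtain y where y: "?nd e = {v, y}" using pair by blast
    then have "y \<noteq> v" using noloop[OF e'(1)] by auto
    then show ?thesis using y e' nd[OF e'(1)] by (auto simp: V_def)
  qed
  then obtain pv where pv: "\<And>e. e \<in> Ev \<Longrightarrow> ?nd e = {v, pv e} \<and> pv e \<in> V" by metis
  interpret Sw: star_space ?nd V E Ew w pw
  proof
    show "?nd e \<subseteq> V" "card (?nd e) = 1 \<or> card (?nd e) = 2" if "e \<in> E" for e
      using that nd[of e] by (auto simp: E_def V_def)
    show "E \<inter> Ew = {}" "w \<notin> V" by (auto simp: E_def Ew_def V_def)
  qed (use fE pw in blast)+
  interpret Sv: star_space ?nd V E Ev v pv
  proof
    show "E \<inter> Ev = {}" "v \<notin> V" by (auto simp: E_def Ev_def V_def)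
  qed (use fE pv in blast)+

  have deg_eq: "card (?at (edges G) v) = 4" "card (?at (edges G) w) = 4"
  proof -
    have l: "{e \<in> edges G. ?nd e = {v}} = {}" "{e \<in> edges G. ?nd e = {w}} = {}" using noloop by auto
    show "card (?at (edges G) v) = 4" "card (?at (edges G) w) = 4"
      using deg[OF vw(1)] deg[OF vw(2)] unfolding degree_def l by simp_all
  qed
  have "?at (edges G) v = Ev \<union> Evw" "?at (edges G) w = Ew \<union> Evw"
    by (auto simp: Ev_def Ew_def Evw_def)
  moreover have "Ev \<inter> Evw = {}" "Ew \<inter> Evw = {}" by (auto simp: Ev_def Ew_def Evw_def)
  ultimately have cv: "card Ev + card Evw = 4" and cw: "card Ew + card Evw = 4"
    using deg_eq fE by (simp_all add: card_Un_disjoint)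
  have "edges G = E \<union> (Ev \<union> (Ew \<union> Evw))" by (auto simp: E_def Ev_def Ew_def Evw_def)
  moreover have "card (E \<union> (Ev \<union> (Ew \<union> Evw))) = card E + (card Ev + (card Ew + card Evw))"
    using fE by (subst card_Un_disjoint; (auto simp: E_def Ev_def Ew_def Evw_def)?)+
  ultimately have "card (edges G) = card E + (card Ev + (card Ew + card Evw))" by simp
  moreover have "4 * card (verts G) = 2 * card (edges G)"
    using sum_degree[OF wf] deg by simp
  moreover have "card (verts G) = card V + 2"
  proof -
    have "verts G = insert v (insert w V)" using vw by (auto simp: V_def)
    moreover have "v \<notin> insert w V" "w \<notin> V" using \<open>v \<noteq> w\<close> by (auto simp: V_def)
    ultimately show ?thesis using fE by simp
  qed
  \<comment> \<open>From 4(|V| + 2) = 2 |edges| and |edges| = |E| + 8 - |Evw|.\<close>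
  ultimately have cE: "card E + 4 = 2 * card V + card Evw" using cv cw by linarith

  have zw: "zero_count 2 (delete_vertex G v) = Sw.zeros"
  proof -
    let ?H = "delete_vertex G v"
    have "edges ?H = E \<union> Ew" by (auto simp: delete_vertex_def E_def Ew_def)
    moreover have "verts ?H - {w} = V" "ends ?H = ?nd" "w \<in> verts ?H"
      using vw \<open>v \<noteq> w\<close> by (auto simp: delete_vertex_def V_def)
    ultimately show ?thesis
      using zero_count_2[OF wf_delete_vertex[OF wf], of w v]
        cob.card_zeros_split[OF fE(1,3) Sw.W(2), of ?nd "vecs V"]
      by (simp add: Sw.zeros_def)
  qed
  have zv: "zero_count 2 (delete_vertex G w) = Sv.zeros"
  proof -
    let ?H = "delete_vertex G w"
    have "edges ?H = E \<union> Ev" by (auto simp: delete_vertex_def E_def Ev_def)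
    moreover have "verts ?H - {v} = V" "ends ?H = ?nd" "v \<in> verts ?H"
      using vw \<open>v \<noteq> w\<close> by (auto simp: delete_vertex_def V_def)
    ultimately show ?thesis
      using zero_count_2[OF wf_delete_vertex[OF wf], of v w]
        cob.card_zeros_split[OF fE(1,2) Sv.W(2), of ?nd "vecs V"]
      by (simp add: Sv.zeros_def)
  qed

  \<comment> \<open>Both stars are placed in one configuration, so that trees completed by an edge
    at \<open>v\<close> can be compared with those completed by an edge at \<open>w\<close>.\<close>
  interpret B: pointed_forms "cob ?nd" "vecs V" E "Ev \<union> Ew" "\<lambda>x. of_bool (x \<in> V)"
  proof
    show "E \<inter> (Ev \<union> Ew) = {}" using Sv.W Sw.W by blast
    show "cob ?nd s (\<lambda>x. of_bool (x \<in> V)) = 1" if "s \<in> Ev \<union> Ew" for s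
      using that Sv.P.one(3) Sw.P.one(3) by blast
  qed (use Sw.P.U Sw.P.S Sw.P.one in auto)
  have root: "cob.dual_sum ?nd (vecs V) E {s} A = cob.dual_sum ?nd (vecs V) E {t} A"
    if "s \<in> Ev" "t \<in> Ew" for s t A
    using B.dual_sum_root that by blast

  have nbw: "pw e \<in> neighbours G w" if "e \<in> Ew" for e
    using pw[OF that] that by (auto simp: neighbours_def Ew_def)
  have nbv: "pv e \<in> neighbours G v" if "e \<in> Ev" for e
    using pv[OF that] that by (auto simp: neighbours_def Ev_def)
  have "pw ` Ew \<subseteq> neighbours G w" "pv ` Ev \<subseteq> neighbours G v"
    using nbw nbv by (simp_all add: image_subset_iff)
  then have PQ: "pw ` Ew \<inter> pv ` Ev = {}" using assms(7) by blast
  have PV: "pw ` Ew \<subseteq> V" "pv ` Ev \<subseteq> V" using pw pv by (simp_all add: image_subset_iff)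

  have goal: "Sw.zeros div 4 mod 2 = Sv.zeros div 4 mod 2"
  proof -
    have "card Evw \<ge> 1" using Evw_ne fE by (simp add: Suc_le_eq card_gt_0_iff)
    \<comment> \<open>Four, three, two and one edges between \<open>v\<close> and \<open>w\<close>,
      in this order.\<close>
    then consider "card Ew = 0" "card Ev = 0" | "card Ew = 1" "card Ev = 1"
      | "card Ew = 2" "card Ev = 2" | "card Ew = 3" "card Ev = 3"
      using cv cw by linarith
    then show ?thesis
    proof cases
      case 1
      then have "Ew = {}" "Ev = {}" using fE by auto
      then show ?thesis by (simp add: Sw.zeros_def Sv.zeros_def)
    next
      case 2
      then obtain s t where st: "Ew = {s}" "Ev = {t}" by (auto simp: card_1_singleton_iff)
      then show ?thesis unfolding Sw.zeros1[OF st(1)] Sv.zeros1[OF st(2)] using root[of t s] by simp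
    next
      case 3
      then obtain s1 s2 t1 t2 where st: "Ew = {s1, s2}" "s1 \<noteq> s2" "Ev = {t1, t2}" "t1 \<noteq> t2"
        by (auto simp: card_2_iff)
      have m: "card E + 2 = 2 * card V" using cE cw 3 by linarith
      have r: "cob.dual_sum ?nd (vecs V) E {t1} A = cob.dual_sum ?nd (vecs V) E {s1} A" for A
        using root st by simp
      \<comment> \<open>The end sets of the two stars are disjoint and nonempty, so on at most two
        vertices each of them is a single vertex.\<close>
      have d: "card V \<ge> 3 \<or> pw s1 = pw s2 \<and> pv t1 = pv t2"
      proof (rule ccontr)
        assume n: "\<not> ?thesis"
        have "card (pw ` Ew \<union> pv ` Ev) = card (pw ` Ew) + card (pv ` Ev)"
          using fE PQ by (intro card_Un_disjoint) auto
        moreover have "card (pw ` Ew \<union> pv ` Ev) \<le> card V" using PV fE by (intro card_mono) auto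
        ultimately show False using n st by (auto simp: card_insert_if split: if_splits)
      qed
      have "(of_nat (card {A \<in> Pow E. Sw.ds {s1} A = 0 \<and> Sw.ds {s1, s2} A = 0}) :: bit) =
          of_nat (card {A \<in> Pow E. Sv.ds {t1} A = 0 \<and> Sv.ds {t1, t2} A = 0})"
        using Sw.zeros2_parity[OF st(1,2) _ m] Sv.zeros2_parity[OF st(3,4) _ m] d r by auto
      then have par: "card {A \<in> Pow E. Sw.ds {s1} A = 0 \<and> Sw.ds {s1, s2} A = 0} mod 2 =
          card {A \<in> Pow E. Sv.ds {t1} A = 0 \<and> Sv.ds {t1, t2} A = 0} mod 2"
        by (rule of_nat_bit_mod_2)
      \<comment> \<open>The summand with factor 2 counts the points with odd tree count and agrees
        for both stars; only the parity of the other count matters.\<close>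
      have div: "(2 * a + 4 * c) div 4 mod 2 = (2 * a + 4 * c') div 4 mod 2" if "c mod 2 = c' mod 2"
        for a c c' :: nat
      proof -
        have "(2 * a + 4 * x) div 4 = a div 2 + x" for x by simp
        then show ?thesis using that by (metis mod_add_right_eq)
      qed
      show ?thesis
        unfolding Sw.zeros2[OF st(1,2)] Sv.zeros2[OF st(3,4)] r by (rule div[OF par[unfolded r]])
    next
      case 4
      then obtain s1 s2 s3 t1 t2 t3 where
        s: "Ew = {s1, s2, s3}" "s1 \<noteq> s2" "s1 \<noteq> s3" "s2 \<noteq> s3" and
        t: "Ev = {t1, t2, t3}" "t1 \<noteq> t2" "t1 \<noteq> t3" "t2 \<noteq> t3"
        by (auto simp: card_3_iff)
      have m: "card E + 3 = 2 * card V" using cE cw 4 by linarith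
      have r: "cob.dual_sum ?nd (vecs V) E {t1} A = cob.dual_sum ?nd (vecs V) E {s1} A" for A
        using root s t by simp
      let ?bw = "\<lambda>A. Sw.ds {s1} A = 0 \<and> Sw.ds {s1, s2} A = 0 \<and> Sw.ds {s1, s3} A = 0 \<and> Sw.ds {s2, s3} A = 0"
      let ?bv = "\<lambda>A. Sv.ds {t1} A = 0 \<and> Sv.ds {t1, t2} A = 0 \<and> Sv.ds {t1, t3} A = 0 \<and> Sv.ds {t2, t3} A = 0"
      have "(\<Sum>A\<in>Pow E. of_bool (?bw A) :: bit) = (\<Sum>A\<in>Pow E. of_bool (?bv A))"
      proof (cases "card V \<ge> 3")
        case False
        \<comment> \<open>On at most two vertices each star is attached at a single vertex, so all
          pair coefficients vanish and only the tree coefficient is left.\<close>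
        have "card (pw ` Ew \<union> pv ` Ev) = card (pw ` Ew) + card (pv ` Ev)"
          using fE PQ by (intro card_Un_disjoint) auto
        moreover have "card (pw ` Ew \<union> pv ` Ev) \<le> card V" using PV fE by (intro card_mono) auto
        moreover have "card (pw ` Ew) > 0" "card (pv ` Ev) > 0" using s t by (auto simp: card_gt_0_iff)
        ultimately have "card (pw ` Ew) = 1" "card (pv ` Ev) = 1" using False by linarith+
        then have "pw s1 = pw s2" "pw s1 = pw s3" "pv t1 = pv t2" "pv t1 = pv t3"
          using s t by (auto simp: card_1_singleton_iff)
        then show ?thesis
          using s t Sw.dual_sum_same_end Sv.dual_sum_same_end r by simp
      next
        case True
        have sW: "s1 \<in> Ew" "s2 \<in> Ew" "s3 \<in> Ew" and tW: "t1 \<in> Ev" "t2 \<in> Ev" "t3 \<in> Ev" using s t by auto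
        let ?P = "pw ` Ew" and ?Q = "pv ` Ev"
        have P: "?P = {pw s1, pw s2, pw s3}" "?Q = {pv t1, pv t2, pv t3}" using s t by auto
        have "(\<Sum>A\<in>Pow E. of_bool (?bw A) :: bit) = (\<Sum>S\<in>Pow E. of_bool (full_on ?P (cob.radical ?nd (vecs V) S)))"
          unfolding P by (rule Sw.sum_bad3[OF sW s(2-4) True m])
        moreover have "(\<Sum>A\<in>Pow E. of_bool (?bv A) :: bit) = (\<Sum>S\<in>Pow E. of_bool (full_on ?Q (cob.radical ?nd (vecs V) S)))"
          unfolding P by (rule Sv.sum_bad3[OF tW t(2-4) True m])
        moreover have "(\<Sum>S\<in>Pow E. of_bool (full_on ?P (cob.radical ?nd (vecs V) S)) :: bit) =
            (\<Sum>S\<in>Pow E. of_bool (full_on ?Q (cob.radical ?nd (vecs V) S)))"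
        \<comment> \<open>With a loop both sides are 0. Without one, the degree of a vertex of
          \<open>V\<close> is the number of its incident edges.\<close>
        proof (cases "\<exists>l\<in>E. card (?nd l) = 1")
          case True
          then show ?thesis using Sw.sum_radical_loop_eq_0 by metis
        next
          case nl: False
          have cx: "card (?at E x) + card (?at Ew x) + card (?at Ev x) = 4"
            if x: "x \<in> V" for x
          proof -
            have xG: "x \<in> verts G" "x \<noteq> v" "x \<noteq> w" using x by (auto simp: V_def)
            have "e \<notin> edges G" if "?nd e = {x}" for e
              using nl that xG by (auto simp: E_def)
            then have l: "{e \<in> edges G. ?nd e = {x}} = {}" by auto
            have 4: "card (?at (edges G) x) = 4"
              using deg[OF xG(1)] unfolding degree_def l by simp
            have "x \<notin> ?nd e" if "e \<in> Evw" for e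
            proof -
              have e: "e \<in> edges G" "v \<in> ?nd e" "w \<in> ?nd e" using that by (auto simp: Evw_def)
              then obtain y where "?nd e = {v, y}" using pair by blast
              then show ?thesis using e \<open>v \<noteq> w\<close> xG by auto
            qed
            then have "?at (edges G) x =
                (?at E x \<union> ?at Ew x) \<union> ?at Ev x"
              by (auto simp: E_def Ew_def Ev_def Evw_def)
            moreover have "card ((?at E x \<union> ?at Ew x) \<union> ?at Ev x) =
                card (?at E x \<union> ?at Ew x) + card (?at Ev x)"
              using fin by (intro card_Un_disjoint) (auto simp: E_def Ew_def Ev_def)
            moreover have "card (?at E x \<union> ?at Ew x) =
                card (?at E x) + card (?at Ew x)"
              using fin by (intro card_Un_disjoint) (auto simp: E_def Ew_def)
            ultimately show ?thesis using 4 by simp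
          qed
          have ew: "x \<in> ?nd e \<longleftrightarrow> x = pw e" if "e \<in> Ew" "x \<in> V" for e x
            using pw[OF that(1)] that(2) by (auto simp: V_def)
          have ev: "x \<in> ?nd e \<longleftrightarrow> x = pv e" if "e \<in> Ev" "x \<in> V" for e x
            using pv[OF that(1)] that(2) by (auto simp: V_def)
          have ew0: "?at Ew x = {}" if "x \<in> V" "x \<notin> ?P" for x using ew that by auto
          have ev0: "?at Ev x = {}" if "x \<in> V" "x \<notin> ?Q" for x using ev that by auto
          \<comment> \<open>Three distinct ends of three edges make \<open>pw\<close> injective, so
            exactly one star edge arrives at each of them.\<close>
          have ew1: "card (?at Ew x) = 1" if x: "x \<in> ?P" and c: "card ?P = 3" for x
          proof -
            have inj: "inj_on pw Ew" using c 4 fE by (intro eq_card_imp_inj_on) auto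
            obtain e where e: "e \<in> Ew" "x = pw e" using x by blast
            have "?at Ew x = {e}"
              using ew PV(1) e inj by (auto dest: inj_onD)
            then show ?thesis by simp
          qed
          have ev1: "card (?at Ev x) = 1" if x: "x \<in> ?Q" and c: "card ?Q = 3" for x
          proof -
            have inj: "inj_on pv Ev" using c 4 fE by (intro eq_card_imp_inj_on) auto
            obtain e where e: "e \<in> Ev" "x = pv e" using x by blast
            have "?at Ev x = {e}"
              using ev PV(2) e inj by (auto dest: inj_onD)
            then show ?thesis by simp
          qed
          show ?thesis
          proof (rule Sw.sum_full_on_swap[OF PV PQ])
            show "card ?P \<le> 3" "card ?Q \<le> 3" using 4 fE card_image_le by metis+
            show "card (?at E x) = 4" if "x \<in> V" "x \<notin> ?P" "x \<notin> ?Q" for x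
              using cx[OF that(1)] unfolding ew0[OF that(1,2)] ev0[OF that(1,3)] by simp
            show "card (?at E x) = 3" if "x \<in> ?P" "card ?P = 3" for x
            proof -
              have "x \<in> V" "x \<notin> ?Q" using that PV PQ by auto
              then show ?thesis using cx[of x] ew1[OF that] unfolding ev0[OF \<open>x \<in> V\<close> \<open>x \<notin> ?Q\<close>] by simp
            qed
            show "card (?at E x) = 3" if "x \<in> ?Q" "card ?Q = 3" for x
            proof -
              have "x \<in> V" "x \<notin> ?P" using that PV PQ by auto
              then show ?thesis using cx[of x] ev1[OF that] unfolding ew0[OF \<open>x \<in> V\<close> \<open>x \<notin> ?P\<close>] by simp
            qed
          qed
        qed
        ultimately show ?thesis by simp
      qed
      then have "(of_nat (Sw.zeros div 4) :: bit) = of_nat (Sv.zeros div 4)"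
        unfolding Sw.zeros3_parity[OF s] Sv.zeros3_parity[OF t] by (simp add: sum.distrib)
      then show ?thesis by (rule of_nat_bit_mod_2)
    qed
  qed
  then show ?thesis unfolding c2_def zw zv by (simp add: power2_eq_square)
qed

end
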